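(* Let $(X,d,\mu)$ be a space of homogeneous type with wavelet basis $\{\psi_\alpha^k\}$ of Hölder exponent $\eta$, and let $\beta,\gamma\in(0,\eta)$. Suppose $f\in\mathring{G}(\beta,\gamma)$. Then the wavelet reproducing formula $$f(x)=\sum_{k\in\mathbb{Z}}\sum_{\alpha\in\mathscr{Y}^k}\langle f,\psi_\alpha^k\rangle\,\psi_\alpha^k(x)$$ holds in $\mathring{G}(\beta',\gamma')$ (i.e. the partial sums over $|k|\le L$ converge to $f$ in the norm of $\mathring{G}(\beta',\gamma')$ as $L\to\infty$) for all $\beta'\in(0,\beta)$ and $\gamma'\in(0,\gamma)$.
   Context: Space of homogeneous type: $(X,d,\mu)$ where $d$ is a quasi-metric on $X$ ($d(x,y)=d(y,x)\ge 0$, $d(x,y)=0$ iff $x=y$, and $d(x,y)\le A_0[d(x,z)+d(z,y)]$ for a constant $A_0\ge 1$), and $\mu$ is a nonzero measure with $\mu(B(x,2r))\le C_\mu\,\mu(B(x,r))<\infty$ for all $x\in X$, $r>0$, where $B(x,r)=\{y: d(x,y)<r\}$. Standing assumptions: $\mu(X)=\infty$ and $\mu(B(x,r))>0$ for all $x\in X$, $r>0$. No further assumptions on $d$ or $\mu$. Notation: $V_r(x)=\mu(B(x,r))$, $V(x,y)=\mu(B(x,d(x,y)))$. Reference dyadic points: fix a small $\delta\in(0,1)$ (e.g. $\delta\le 10^{-3}A_0^{-10}$). $\mathscr{X}^0$ is a maximal collection of $1$-separated points of $X$; inductively for $k\ge1$, $\mathscr{X}^k\supseteq\mathscr{X}^{k-1}$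 and $\mathscr{X}^{-k}\subseteq\mathscr{X}^{-(k-1)}$ are maximal $\delta^k$- and $\delta^{-k}$-separated collections in $X$ and $\mathscr{X}^{-(k-1)}$ respectively. Thus distinct points of $\mathscr{X}^k=\{x_\alpha^k\}_\alpha$ are at distance $\ge\delta^k$ and $\min_\alpha d(x,x_\alpha^k)<2A_0\delta^k$ for all $x\in X$. Put $\mathscr{Y}^k=\mathscr{X}^{k+1}\setminus\mathscr{X}^k$, with points denoted $y_\alpha^k$ (indices $\alpha$ are identified with points). Wavelets: $\{\psi_\alpha^k\}_{k\in\mathbb{Z},\alpha\in\mathscr{Y}^k}$ is the Auscher--Hytönen orthonormal basis of $L^2(X)$, which satisfies, with $a=(1+2\log_2A_0)^{-1}$ and constants $C<\infty$, $\nu>0$, $\eta\in(0,1]$ independent of $k,\alpha,x,y$: $|\psi_\alpha^k(x)|\le C\mu(B(y_\alpha^k,\delta^k))^{-1/2}\exp(-\nu(d(y_\alpha^k,x)/\delta^k)^a)$; $|\psi_\alpha^k(x)-\psi_\alpha^k(y)|\le C\mu(B(y_\alpha^k,\delta^k))^{-1/2}(d(x,y)/\delta^k)^\eta\exp(-\nu(d(y_\alpha^k,x)/\delta^k)^a)$ whenever $d(x,y)\le\delta^k$; and $\int_X\psi_\alpha^k\,d\mu=0$. Test functions: for $x_0\in X$, $r>0$, $\beta\in(0,\eta]$, $\gamma>0$, $G(x_0,r,\beta,\gamma)$ is the set of functions $f$ on $X$ for which there is $C>0$ with (i) $|f(x)|\le C\frac{1}{V_r(x_0)+V(x,x_0)}\big(\frac{r}{r+d(x,x_0)}\big)^\gamma$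 for all $x\in X$; (ii) $|f(x)-f(y)|\le C\big(\frac{d(x,y)}{r+d(x,x_0)}\big)^\beta\frac{1}{V_r(x_0)+V(x,x_0)}\big(\frac{r}{r+d(x,x_0)}\big)^\gamma$ for all $x,y$ with $d(x,y)<(2A_0)^{-1}(r+d(x,x_0))$; and (iii) $\int_X f\,d\mu=0$. Its norm is the infimum of $C$ for which (i) and (ii) hold. Fix $x_0$ and set $G(\beta,\gamma)=G(x_0,1,\beta,\gamma)$ (a Banach space; other choices of $x_0$, $r$ give equivalent norms). $\mathring{G}(\beta,\gamma)$ is the completion of $G(\eta,\gamma)$ in the norm of $G(\beta,\gamma)$, with that norm. *)

theory Defs
  imports "HOL-Analysis.Analysis"
begin

section \<open>Spaces of homogeneous type\<close>

text \<open>The underlying set is the whole type; the library's \<open>ball\<close> needs a metric,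
  so balls of a quasi-metric \<open>d\<close> are defined here.\<close>

definition qball :: "('a \<Rightarrow> 'a \<Rightarrow> real) \<Rightarrow> 'a \<Rightarrow> real \<Rightarrow> 'a set" where
  "qball d x r = {y. d x y < r}"

definition vol :: "('a \<Rightarrow> 'a \<Rightarrow> real) \<Rightarrow> 'a measure \<Rightarrow> real \<Rightarrow> 'a \<Rightarrow> real" where
  "vol d M r x = measure M (qball d x r)"

definition vol2 :: "('a \<Rightarrow> 'a \<Rightarrow> real) \<Rightarrow> 'a measure \<Rightarrow> 'a \<Rightarrow> 'a \<Rightarrow> real" where
  "vol2 d M x y = measure M (qball d x (d x y))"

text \<open>Measurability of balls is implicit in \<open>ball_pos\<close>, since \<open>emeasure\<close> vanishes
  on non-measurable sets.\<close>

locale homogeneous_type =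
  fixes d :: "'a \<Rightarrow> 'a \<Rightarrow> real" and A0 :: real and M :: "'a measure"
  assumes d_sym: "d x y = d y x"
    and d_nonneg: "0 \<le> d x y"
    and d_eq_0: "d x y = 0 \<longleftrightarrow> x = y"
    and A0_ge_1: "1 \<le> A0"
    and d_quasi_triangle: "d x y \<le> A0 * (d x z + d z y)"
    and space_M: "space M = UNIV"
    and doubling: "\<exists>C. \<forall>x r. 0 < r \<longrightarrow>
          emeasure M (qball d x (2 * r)) \<le> ennreal C * emeasure M (qball d x r)"
    and ball_finite: "0 < r \<Longrightarrow> emeasure M (qball d x r) < \<infinity>"
    and ball_pos: "0 < r \<Longrightarrow> 0 < emeasure M (qball d x r)"
    and total_infinite: "emeasure M (space M) = \<infinity>"

section \<open>Reference dyadic points\<close>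

definition separated :: "('a \<Rightarrow> 'a \<Rightarrow> real) \<Rightarrow> real \<Rightarrow> 'a set \<Rightarrow> bool" where
  "separated d s A \<longleftrightarrow> (\<forall>x\<in>A. \<forall>y\<in>A. x \<noteq> y \<longrightarrow> s \<le> d x y)"

definition maximal_separated :: "('a \<Rightarrow> 'a \<Rightarrow> real) \<Rightarrow> real \<Rightarrow> 'a set \<Rightarrow> 'a set \<Rightarrow> bool" where
  "maximal_separated d s S A \<longleftrightarrow> A \<subseteq> S \<and> separated d s A \<and>
     (\<forall>B. A \<subseteq> B \<and> B \<subseteq> S \<and> separated d s B \<longrightarrow> B = A)"

text \<open>For \<open>k \<ge> 0\<close> the set \<open>X k\<close> is maximal in the whole space, for \<open>k < 0\<close> only in the next
  finer set \<open>X (k + 1)\<close>. The construction is usually made with \<open>\<delta>\<close> small depending on \<open>A0\<close>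
  (say \<open>\<delta> \<le> 1 / (1000 * A0 ^ 10)\<close>); every \<open>\<delta>\<close> between 0 and 1 is admitted here.\<close>

definition reference_points :: "('a \<Rightarrow> 'a \<Rightarrow> real) \<Rightarrow> real \<Rightarrow> (int \<Rightarrow> 'a set) \<Rightarrow> bool" where
  "reference_points d \<delta> X \<longleftrightarrow>
     (\<forall>k. X k \<subseteq> X (k + 1)) \<and>
     (\<forall>k\<ge>0. maximal_separated d (\<delta> powi k) UNIV (X k)) \<and>
     (\<forall>k<0. maximal_separated d (\<delta> powi k) (X (k + 1)) (X k))"

definition new_points :: "(int \<Rightarrow> 'a set) \<Rightarrow> int \<Rightarrow> 'a set" where
  "new_points X k = X (k + 1) - X k"

section \<open>Orthonormal wavelet bases\<close>

definition square_integrable :: "'a measure \<Rightarrow> ('a \<Rightarrow> complex) \<Rightarrow> bool" where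
  "square_integrable M f \<longleftrightarrow> f \<in> borel_measurable M \<and> integrable M (\<lambda>x. (cmod (f x))\<^sup>2)"

definition l2_inner :: "'a measure \<Rightarrow> ('a \<Rightarrow> complex) \<Rightarrow> ('a \<Rightarrow> complex) \<Rightarrow> complex" where
  "l2_inner M f g = (LINT x|M. f x * cnj (g x))"

text \<open>The last conjunct says that the linear span of the family is dense in the space
  of square-integrable functions.\<close>

definition orthonormal_basis :: "'a measure \<Rightarrow> 'i set \<Rightarrow> ('i \<Rightarrow> 'a \<Rightarrow> complex) \<Rightarrow> bool" where
  "orthonormal_basis M I e \<longleftrightarrow>
     (\<forall>i\<in>I. square_integrable M (e i)) \<and>
     (\<forall>i\<in>I. \<forall>j\<in>I. l2_inner M (e i) (e j) = (if i = j then 1 else 0)) \<and>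
     (\<forall>f. square_integrable M f \<longrightarrow>
        (\<forall>\<epsilon>>0. \<exists>F c. finite F \<and> F \<subseteq> I \<and>
           (LINT x|M. (cmod (f x - (\<Sum>i\<in>F. c i * e i x)))\<^sup>2) < \<epsilon>))"

text \<open>The locale collects the properties of the Auscher--Hytonen wavelets; \<open>\<psi> k y\<close> is the
  wavelet of scale \<open>\<delta> powi k\<close> centred at \<open>y \<in> new_points X k\<close> (its values for other \<open>y\<close>
  are irrelevant). Scalars are complex, which includes real-valued wavelets.\<close>

locale wavelet_basis = homogeneous_type d A0 M
  for d :: "'a \<Rightarrow> 'a \<Rightarrow> real" and A0 :: real and M :: "'a measure" +
  fixes \<delta> :: real and X :: "int \<Rightarrow> 'a set"
    and \<eta> :: real and \<psi> :: "int \<Rightarrow> 'a \<Rightarrow> 'a \<Rightarrow> complex"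
  assumes \<delta>_range: "0 < \<delta>" "\<delta> < 1"
    and reference_points: "reference_points d \<delta> X"
    and \<eta>_range: "0 < \<eta>" "\<eta> \<le> 1"
    and basis: "orthonormal_basis M (SIGMA k:UNIV. new_points X k) (\<lambda>(k, y). \<psi> k y)"
    and estimates: "\<exists>C \<nu>. 0 < \<nu> \<and> (\<forall>k. \<forall>y\<in>new_points X k.
          (\<forall>x. cmod (\<psi> k y x) \<le> C * vol d M (\<delta> powi k) y powr (- 1 / 2)
             * exp (- \<nu> * (d y x / \<delta> powi k) powr (1 / (1 + 2 * log 2 A0)))) \<and>
          (\<forall>x z. d x z \<le> \<delta> powi k \<longrightarrow>
             cmod (\<psi> k y x - \<psi> k y z) \<le> C * vol d M (\<delta> powi k) y powr (- 1 / 2)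
             * (d x z / \<delta> powi k) powr \<eta>
             * exp (- \<nu> * (d y x / \<delta> powi k) powr (1 / (1 + 2 * log 2 A0)))))"
    and cancellation: "y \<in> new_points X k \<Longrightarrow> has_bochner_integral M (\<psi> k y) 0"

section \<open>Test functions\<close>

definition test_bound :: "('a \<Rightarrow> 'a \<Rightarrow> real) \<Rightarrow> real \<Rightarrow> 'a measure \<Rightarrow> 'a \<Rightarrow> real \<Rightarrow> real \<Rightarrow> real
    \<Rightarrow> ('a \<Rightarrow> complex) \<Rightarrow> real \<Rightarrow> bool" where
  "test_bound d A0 M x0 r \<beta> \<gamma> f C \<longleftrightarrow>
     (\<forall>x. cmod (f x) \<le> C * (1 / (vol d M r x0 + vol2 d M x x0))
        * (r / (r + d x x0)) powr \<gamma>) \<and>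
     (\<forall>x y. d x y < (r + d x x0) / (2 * A0) \<longrightarrow>
        cmod (f x - f y) \<le> C * (d x y / (r + d x x0)) powr \<beta>
        * (1 / (vol d M r x0 + vol2 d M x x0)) * (r / (r + d x x0)) powr \<gamma>)"

definition test_functions :: "('a \<Rightarrow> 'a \<Rightarrow> real) \<Rightarrow> real \<Rightarrow> 'a measure \<Rightarrow> 'a \<Rightarrow> real \<Rightarrow> real \<Rightarrow> real
    \<Rightarrow> ('a \<Rightarrow> complex) set" where
  "test_functions d A0 M x0 r \<beta> \<gamma> =
     {f. (\<exists>C>0. test_bound d A0 M x0 r \<beta> \<gamma> f C) \<and> has_bochner_integral M f 0}"

definition test_norm :: "('a \<Rightarrow> 'a \<Rightarrow> real) \<Rightarrow> real \<Rightarrow> 'a measure \<Rightarrow> 'a \<Rightarrow> real \<Rightarrow> real \<Rightarrow> real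
    \<Rightarrow> ('a \<Rightarrow> complex) \<Rightarrow> real" where
  "test_norm d A0 M x0 r \<beta> \<gamma> f = Inf {C. 0 < C \<and> test_bound d A0 M x0 r \<beta> \<gamma> f C}"

text \<open>The completion of the test functions of exponents \<open>(\<eta>, \<gamma>)\<close> in the \<open>(\<beta>, \<gamma>)\<close>-norm,
  realised as their closure in the Banach space of test functions of exponents \<open>(\<beta>, \<gamma>)\<close>,
  so that its elements are functions. Its norm is the \<open>(\<beta>, \<gamma>)\<close>-norm, with \<open>r = 1\<close>.\<close>

definition completed_test_functions :: "('a \<Rightarrow> 'a \<Rightarrow> real) \<Rightarrow> real \<Rightarrow> 'a measure \<Rightarrow> real \<Rightarrow> 'a
    \<Rightarrow> real \<Rightarrow> real \<Rightarrow> ('a \<Rightarrow> complex) set" where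
  "completed_test_functions d A0 M \<eta> x0 \<beta> \<gamma> =
     {f \<in> test_functions d A0 M x0 1 \<beta> \<gamma>.
        \<exists>g. (\<forall>n. g n \<in> test_functions d A0 M x0 1 \<eta> \<gamma>) \<and>
            (\<lambda>n::nat. test_norm d A0 M x0 1 \<beta> \<gamma> (\<lambda>x. g n x - f x)) \<longlonglongrightarrow> 0}"

definition wavelet_partial_sum :: "'a measure \<Rightarrow> (int \<Rightarrow> 'a set) \<Rightarrow> (int \<Rightarrow> 'a \<Rightarrow> 'a \<Rightarrow> complex)
    \<Rightarrow> ('a \<Rightarrow> complex) \<Rightarrow> nat \<Rightarrow> 'a \<Rightarrow> complex" where
  "wavelet_partial_sum M X \<psi> f L x =
     (\<Sum>k = - int L..int L. \<Sum>\<^sub>\<infinity>y\<in>new_points X k. l2_inner M f (\<psi> k y) * \<psi> k y x)"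

end

theory Submission
  imports Defs
begin

text \<open>Fix a level \<open>k\<close> with scale \<open>r = \<delta> powi k\<close> and let \<open>block k f\<close> be the sum of the terms of the wavelet
expansion at that level. With \<open>decay x0 \<kappa> t = t powr (- \<kappa>) / V t x0\<close>, a test function of exponents
\<open>(\<beta>, \<gamma>)\<close> is, up to a constant, a function with
\<open>\<bar>f x\<bar> \<le> decay x0 \<gamma> (1 + d x x0)\<close> and
\<open>\<bar>f x - f y\<bar> \<le> d x y powr \<beta> * decay x0 (\<beta> + \<gamma>) (1 + d x x0)\<close> for \<open>y\<close> near \<open>x\<close>
(\<open>smooth_bound\<close>, \<open>test_bound_equiv_ex\<close>). The theorem rests on one estimate for the wavelet
coefficients (\<open>coefficient_bound_ex\<close>): up to a constant,
\<open>\<bar>\<langle>f, \<psi> k y\<rangle>\<bar> \<le> V r y powr (1/2) * r powr \<beta> * decay x0 (\<beta> + \<gamma>) (max 1 r + d y x0)\<close>.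

At fine scales \<open>r \<le> 1\<close> the cancellation of the wavelet lets one replace \<open>f\<close> by \<open>f - f y\<close>. This
difference grows at most like a power of \<open>1 + d y z / r\<close>, and the wavelet decays faster than every such
power. At coarse scales \<open>r \<ge> 1\<close> the function \<open>f\<close> resembles an atom concentrated at \<open>x0\<close>: away
from \<open>x0\<close> the argument is the same as before, and near \<open>x0\<close> the cancellation of \<open>f\<close> allows one to
subtract the value of the wavelet at \<open>x0\<close>. The Hoelder continuity of the wavelet then brings in the
moment of \<open>\<bar>f\<bar>\<close> against \<open>min 1 ((1 + d z x0) / r) powr \<eta>\<close>, which is of size \<open>r powr (- \<gamma>)\<close> exactly
because \<open>\<gamma> < \<eta>\<close>.

The wavelets of one level are centred at separated points and concentrated at scale \<open>r\<close>, and the bound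
on the coefficients changes only by powers of \<open>1 + d x y / r\<close> from place to place. Summation over the
centres therefore gives the same bound for \<open>block k f\<close>, and for its increments the same bound
with the additional factor \<open>(d x x' / r) powr \<eta>\<close> (\<open>block_bound_ex\<close>). Two consequences follow
(\<open>block_smooth_ex\<close>). Giving up \<open>\<epsilon> = min (\<beta> - \<beta>') (\<gamma> - \<gamma>')\<close> in the exponents gains the
factor \<open>(\<delta> powr \<epsilon>) ^ nat \<bar>k\<bar>\<close>, so the series over \<open>k\<close> converges geometrically in the
\<open>(\<beta>', \<gamma>')\<close>-norm. Giving up nothing, each \<open>block k\<close> is bounded on the test functions of exponents
\<open>(\<beta>, \<gamma>)\<close> and on those of exponents \<open>(\<eta>, \<gamma>)\<close>, so partial sums remain in the completed space
(\<open>partial_sum_completed\<close>).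

It remains to recognise the sum \<open>h\<close> of the series as \<open>f\<close> (\<open>partial_sums_converge\<close>). Dominated
convergence shows that \<open>h - f\<close> is orthogonal to every wavelet, so completeness of the basis makes it zero
almost everywhere; it is Hoelder continuous and balls have positive measure, so it is zero everywhere.\<close>

section \<open>Volume growth and decay profiles\<close>

context homogeneous_type
begin

abbreviation V :: "real \<Rightarrow> 'a \<Rightarrow> real" where "V \<equiv> vol d M"

lemma d_self [simp]: "d x x = 0"
  using d_eq_0 by blast

lemma A0_pos: "0 < A0" using A0_ge_1 by linarith

lemma qball_sets [measurable]: "qball d x r \<in> sets M"
proof (cases "0 < r")
  case True
  then show ?thesis using ball_pos[of r x] emeasure_notin_sets by fastforce
next
  case False
  then have "qball d x r = {}" by (auto simp: qball_def not_less intro: order_trans[OF _ d_nonneg])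
  then show ?thesis by simp
qed

lemma d_measurable [measurable]: "(\<lambda>z. d x z) \<in> borel_measurable M" "(\<lambda>z. d z x) \<in> borel_measurable M"
proof -
  show "(\<lambda>z. d x z) \<in> borel_measurable M"
    by (subst borel_measurable_iff_less) (use qball_sets in \<open>simp add: space_M qball_def\<close>)
  then show "(\<lambda>z. d z x) \<in> borel_measurable M" by (simp add: d_sym[of _ x])
qed

lemma emeasure_qball: "0 < r \<Longrightarrow> emeasure M (qball d x r) = ennreal (V r x)"
  unfolding vol_def using ball_finite[of r x]
  by (intro emeasure_eq_ennreal_measure) auto

lemma V_pos: "0 < r \<Longrightarrow> 0 < V r x"
  using ball_pos[of r x] emeasure_qball[of r x] by simp

lemma V_nonneg [simp]: "0 \<le> V r x"
  by (simp add: vol_def)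

lemma V_mono_ball:
  assumes "qball d x r \<subseteq> qball d y s" "0 < s"
  shows "V r x \<le> V s y"
  unfolding vol_def measure_def using assms ball_finite[of s y]
  by (intro enn2real_mono emeasure_mono) auto

lemma V_mono: "r \<le> s \<Longrightarrow> V r x \<le> V s x"
proof (cases "0 < s")
  case True
  then show "r \<le> s \<Longrightarrow> ?thesis" by (intro V_mono_ball) (auto simp: qball_def)
next
  case False
  assume "r \<le> s"
  with False have "qball d x r = {}" by (auto simp: qball_def not_less intro: order_trans[OF _ d_nonneg])
  then show ?thesis by (simp add: vol_def)
qed

lemma V_measurable [measurable]: "(\<lambda>t. V t y) \<in> borel_measurable borel"
  by (rule borel_measurable_mono) (auto simp: mono_def V_mono)

lemma V_measurable_comp [measurable]:
  "\<rho> \<in> borel_measurable N \<Longrightarrow> (\<lambda>z. V (\<rho> z) y) \<in> borel_measurable N"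
  by (rule measurable_compose[OF _ V_measurable])

lemma qball_subset:
  assumes "A0 * (d x y + r) \<le> s"
  shows "qball d x r \<subseteq> qball d y s"
proof
  fix z assume "z \<in> qball d x r"
  then have z: "d x z < r" by (simp add: qball_def)
  have "d y z \<le> A0 * (d x y + d x z)" using d_quasi_triangle[of y z x] d_sym[of y x] by simp
  also have "\<dots> < A0 * (d x y + r)" using z A0_pos by simp
  finally show "z \<in> qball d y s" using assms by (simp add: qball_def)
qed

text \<open>Iterating the doubling inequality turns it into polynomial growth with exponent
\<open>\<omega> = log 2 D\<close>, the homogeneous dimension.\<close>

lemma V_growth_ex:
  "\<exists>D \<omega>. 1 \<le> D \<and> 0 \<le> \<omega> \<and>
    (\<forall>x r l. 0 < r \<longrightarrow> 1 \<le> l \<longrightarrow> V (l * r) x \<le> D * l powr \<omega> * V r x)"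
proof -
  obtain C where C: "\<And>x r. 0 < r \<Longrightarrow>
      emeasure M (qball d x (2 * r)) \<le> ennreal C * emeasure M (qball d x r)"
    using doubling by blast
  define D where "D = max 1 C"
  have D1: "1 \<le> D" by (simp add: D_def)
  have dbl: "V (2 * r) x \<le> D * V r x" if "0 < r" for r x
  proof -
    have "ennreal (V (2 * r) x) \<le> ennreal C * ennreal (V r x)"
      using C[OF that, of x] that by (simp add: emeasure_qball)
    also have "\<dots> \<le> ennreal D * ennreal (V r x)"
      by (intro mult_right_mono ennreal_leI) (auto simp: D_def)
    also have "\<dots> = ennreal (D * V r x)" using D1 by (simp add: ennreal_mult'')
    finally show ?thesis using D1 by (simp add: ennreal_le_iff)
  qed
  have pow: "V (2 ^ n * r) x \<le> D ^ n * V r x" if "0 < r" for n r x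
  proof (induction n)
    case (Suc n)
    have "V (2 ^ Suc n * r) x \<le> D * V (2 ^ n * r) x"
      using dbl[of "2 ^ n * r" x] that by (simp add: mult.assoc)
    also have "\<dots> \<le> D * (D ^ n * V r x)" using Suc D1 by (intro mult_left_mono) auto
    finally show ?case by simp
  qed simp
  define \<omega> where "\<omega> = log 2 D"
  have "V (l * r) x \<le> D * l powr \<omega> * V r x" if r: "0 < r" and l: "1 \<le> l" for r l x
  proof -
    define n where "n = nat \<lceil>log 2 l\<rceil>"
    have l0: "0 \<le> log 2 l" using l by simp
    have "real n = of_int \<lceil>log 2 l\<rceil>" using l0 by (simp add: n_def)
    then have n1: "log 2 l \<le> real n" and n2: "real n \<le> log 2 l + 1" by linarith+
    have "l \<le> 2 powr real n" using n1 l by (simp add: log_le_iff)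
    then have "V (l * r) x \<le> V (2 ^ n * r) x" using r by (intro V_mono) (simp add: powr_realpow)
    also have "\<dots> \<le> D ^ n * V r x" by (rule pow[OF r])
    also have "D ^ n = D powr real n" using D1 by (simp add: powr_realpow)
    also have "D powr real n \<le> D powr (log 2 l + 1)" using D1 n2 by (intro powr_mono) auto
    also have "\<dots> = D * l powr \<omega>"
    proof -
      have "D powr log 2 l = l powr \<omega>"
        using D1 l by (simp add: \<omega>_def powr_def log_def)
      then show ?thesis using D1 by (simp add: powr_add)
    qed
    finally show ?thesis by (simp add: mult_right_mono)
  qed
  then show ?thesis using D1 by (intro exI[of _ D] exI[of _ \<omega>]) (auto simp: \<omega>_def)
qed

text \<open>The size and regularity conditions on test functions, the bounds on wavelet coefficients and
those on blocks all have the form of one profile with different exponents and arguments, so that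
every comparison between them reduces to comparing two values of this function.\<close>

definition decay :: "'a \<Rightarrow> real \<Rightarrow> real \<Rightarrow> real" where
  "decay x0 \<kappa> t = t powr (- \<kappa>) / V t x0"

lemma decay_nonneg [simp]: "0 \<le> decay x0 \<kappa> t"
  by (simp add: decay_def)

lemma decay_pos: "0 < t \<Longrightarrow> 0 < decay x0 \<kappa> t"
  by (simp add: decay_def V_pos)

lemma decay_measurable [measurable]:
  "\<rho> \<in> borel_measurable N \<Longrightarrow> (\<lambda>z. decay x0 \<kappa> (\<rho> z)) \<in> borel_measurable N"
  unfolding decay_def by (intro borel_measurable_divide V_measurable_comp powr_real_measurable) auto

lemma decay_add: "decay x0 (\<kappa> + \<kappa>') t = t powr (- \<kappa>) * decay x0 \<kappa>' t"
  by (simp add: decay_def flip: powr_add)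

lemma decay_antimono:
  assumes "0 < s" "s \<le> t" "0 \<le> \<kappa>"
  shows "decay x0 \<kappa> t \<le> decay x0 \<kappa> s"
  unfolding decay_def using assms V_pos[of s x0]
  by (intro frac_le V_mono powr_mono2') auto

end

text \<open>Fixing one pair of growth constants lets the bounds below refer to the same exponent \<open>\<omega>\<close>.\<close>

locale volume_growth = homogeneous_type d A0 M
  for d :: "'a \<Rightarrow> 'a \<Rightarrow> real" and A0 :: real and M :: "'a measure" +
  fixes D \<omega> :: real
  assumes D_ge_1: "1 \<le> D" and \<omega>_nonneg: "0 \<le> \<omega>"
    and V_growth: "0 < r \<Longrightarrow> 1 \<le> l \<Longrightarrow> vol d M (l * r) x \<le> D * l powr \<omega> * vol d M r x"
begin

lemma D_pos: "0 < D" using D_ge_1 by linarith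

lemma V_growth_le:
  assumes "0 < r" "1 \<le> l" "s \<le> l * r"
  shows "V s x \<le> D * l powr \<omega> * V r x"
  using V_mono[OF assms(3), of x] V_growth[OF assms(1,2), of x] by linarith

text \<open>The profile is slowly varying: changing its argument by a factor costs only a power of the factor.\<close>

lemma decay_compare:
  assumes "0 < s" "0 < t" "1 \<le> l" "s \<le> l * t" "0 \<le> \<kappa>"
  shows "decay x0 \<kappa> t \<le> D * l powr (\<kappa> + \<omega>) * decay x0 \<kappa> s"
proof -
  have "t powr (-\<kappa>) \<le> (s / l) powr (-\<kappa>)"
    using assms by (intro powr_mono2') (auto simp: field_simps)
  also have "\<dots> = l powr \<kappa> * s powr (-\<kappa>)"
    using assms by (simp add: powr_divide powr_minus field_simps)
  finally have 1: "t powr (-\<kappa>) \<le> l powr \<kappa> * s powr (-\<kappa>)" .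
  have "V s x0 \<le> D * l powr \<omega> * V t x0" using assms by (intro V_growth_le) auto
  then have 2: "1 / V t x0 \<le> D * l powr \<omega> / V s x0"
    using V_pos[OF assms(1), of x0] V_pos[OF assms(2), of x0] by (simp add: field_simps)
  have "t powr (-\<kappa>) * (1 / V t x0) \<le> (l powr \<kappa> * s powr (-\<kappa>)) * (D * l powr \<omega> / V s x0)"
    using 1 2 by (intro mult_mono) auto
  then show ?thesis by (simp add: decay_def powr_add field_simps)
qed

section \<open>Integrals of decay profiles\<close>

text \<open>A shell of radius \<open>t j\<close> has measure comparable to \<open>V (t j) y\<close>, so division by the volume leaves
one term of a geometric series for each shell. The offset \<open>s > 0\<close> keeps the radius positive at \<open>y\<close>.\<close>

lemma shell_integral:
  assumes q: "0 \<le> q" "q < 1" and s: "0 < s" and t: "\<And>j. 0 < t j"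
    and \<phi>: "\<And>z. 0 \<le> \<phi> z"
    and shell: "\<And>z. \<phi> z \<noteq> 0 \<Longrightarrow> \<exists>j::nat. t j \<le> s + d y z \<and> s + d y z \<le> 2 * t j \<and> \<phi> z \<le> q ^ j"
  shows "(\<integral>\<^sup>+z. ennreal (\<phi> z / V (s + d y z) y) \<partial>M) \<le> ennreal (D * 2 powr \<omega> / (1 - q))"
proof -
  have "(\<integral>\<^sup>+z. ennreal (\<phi> z / V (s + d y z) y) \<partial>M)
      \<le> (\<integral>\<^sup>+z. (\<Sum>j. ennreal (q ^ j / V (t j) y) * indicator (qball d y (2 * t j)) z) \<partial>M)"
  proof (rule nn_integral_mono)
    fix z
    show "ennreal (\<phi> z / V (s + d y z) y) \<le> (\<Sum>j. ennreal (q ^ j / V (t j) y) * indicator (qball d y (2 * t j)) z)"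
    proof (cases "\<phi> z = 0")
      case False
      then obtain j where j: "t j \<le> s + d y z" "s + d y z \<le> 2 * t j" "\<phi> z \<le> q ^ j" using shell by blast
      have "ennreal (\<phi> z / V (s + d y z) y) \<le> ennreal (q ^ j / V (t j) y)"
        using j \<phi> V_pos[OF t] q by (intro ennreal_leI frac_le V_mono) auto
      also have "\<dots> = ennreal (q ^ j / V (t j) y) * indicator (qball d y (2 * t j)) z"
        using j s by (simp add: qball_def)
      also have "\<dots> \<le> (\<Sum>j. ennreal (q ^ j / V (t j) y) * indicator (qball d y (2 * t j)) z)"
        using sum_le_suminf[of "\<lambda>j. ennreal (q ^ j / V (t j) y) * indicator (qball d y (2 * t j)) z" "{j}"]
        by (simp del: sum_mult_indicator)
      finally show ?thesis .
    qed simp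
  qed
  also have "\<dots> = (\<Sum>j. \<integral>\<^sup>+z. ennreal (q ^ j / V (t j) y) * indicator (qball d y (2 * t j)) z \<partial>M)"
    by (rule nn_integral_suminf) measurable
  also have "\<dots> \<le> (\<Sum>j. ennreal (D * 2 powr \<omega> * q ^ j))"
  proof (rule suminf_le)
    fix j
    have "(\<integral>\<^sup>+z. ennreal (q ^ j / V (t j) y) * indicator (qball d y (2 * t j)) z \<partial>M)
        = ennreal (q ^ j / V (t j) y) * ennreal (V (2 * t j) y)"
      using t[of j] by (simp add: nn_integral_cmult_indicator emeasure_qball)
    also have "\<dots> = ennreal (q ^ j / V (t j) y * V (2 * t j) y)"
      using q by (subst ennreal_mult[symmetric]) auto
    also have "\<dots> \<le> ennreal (q ^ j / V (t j) y * (D * 2 powr \<omega> * V (t j) y))"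
      using q t by (intro ennreal_leI mult_left_mono V_growth) auto
    also have "q ^ j / V (t j) y * (D * 2 powr \<omega> * V (t j) y) = D * 2 powr \<omega> * q ^ j"
      using V_pos[OF t[of j], of y] by (simp add: field_simps)
    finally show "(\<integral>\<^sup>+z. ennreal (q ^ j / V (t j) y) * indicator (qball d y (2 * t j)) z \<partial>M) \<le> ennreal (D * 2 powr \<omega> * q ^ j)" .
  qed auto
  also have "\<dots> = ennreal (\<Sum>j. D * 2 powr \<omega> * q ^ j)"
    using q D_pos by (intro suminf_ennreal2 summable_mult summable_geometric) auto
  also have "(\<Sum>j. D * 2 powr \<omega> * q ^ j) = D * 2 powr \<omega> / (1 - q)"
    using q by (simp add: suminf_mult summable_geometric suminf_geometric)
  finally show ?thesis .
qed

lemma dyadic_bracket: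
  fixes x :: real assumes "1 \<le> x" obtains j :: nat where "2 ^ j \<le> x" "x \<le> 2 * 2 ^ j"
proof -
  define j where "j = nat \<lfloor>log 2 x\<rfloor>"
  have 0: "0 \<le> log 2 x" using assms by simp
  have "real j = of_int \<lfloor>log 2 x\<rfloor>" using 0 by (simp add: j_def)
  then have "real j \<le> log 2 x" "log 2 x \<le> real j + 1" by linarith+
  then have "2 powr real j \<le> x" "x \<le> 2 powr (real j + 1)"
    using assms by (simp_all add: le_log_iff log_le_iff)
  then show thesis by (intro that[of j]) (auto simp: powr_realpow powr_add)
qed

text \<open>The integrand decays geometrically over dyadic shells in both directions away from the radius \<open>r\<close>;
all integrals below are reduced to this one.\<close>

lemma scale_integral_ex:
  assumes "0 < \<epsilon>"
  shows "\<exists>C\<ge>0. \<forall>y s r. 0 < s \<longrightarrow> 0 < r \<longrightarrow>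
     (\<integral>\<^sup>+z. ennreal (min ((s + d y z) / r) (r / (s + d y z)) powr \<epsilon> / V (s + d y z) y) \<partial>M) \<le> ennreal C"
proof -
  define q where "q = 2 powr (-\<epsilon>)"
  have "q < 2 powr 0" unfolding q_def using assms by (intro powr_less_mono) auto
  then have q: "0 \<le> q" "q < 1" by (auto simp: q_def)
  have qj: "(1 / 2 ^ j) powr \<epsilon> = q ^ j" for j
    by (simp add: q_def powr_divide powr_powr powr_minus_divide flip: powr_realpow)
       (simp add: mult.commute)
  define C where "C = D * 2 powr \<omega> / (1 - q)"
  have C0: "0 \<le> C" using q D_pos by (simp add: C_def)
  have "(\<integral>\<^sup>+z. ennreal (min ((s + d y z) / r) (r / (s + d y z)) powr \<epsilon> / V (s + d y z) y) \<partial>M) \<le> ennreal (C + C)"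
    if s: "0 < s" and r: "0 < r" for y s r
  proof -
    define \<rho> where "\<rho> z = s + d y z" for z
    have \<rho>: "0 < \<rho> z" for z using s d_nonneg[of y z] by (simp add: \<rho>_def)
    \<comment> \<open>the shells outside and inside the radius \<open>r\<close>\<close>
    define \<phi>1 where "\<phi>1 z = (if r \<le> \<rho> z then (r / \<rho> z) powr \<epsilon> else 0)" for z
    define \<phi>2 where "\<phi>2 z = (if \<rho> z \<le> r then (\<rho> z / r) powr \<epsilon> else 0)" for z
    have [measurable]: "\<rho> \<in> borel_measurable M" unfolding \<rho>_def by measurable
    have I1: "(\<integral>\<^sup>+z. ennreal (\<phi>1 z / V (\<rho> z) y) \<partial>M) \<le> ennreal C"
      unfolding C_def \<rho>_def
    proof (rule shell_integral[where t = "\<lambda>j. 2 ^ j * r"])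
      fix z assume "\<phi>1 z \<noteq> 0"
      then have le: "r \<le> \<rho> z" by (auto simp: \<phi>1_def split: if_splits)
      then have "1 \<le> \<rho> z / r" using r by simp
      then obtain j where j: "2 ^ j \<le> \<rho> z / r" "\<rho> z / r \<le> 2 * 2 ^ j" by (rule dyadic_bracket)
      have "\<phi>1 z = (r / \<rho> z) powr \<epsilon>" using le by (simp add: \<phi>1_def)
      also have "\<dots> \<le> (1 / 2 ^ j) powr \<epsilon>"
        using j(1) r \<rho>[of z] assms by (intro powr_mono2) (auto simp: field_simps)
      finally have "\<phi>1 z \<le> q ^ j" by (simp add: qj)
      then show "\<exists>j. 2 ^ j * r \<le> s + d y z \<and> s + d y z \<le> 2 * (2 ^ j * r) \<and> \<phi>1 z \<le> q ^ j"
        using j r by (intro exI[of _ j]) (auto simp: \<rho>_def field_simps)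
    qed (use q s r in \<open>auto simp: \<phi>1_def\<close>)
    have I2: "(\<integral>\<^sup>+z. ennreal (\<phi>2 z / V (\<rho> z) y) \<partial>M) \<le> ennreal C"
      unfolding C_def \<rho>_def
    proof (rule shell_integral[where t = "\<lambda>j. r / (2 * 2 ^ j)"])
      fix z assume "\<phi>2 z \<noteq> 0"
      then have le: "\<rho> z \<le> r" by (auto simp: \<phi>2_def split: if_splits)
      then have "1 \<le> r / \<rho> z" using r \<rho>[of z] by simp
      then obtain j where j: "2 ^ j \<le> r / \<rho> z" "r / \<rho> z \<le> 2 * 2 ^ j" by (rule dyadic_bracket)
      have "\<phi>2 z = (\<rho> z / r) powr \<epsilon>" using le by (simp add: \<phi>2_def)
      also have "\<dots> \<le> (1 / 2 ^ j) powr \<epsilon>"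
        using j(1) r \<rho>[of z] assms by (intro powr_mono2) (auto simp: field_simps)
      finally have "\<phi>2 z \<le> q ^ j" by (simp add: qj)
      then show "\<exists>j. r / (2 * 2 ^ j) \<le> s + d y z \<and> s + d y z \<le> 2 * (r / (2 * 2 ^ j)) \<and> \<phi>2 z \<le> q ^ j"
        using j r \<rho>[of z] by (intro exI[of _ j]) (auto simp: \<rho>_def field_simps)
    qed (use q s r in \<open>auto simp: \<phi>2_def\<close>)
    have "(\<integral>\<^sup>+z. ennreal (min (\<rho> z / r) (r / \<rho> z) powr \<epsilon> / V (\<rho> z) y) \<partial>M)
        \<le> (\<integral>\<^sup>+z. ennreal (\<phi>1 z / V (\<rho> z) y) + ennreal (\<phi>2 z / V (\<rho> z) y) \<partial>M)"
    proof (rule nn_integral_mono)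
      fix z
      have "min (\<rho> z / r) (r / \<rho> z) powr \<epsilon> \<le> \<phi>1 z + \<phi>2 z"
      proof (cases "r \<le> \<rho> z")
        case True
        have "min (\<rho> z / r) (r / \<rho> z) powr \<epsilon> \<le> (r / \<rho> z) powr \<epsilon>"
          using assms r \<rho>[of z] by (intro powr_mono2) auto
        then show ?thesis using True by (auto simp: \<phi>1_def \<phi>2_def add_increasing2)
      next
        case False
        have "min (\<rho> z / r) (r / \<rho> z) powr \<epsilon> \<le> (\<rho> z / r) powr \<epsilon>"
          using assms r \<rho>[of z] by (intro powr_mono2) auto
        then show ?thesis using False by (auto simp: \<phi>1_def \<phi>2_def)
      qed
      then have "min (\<rho> z / r) (r / \<rho> z) powr \<epsilon> / V (\<rho> z) y \<le> \<phi>1 z / V (\<rho> z) y + \<phi>2 z / V (\<rho> z) y"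
        by (simp add: divide_right_mono flip: add_divide_distrib)
      then show "ennreal (min (\<rho> z / r) (r / \<rho> z) powr \<epsilon> / V (\<rho> z) y)
          \<le> ennreal (\<phi>1 z / V (\<rho> z) y) + ennreal (\<phi>2 z / V (\<rho> z) y)"
        by (subst ennreal_plus[symmetric]) (auto simp: \<phi>1_def \<phi>2_def intro!: ennreal_leI)
    qed
    also have "\<dots> = (\<integral>\<^sup>+z. ennreal (\<phi>1 z / V (\<rho> z) y) \<partial>M) + (\<integral>\<^sup>+z. ennreal (\<phi>2 z / V (\<rho> z) y) \<partial>M)"
      unfolding \<phi>1_def \<phi>2_def by (rule nn_integral_add) measurable
    also have "\<dots> \<le> ennreal C + ennreal C" using I1 I2 by (rule add_mono)
    finally show ?thesis unfolding \<rho>_def ennreal_plus[OF C0 C0] .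
  qed
  then show ?thesis using C0 by (intro exI[of _ "C + C"]) auto
qed

lemma ball_tail_integral_ex:
  "\<exists>C\<ge>0. \<forall>y r. 0 < r \<longrightarrow>
     (\<integral>\<^sup>+z. ennreal ((1 + d y z / r) powr (- (\<omega> + 1))) \<partial>M) \<le> ennreal (C * V r y)"
proof -
  obtain C where C: "0 \<le> C" "\<And>y s r. 0 < s \<Longrightarrow> 0 < r \<Longrightarrow>
     (\<integral>\<^sup>+z. ennreal (min ((s + d y z) / r) (r / (s + d y z)) powr 1 / V (s + d y z) y) \<partial>M) \<le> ennreal C"
    using scale_integral_ex[of 1] by auto
  have "(\<integral>\<^sup>+z. ennreal ((1 + d y z / r) powr (- (\<omega> + 1))) \<partial>M) \<le> ennreal (D * C * V r y)" if r: "0 < r" for y r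
  proof -
    have "(\<integral>\<^sup>+z. ennreal ((1 + d y z / r) powr (- (\<omega> + 1))) \<partial>M)
      \<le> (\<integral>\<^sup>+z. ennreal (D * V r y) * ennreal (min ((r + d y z) / r) (r / (r + d y z)) powr 1 / V (r + d y z) y) \<partial>M)"
    proof (rule nn_integral_mono)
      fix z
      define u where "u = 1 + d y z / r"
      have u: "1 \<le> u" using r d_nonneg[of y z] by (simp add: u_def)
      have ru: "r + d y z = u * r" using r by (simp add: u_def field_simps)
      have V1: "V (u * r) y \<le> D * u powr \<omega> * V r y" using r u by (rule V_growth)
      have "min u (1 / u) = 1 / u" using u mult_mono[OF u u] by (simp add: min_def field_simps)
      then have m: "min ((r + d y z) / r) (r / (r + d y z)) powr 1 = 1 / u"
        unfolding ru using r u by simp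
      have "u powr (- (\<omega> + 1)) = 1 / (u powr \<omega> * u)"
        using u by (simp add: powr_diff powr_minus field_simps powr_add)
      also have "\<dots> \<le> D * V r y * (1 / u / V (u * r) y)"
        using u V1 V_pos[of "u * r" y] V_pos[OF r, of y] r by (simp add: field_simps)
      finally show "ennreal ((1 + d y z / r) powr (- (\<omega> + 1)))
          \<le> ennreal (D * V r y) * ennreal (min ((r + d y z) / r) (r / (r + d y z)) powr 1 / V (r + d y z) y)"
        unfolding m using u D_pos
        by (subst ennreal_mult[symmetric]) (auto simp: ru u_def[symmetric] intro!: ennreal_leI)
    qed
    also have "\<dots> = ennreal (D * V r y) * (\<integral>\<^sup>+z. ennreal (min ((r + d y z) / r) (r / (r + d y z)) powr 1 / V (r + d y z) y) \<partial>M)"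
      by (rule nn_integral_cmult) measurable
    also have "\<dots> \<le> ennreal (D * V r y) * ennreal C" using r by (intro mult_left_mono C) auto
    also have "\<dots> = ennreal (D * C * V r y)" using C D_pos by (simp add: ennreal_mult' mult_ac)
    finally show ?thesis .
  qed
  then show ?thesis using C(1) D_pos by (intro exI[of _ "D * C"]) auto
qed

text \<open>With \<open>s = (1 + d z x0) / r\<close> the integrand is \<open>r powr (- \<gamma>)\<close> times \<open>s powr (\<eta> - \<gamma>)\<close> for small
\<open>s\<close> and \<open>s powr (- \<gamma>)\<close> for large \<open>s\<close>, divided by the volume. Both exponents decay away from
\<open>s = 1\<close> because \<open>0 < \<gamma> < \<eta>\<close>.\<close>

lemma decay_moment_ex:
  assumes "0 < \<gamma>" "\<gamma> < \<eta>"
  shows "\<exists>C\<ge>0. \<forall>x0 r. 1 \<le> r \<longrightarrow>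
     (\<integral>\<^sup>+z. ennreal (decay x0 \<gamma> (1 + d z x0) * min 1 ((1 + d z x0) / r) powr \<eta>) \<partial>M) \<le> ennreal (C * r powr (- \<gamma>))"
proof -
  \<comment> \<open>the slower of the two rates of decay away from \<open>s = 1\<close>\<close>
  define \<epsilon> where "\<epsilon> = min \<gamma> (\<eta> - \<gamma>)"
  have e: "0 < \<epsilon>" "\<epsilon> \<le> \<gamma>" "\<epsilon> \<le> \<eta> - \<gamma>" using assms by (auto simp: \<epsilon>_def)
  obtain C where C: "0 \<le> C" "\<And>y s r. 0 < s \<Longrightarrow> 0 < r \<Longrightarrow>
     (\<integral>\<^sup>+z. ennreal (min ((s + d y z) / r) (r / (s + d y z)) powr \<epsilon> / V (s + d y z) y) \<partial>M) \<le> ennreal C"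
    using scale_integral_ex[OF e(1)] by auto
  have "(\<integral>\<^sup>+z. ennreal (decay x0 \<gamma> (1 + d z x0) * min 1 ((1 + d z x0) / r) powr \<eta>) \<partial>M) \<le> ennreal (C * r powr (- \<gamma>))"
    if r: "1 \<le> r" for x0 r
  proof -
    have "(\<integral>\<^sup>+z. ennreal (decay x0 \<gamma> (1 + d z x0) * min 1 ((1 + d z x0) / r) powr \<eta>) \<partial>M)
      \<le> (\<integral>\<^sup>+z. ennreal (r powr (- \<gamma>)) * ennreal (min ((1 + d x0 z) / r) (r / (1 + d x0 z)) powr \<epsilon> / V (1 + d x0 z) x0) \<partial>M)"
    proof (rule nn_integral_mono)
      fix z
      define R where "R = 1 + d x0 z"
      define s where "s = R / r"
      have R: "1 \<le> R" using d_nonneg[of x0 z] by (simp add: R_def)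
      have s: "0 < s" using R r by (simp add: s_def)
      have Rs: "R = r * s" using r by (simp add: s_def)
      have key: "s powr (- \<gamma>) * min 1 s powr \<eta> \<le> min s (1 / s) powr \<epsilon>"
      proof (cases "s \<le> 1")
        case True
        have "s * s \<le> 1" using True s by (simp add: mult_le_one)
        then have m: "min s (1 / s) = s" using s by (simp add: min_def field_simps)
        have "s powr (- \<gamma>) * s powr \<eta> = s powr (\<eta> - \<gamma>)" by (simp flip: powr_add)
        also have "\<dots> \<le> s powr \<epsilon>" using True s e by (intro powr_mono') auto
        finally show ?thesis using True m by simp
      next
        case False
        have "1 \<le> s * s" using False mult_mono[of 1 s 1 s] by simp
        then have m: "min s (1 / s) = 1 / s" using s by (simp add: min_def field_simps)
        have "s powr (- \<gamma>) \<le> s powr (- \<epsilon>)" using False e by (intro powr_mono) auto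
        also have "\<dots> = (1 / s) powr \<epsilon>" using s by (simp add: powr_divide powr_minus_divide)
        finally show ?thesis using False m by simp
      qed
      have "R powr (- \<gamma>) = r powr (- \<gamma>) * s powr (- \<gamma>)" using r s by (simp add: Rs powr_mult)
      then have "decay x0 \<gamma> R * min 1 s powr \<eta> = r powr (- \<gamma>) * (s powr (- \<gamma>) * min 1 s powr \<eta> / V R x0)"
        by (simp add: decay_def)
      also have "\<dots> \<le> r powr (- \<gamma>) * (min s (1 / s) powr \<epsilon> / V R x0)"
        by (intro mult_left_mono divide_right_mono key) auto
      finally have "ennreal (decay x0 \<gamma> R * min 1 s powr \<eta>) \<le> ennreal (r powr (- \<gamma>)) * ennreal (min s (1 / s) powr \<epsilon> / V R x0)"
        by (subst ennreal_mult[symmetric]) (auto intro!: ennreal_leI)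
      then show "ennreal (decay x0 \<gamma> (1 + d z x0) * min 1 ((1 + d z x0) / r) powr \<eta>) \<le>
          ennreal (r powr (- \<gamma>)) * ennreal (min ((1 + d x0 z) / r) (r / (1 + d x0 z)) powr \<epsilon> / V (1 + d x0 z) x0)"
        using s by (simp add: R_def s_def d_sym[of z x0])
    qed
    also have "\<dots> = ennreal (r powr (- \<gamma>)) * (\<integral>\<^sup>+z. ennreal (min ((1 + d x0 z) / r) (r / (1 + d x0 z)) powr \<epsilon> / V (1 + d x0 z) x0) \<partial>M)"
      by (rule nn_integral_cmult) measurable
    also have "\<dots> \<le> ennreal (r powr (- \<gamma>)) * ennreal C" using r by (intro mult_left_mono C) auto
    also have "\<dots> = ennreal (C * r powr (- \<gamma>))" using C by (simp add: ennreal_mult' mult_ac)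
    finally show ?thesis .
  qed
  then show ?thesis using C(1) by (intro exI[of _ C]) auto
qed

lemma integrable_decay:
  assumes "0 < \<gamma>" shows "integrable M (\<lambda>z. decay x0 \<gamma> (1 + d z x0))"
proof (rule integrableI_nonneg)
  obtain C where "(\<integral>\<^sup>+z. ennreal (decay x0 \<gamma> (1 + d z x0) * min 1 ((1 + d z x0) / 1) powr (\<gamma> + 1)) \<partial>M)
      \<le> ennreal (C * 1 powr (- \<gamma>))"
    using decay_moment_ex[of \<gamma> "\<gamma> + 1"] assms by fastforce
  then show "(\<integral>\<^sup>+z. ennreal (decay x0 \<gamma> (1 + d z x0)) \<partial>M) < \<infinity>"
    using d_nonneg by (simp add: le_less_trans)
qed auto

end

section \<open>Test functions and molecules\<close>

lemma cnj_measurable [measurable]: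
  "f \<in> borel_measurable M \<Longrightarrow> (\<lambda>x. cnj (f x)) \<in> borel_measurable M"
  by (rule borel_measurable_continuous_on[of cnj]) (auto intro: continuous_intros)

lemma nn_integral_le_imp_integrable:
  fixes f :: "'a \<Rightarrow> real"
  assumes "f \<in> borel_measurable M" "\<And>z. 0 \<le> f z" "0 \<le> C" "(\<integral>\<^sup>+z. ennreal (f z) \<partial>M) \<le> ennreal C"
  shows "integrable M f" "(LINT z|M. f z) \<le> C"
proof -
  show "integrable M f"
    using assms by (intro integrableI_nonneg) (auto simp: le_less_trans)
  show "(LINT z|M. f z) \<le> C"
    using assms by (subst integral_eq_nn_integral) (auto intro: enn2real_leI)
qed

lemma norm_integral_le_dominated:
  fixes F :: "'a \<Rightarrow> complex"
  assumes "integrable M w" "F \<in> borel_measurable M" "\<And>z. cmod (F z) \<le> w z"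
  shows "integrable M F" "cmod (LINT z|M. F z) \<le> (LINT z|M. w z)"
proof -
  show F: "integrable M F"
    by (rule Bochner_Integration.integrable_bound[OF assms(1,2)])
       (use assms(3) abs_ge_self order_trans in \<open>fastforce\<close>)
  have "cmod (LINT z|M. F z) \<le> (LINT z|M. cmod (F z))" by (rule integral_norm_bound)
  also have "\<dots> \<le> (LINT z|M. w z)" using assms F by (intro integral_mono) auto
  finally show "cmod (LINT z|M. F z) \<le> (LINT z|M. w z)" .
qed

context homogeneous_type
begin

abbreviation mean_zero :: "('a \<Rightarrow> complex) \<Rightarrow> bool" where
  "mean_zero f \<equiv> has_bochner_integral M f 0"

text \<open>The bounds of a test function at scale 1, with \<open>V 1 x0 + vol2 d M x x0\<close> replaced by the comparable
volume of the ball around \<open>x0\<close> of radius \<open>1 + d x x0\<close>.\<close>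

definition smooth_bound :: "'a \<Rightarrow> real \<Rightarrow> real \<Rightarrow> ('a \<Rightarrow> complex) \<Rightarrow> real \<Rightarrow> bool" where
  "smooth_bound x0 \<beta> \<gamma> f C \<longleftrightarrow>
     (\<forall>x. cmod (f x) \<le> C * decay x0 \<gamma> (1 + d x x0)) \<and>
     (\<forall>x y. d x y < (1 + d x x0) / (2 * A0) \<longrightarrow>
        cmod (f x - f y) \<le> C * d x y powr \<beta> * decay x0 (\<beta> + \<gamma>) (1 + d x x0))"

text \<open>An unnormalised wavelet centred at \<open>y\<close> of scale \<open>r\<close>: the exponential decay is relaxed to a power,
since every argument below only uses a sufficiently high power.\<close>

definition molecule :: "real \<Rightarrow> real \<Rightarrow> 'a \<Rightarrow> real \<Rightarrow> real \<Rightarrow> ('a \<Rightarrow> complex) \<Rightarrow> bool" where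
  "molecule N \<eta> y r B \<phi> \<longleftrightarrow> mean_zero \<phi> \<and>
     (\<forall>z. cmod (\<phi> z) \<le> B * (1 + d y z / r) powr (- N)) \<and>
     (\<forall>z w. d z w \<le> r \<longrightarrow>
        cmod (\<phi> z - \<phi> w) \<le> B * (d z w / r) powr \<eta> * (1 + d y z / r) powr (- N))"

lemma smooth_bound_nonneg: "smooth_bound x0 \<beta> \<gamma> f C \<Longrightarrow> 0 \<le> C"
proof -
  assume "smooth_bound x0 \<beta> \<gamma> f C"
  then have "cmod (f x0) \<le> C * decay x0 \<gamma> (1 + d x0 x0)" unfolding smooth_bound_def by blast
  then have "0 \<le> C * decay x0 \<gamma> 1" using norm_ge_zero[of "f x0"] by (simp del: norm_ge_zero)
  then show ?thesis using decay_pos[of 1 x0 \<gamma>] by (simp add: zero_le_mult_iff)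
qed

lemma molecule_nonneg: "molecule N \<eta> y r B \<phi> \<Longrightarrow> 0 \<le> B"
proof -
  assume "molecule N \<eta> y r B \<phi>"
  then have "cmod (\<phi> y) \<le> B * (1 + d y y / r) powr (- N)" unfolding molecule_def by blast
  then show "0 \<le> B" using norm_ge_zero[of "\<phi> y"] by (simp del: norm_ge_zero)
qed

end

context volume_growth
begin

lemma test_volume_compare:
  "\<exists>K\<ge>1. \<forall>x0 x. V (1 + d x x0) x0 \<le> K * (V 1 x0 + vol2 d M x x0) \<and>
                 V 1 x0 + vol2 d M x x0 \<le> K * V (1 + d x x0) x0"
proof -
  define c where "c = D * (3 * A0) powr \<omega>"
  have c0: "0 \<le> c" using D_pos by (simp add: c_def)
  have "V (1 + d x x0) x0 \<le> (1 + c) * (V 1 x0 + vol2 d M x x0)" (is ?A)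
    "V 1 x0 + vol2 d M x x0 \<le> (1 + c) * V (1 + d x x0) x0" (is ?B) for x x0
  proof -
    have vol2: "vol2 d M x x0 = V (d x x0) x" by (simp add: vol2_def vol_def)
    have d0: "0 \<le> d x x0" by (rule d_nonneg)
    have "V (d x x0) x \<le> V (3 * A0 * (1 + d x x0)) x0"
    proof (rule V_mono_ball[OF qball_subset])
      show "A0 * (d x x0 + d x x0) \<le> 3 * A0 * (1 + d x x0)" using d0 A0_pos by (simp add: algebra_simps)
    qed (use d0 A0_pos in auto)
    also have "\<dots> \<le> c * V (1 + d x x0) x0"
      unfolding c_def using A0_ge_1 d0 by (intro V_growth) auto
    finally have "V (d x x0) x \<le> c * V (1 + d x x0) x0" .
    moreover have "V 1 x0 \<le> V (1 + d x x0) x0" using d0 by (intro V_mono) auto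
    ultimately show ?B by (simp add: vol2 algebra_simps)
    show ?A
    proof (cases "d x x0 \<le> 1")
      case True
      have "V (1 + d x x0) x0 \<le> c * V 1 x0"
        unfolding c_def using A0_ge_1 True by (intro V_growth_le) auto
      also have "\<dots> \<le> (1 + c) * (V 1 x0 + vol2 d M x x0)"
        using c0 by (intro mult_mono) (auto simp: vol2)
      finally show ?thesis .
    next
      case False
      have "V (1 + d x x0) x0 \<le> V (3 * A0 * d x x0) x"
      proof (rule V_mono_ball[OF qball_subset])
        have "A0 * (1 + 2 * d x x0) \<le> A0 * (3 * d x x0)" using False A0_pos by (intro mult_left_mono) auto
        then show "A0 * (d x0 x + (1 + d x x0)) \<le> 3 * A0 * d x x0"
          by (simp add: d_sym[of x0 x] algebra_simps)
      qed (use False A0_pos in auto)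
      also have "\<dots> \<le> c * V (d x x0) x"
        unfolding c_def using A0_ge_1 False by (intro V_growth) auto
      also have "\<dots> \<le> (1 + c) * (V 1 x0 + vol2 d M x x0)"
        using c0 by (intro mult_mono) (auto simp: vol2)
      finally show ?thesis .
    qed
  qed
  then show ?thesis using c0 by (intro exI[of _ "1 + c"]) auto
qed

lemma test_bound_equiv_ex:
  "\<exists>K\<ge>1. \<forall>x0 \<beta> \<gamma> f C. 0 \<le> C \<longrightarrow>
     (test_bound d A0 M x0 1 \<beta> \<gamma> f C \<longrightarrow> smooth_bound x0 \<beta> \<gamma> f (K * C)) \<and>
     (smooth_bound x0 \<beta> \<gamma> f C \<longrightarrow> test_bound d A0 M x0 1 \<beta> \<gamma> f (K * C))"
proof -
  obtain K where K: "1 \<le> K" "\<And>x x0. V (1 + d x x0) x0 \<le> K * (V 1 x0 + vol2 d M x x0)"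
    "\<And>x x0. V 1 x0 + vol2 d M x x0 \<le> K * V (1 + d x x0) x0"
    using test_volume_compare by blast
  have "(test_bound d A0 M x0 1 \<beta> \<gamma> f C \<longrightarrow> smooth_bound x0 \<beta> \<gamma> f (K * C)) \<and>
     (smooth_bound x0 \<beta> \<gamma> f C \<longrightarrow> test_bound d A0 M x0 1 \<beta> \<gamma> f (K * C))"
    if C: "0 \<le> C" for x0 \<beta> \<gamma> f C
  proof -
    have R: "0 < 1 + d x x0" for x using d_nonneg[of x x0] by linarith
    have W: "0 < V 1 x0 + vol2 d M x x0" for x
      using V_pos[of 1 x0] by (simp add: vol2_def add_pos_nonneg)
    have le1: "1 / (V 1 x0 + vol2 d M x x0) \<le> K * (1 / V (1 + d x x0) x0)" for x
      using K(2)[of x x0] W[of x] V_pos[OF R, of x x0] by (simp add: field_simps)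
    have le2: "1 / V (1 + d x x0) x0 \<le> K * (1 / (V 1 x0 + vol2 d M x x0))" for x
      using K(3)[of x0 x] W[of x] V_pos[OF R, of x x0] by (simp add: field_simps)
    have g: "(1 / (1 + d x x0)) powr \<gamma> = (1 + d x x0) powr (- \<gamma>)" for x
      using R[of x] by (simp add: powr_divide powr_minus_divide)
    have b: "(d x y / (1 + d x x0)) powr \<beta> = d x y powr \<beta> * (1 + d x x0) powr (- \<beta>)" for x y
      using R[of x] d_nonneg[of x y] by (simp add: powr_divide powr_minus_divide)
    have s1: "C * (1 / (V 1 x0 + vol2 d M x x0)) * (1 / (1 + d x x0)) powr \<gamma> \<le> K * C * decay x0 \<gamma> (1 + d x x0)" for x
      using mult_left_mono[OF le1[of x], of "C * (1 + d x x0) powr (- \<gamma>)"] C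
      unfolding g decay_def by (simp add: mult_ac)
    have s2: "C * decay x0 \<gamma> (1 + d x x0) \<le> K * C * (1 / (V 1 x0 + vol2 d M x x0)) * (1 / (1 + d x x0)) powr \<gamma>" for x
      using mult_left_mono[OF le2[of x], of "C * (1 + d x x0) powr (- \<gamma>)"] C
      unfolding g decay_def by (simp add: mult_ac)
    have s3: "C * (d x y / (1 + d x x0)) powr \<beta> * (1 / (V 1 x0 + vol2 d M x x0)) * (1 / (1 + d x x0)) powr \<gamma>
        \<le> K * C * d x y powr \<beta> * decay x0 (\<beta> + \<gamma>) (1 + d x x0)" for x y
      using mult_left_mono[OF s1[of x], of "(d x y / (1 + d x x0)) powr \<beta>"]
      unfolding decay_add b by (simp add: mult_ac)
    have s4: "C * d x y powr \<beta> * decay x0 (\<beta> + \<gamma>) (1 + d x x0)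
        \<le> K * C * (d x y / (1 + d x x0)) powr \<beta> * (1 / (V 1 x0 + vol2 d M x x0)) * (1 / (1 + d x x0)) powr \<gamma>" for x y
      using mult_left_mono[OF s2[of x], of "(d x y / (1 + d x x0)) powr \<beta>"]
      unfolding decay_add b by (simp add: mult_ac)
    show ?thesis
    proof (intro conjI impI)
      assume "test_bound d A0 M x0 1 \<beta> \<gamma> f C"
      then show "smooth_bound x0 \<beta> \<gamma> f (K * C)"
        unfolding test_bound_def smooth_bound_def
        by (auto intro: order_trans[OF _ s1] order_trans[OF _ s3])
    next
      assume "smooth_bound x0 \<beta> \<gamma> f C"
      then show "test_bound d A0 M x0 1 \<beta> \<gamma> f (K * C)"
        unfolding test_bound_def smooth_bound_def
        by (auto intro: order_trans[OF _ s2] order_trans[OF _ s4] simp del: times_divide_eq_right mult_1_right)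
    qed
  qed
  then show ?thesis using K(1) by blast
qed

lemma molecule_measurable:
  assumes "molecule N \<eta> y r B \<phi>" shows "\<phi> \<in> borel_measurable M"
  using assms unfolding molecule_def has_bochner_integral_iff by (blast intro: borel_measurable_integrable)

text \<open>Polynomial growth of one factor at scale \<open>r\<close> is absorbed by polynomial decay of the other, with
\<open>\<omega> + 1\<close> powers to spare for integrability.\<close>

lemma pairing_growth_ex:
  "\<exists>C\<ge>0. \<forall>g \<phi> G B K N y r. 0 < r \<longrightarrow> K + \<omega> + 1 \<le> N \<longrightarrow> 0 \<le> G \<longrightarrow> 0 \<le> B \<longrightarrow>
     g \<in> borel_measurable M \<longrightarrow> \<phi> \<in> borel_measurable M \<longrightarrow>
     (\<forall>z. cmod (g z) \<le> G * (1 + d y z / r) powr K) \<longrightarrow>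
     (\<forall>z. cmod (\<phi> z) \<le> B * (1 + d y z / r) powr (- N)) \<longrightarrow>
     integrable M (\<lambda>z. g z * cnj (\<phi> z)) \<and>
     cmod (LINT z|M. g z * cnj (\<phi> z)) \<le> C * G * B * V r y"
proof -
  obtain C where C: "0 \<le> C" "\<And>y r. 0 < r \<Longrightarrow>
     (\<integral>\<^sup>+z. ennreal ((1 + d y z / r) powr (- (\<omega> + 1))) \<partial>M) \<le> ennreal (C * V r y)"
    using ball_tail_integral_ex by blast
  have "integrable M (\<lambda>z. g z * cnj (\<phi> z)) \<and> cmod (LINT z|M. g z * cnj (\<phi> z)) \<le> C * G * B * V r y"
    if r: "0 < r" and KN: "K + \<omega> + 1 \<le> N" and G: "0 \<le> G" and B: "0 \<le> B"
      and [measurable]: "g \<in> borel_measurable M" "\<phi> \<in> borel_measurable M"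
      and g: "\<forall>z. cmod (g z) \<le> G * (1 + d y z / r) powr K"
      and \<phi>: "\<forall>z. cmod (\<phi> z) \<le> B * (1 + d y z / r) powr (- N)"
    for g \<phi> :: "'a \<Rightarrow> complex" and G B K N r y
  proof -
    define w where "w z = (1 + d y z / r) powr (- (\<omega> + 1))" for z
    have w: "integrable M w" "(LINT z|M. w z) \<le> C * V r y"
      unfolding w_def by (rule nn_integral_le_imp_integrable[OF _ _ _ C(2)[OF r]]; use C(1) in simp)+
    have bd: "cmod (g z * cnj (\<phi> z)) \<le> G * B * w z" for z
    proof -
      have u: "1 \<le> 1 + d y z / r" using r d_nonneg[of y z] by simp
      have "cmod (g z * cnj (\<phi> z)) \<le> (G * (1 + d y z / r) powr K) * (B * (1 + d y z / r) powr (- N))"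
        unfolding norm_mult complex_mod_cnj using g \<phi> G by (intro mult_mono) auto
      also have "\<dots> = G * B * (1 + d y z / r) powr (K - N)"
        by (simp add: powr_diff powr_minus divide_inverse)
      also have "\<dots> \<le> G * B * w z"
        unfolding w_def using u KN G B by (intro mult_left_mono powr_mono) auto
      finally show ?thesis .
    qed
    have "integrable M (\<lambda>z. G * B * w z)" using w(1) by simp
    note dom = norm_integral_le_dominated[OF this _ bd]
    have "cmod (LINT z|M. g z * cnj (\<phi> z)) \<le> G * B * (LINT z|M. w z)"
      using dom(2) by simp
    also have "\<dots> \<le> G * B * (C * V r y)" using w(2) G B by (intro mult_left_mono) auto
    finally show ?thesis using dom(1) by (simp add: mult_ac)
  qed
  then show ?thesis using C(1) by blast
qed

section \<open>Wavelet coefficients of a test function\<close>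

lemma decay_split:
  assumes "0 < t" shows "decay x0 \<gamma> t = t powr \<beta> * decay x0 (\<beta> + \<gamma>) t"
  using assms by (simp add: decay_add powr_minus)

lemma dist_powr_le:
  assumes "0 < r" "0 < \<beta>" "\<beta> \<le> K"
  shows "d y z powr \<beta> \<le> r powr \<beta> * (1 + d y z / r) powr K"
proof -
  have u: "1 \<le> 1 + d y z / r" using assms d_nonneg[of y z] by simp
  have "d y z powr \<beta> \<le> (r * (1 + d y z / r)) powr \<beta>"
    using assms d_nonneg by (intro powr_mono2) (auto simp: field_simps)
  also have "\<dots> = r powr \<beta> * (1 + d y z / r) powr \<beta>" using assms u by (simp add: powr_mult)
  also have "\<dots> \<le> r powr \<beta> * (1 + d y z / r) powr K" using u assms by (intro mult_left_mono powr_mono) auto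
  finally show ?thesis .
qed

text \<open>For \<open>z\<close> near \<open>y\<close> this is Hoelder continuity with \<open>d y z \<le> r * u\<close>, where \<open>u = 1 + d y z / r\<close>.
For \<open>z\<close> far from \<open>y\<close>, \<open>1 + d y x0\<close> is at most a multiple of \<open>r * u\<close>, so that even the trivial
bound on \<open>f\<close> near \<open>x0\<close> only loses a power of \<open>u\<close>; \<open>r \<le> 1\<close> turns the resulting power of \<open>r\<close>
into \<open>r powr \<beta>\<close>.\<close>

lemma fine_offset_bound:
  assumes \<beta>: "0 < \<beta>" and \<gamma>: "0 < \<gamma>" and f: "smooth_bound x0 \<beta> \<gamma> f A"
    and r: "0 < r" "r \<le> 1"
  shows "cmod (f z - f y) \<le> 2 * D * (4 * A0) powr (\<beta> + \<gamma> + \<omega>) * A * r powr \<beta>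
     * decay x0 (\<beta> + \<gamma>) (1 + d y x0) * (1 + d y z / r) powr (\<beta> + \<gamma> + \<omega>)"
proof -
  define R where "R = 1 + d y x0"
  define u where "u = 1 + d y z / r"
  define K where "K = \<beta> + \<gamma> + \<omega>"
  define P where "P = decay x0 (\<beta> + \<gamma>) R"
  have A: "0 \<le> A" using f by (rule smooth_bound_nonneg)
  have R: "1 \<le> R" using d_nonneg[of y x0] by (simp add: R_def)
  have u: "1 \<le> u" using r d_nonneg[of y z] by (simp add: u_def)
  have du: "d y z \<le> r * u" using r by (simp add: u_def field_simps)
  have K: "0 \<le> K" "\<beta> \<le> K" using \<beta> \<gamma> \<omega>_nonneg by (auto simp: K_def)
  have P: "0 \<le> P" by (simp add: P_def)
  have big: "1 \<le> (4 * A0) powr K" using A0_ge_1 K by (intro ge_one_powr_ge_zero) auto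
  have "1 * 1 \<le> D * (4 * A0) powr K" using D_ge_1 big by (intro mult_mono) auto
  then have cK: "1 \<le> 2 * D * (4 * A0) powr K" by linarith
  show ?thesis
    unfolding R_def[symmetric] u_def[symmetric] K_def[symmetric] P_def[symmetric]
  proof (cases "d y z < R / (2 * A0)")
    case True
    then have "cmod (f y - f z) \<le> A * d y z powr \<beta> * P"
      using f unfolding smooth_bound_def R_def P_def by blast
    also have "\<dots> \<le> A * (r powr \<beta> * u powr K) * P"
      unfolding u_def using A P r \<beta> K by (intro mult_right_mono mult_left_mono dist_powr_le) auto
    also have "\<dots> \<le> (2 * D * (4 * A0) powr K) * (A * (r powr \<beta> * u powr K) * P)"
      using mult_right_mono[OF cK, of "A * (r powr \<beta> * u powr K) * P"] A P by simp
    finally show "cmod (f z - f y) \<le> 2 * D * (4 * A0) powr K * A * r powr \<beta> * P * u powr K"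
      by (simp add: norm_minus_commute mult_ac)
  next
    case False
    have Rz: "1 \<le> 1 + d z x0" using d_nonneg[of z x0] by simp
    have "R \<le> 2 * A0 * d y z" using False A0_pos by (simp add: field_simps)
    also have "\<dots> \<le> 2 * A0 * (r * u)" using du A0_pos by (intro mult_left_mono) auto
    also have "\<dots> \<le> 4 * A0 * (r * u)" using r u A0_pos by (intro mult_right_mono) auto
    finally have Ru: "R \<le> 4 * A0 * (r * u)" .
    have val: "A * decay x0 \<gamma> t \<le> A * (D * R powr (\<gamma> + \<omega>) * decay x0 \<gamma> R)" if "1 \<le> t" for t
      using decay_compare[of R t R \<gamma> x0] that R \<gamma> A mult_mono[of 1 t 1 R]
      by (intro mult_left_mono) auto
    have "cmod (f z - f y) \<le> cmod (f z) + cmod (f y)" by (rule norm_triangle_ineq4)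
    also have "cmod (f z) \<le> A * (D * R powr (\<gamma> + \<omega>) * decay x0 \<gamma> R)"
      using f val[OF Rz] unfolding smooth_bound_def by (meson order_trans)
    also have "cmod (f y) \<le> A * (D * R powr (\<gamma> + \<omega>) * decay x0 \<gamma> R)"
      using f val[OF R] unfolding smooth_bound_def R_def by (meson order_trans)
    also have "A * (D * R powr (\<gamma> + \<omega>) * decay x0 \<gamma> R) + A * (D * R powr (\<gamma> + \<omega>) * decay x0 \<gamma> R)
        = 2 * D * A * P * R powr K"
      using R by (simp add: decay_split[of R x0 \<gamma> \<beta>] P_def K_def powr_add mult_ac)
    also have "\<dots> \<le> 2 * D * A * P * ((4 * A0) powr K * r powr \<beta> * u powr K)"
    proof -
      have "R powr K \<le> (4 * A0 * (r * u)) powr K" using Ru R K by (intro powr_mono2) auto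
      also have "\<dots> = (4 * A0) powr K * r powr K * u powr K"
        using A0_pos r u by (simp add: powr_mult mult_ac)
      also have "\<dots> \<le> (4 * A0) powr K * r powr \<beta> * u powr K"
        using r K by (intro mult_right_mono mult_left_mono powr_mono') auto
      finally show ?thesis using A P D_pos by (intro mult_left_mono) auto
    qed
    finally show "cmod (f z - f y) \<le> 2 * D * (4 * A0) powr K * A * r powr \<beta> * P * u powr K"
      by (simp add: mult_ac)
  qed
qed

lemma near_origin_far_from_centre:
  assumes "0 < r" "d z x0 < (r + d y x0) / (2 * A0)"
  shows "r + d y x0 \<le> 2 * A0 * (r * (1 + d y z / r))"
proof -
  define a b c where "a = A0 * d y z" and "b = A0 * d z x0" and "c = A0 * r"
  have "d y x0 \<le> a + b" using d_quasi_triangle[of y x0 z] by (simp add: a_def b_def algebra_simps)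
  moreover have "2 * b \<le> r + d y x0" using assms A0_pos by (simp add: b_def field_simps)
  moreover have "r \<le> c" using assms A0_ge_1 by (simp add: c_def)
  ultimately have "r + d y x0 \<le> 2 * c + 2 * a" by linarith
  moreover have "2 * A0 * (r * (1 + d y z / r)) = 2 * c + 2 * a"
    using assms by (simp add: a_def c_def field_simps)
  ultimately show ?thesis by simp
qed

text \<open>The coarse-scale analogue of the previous bound. The ball around \<open>x0\<close> where \<open>f\<close> is large is cut out,
and \<open>f y\<close> is subtracted only if \<open>y\<close> lies outside the scale \<open>r\<close>, since otherwise \<open>f y\<close> itself
is too large. What remains again grows at most like a power of \<open>1 + d y z / r\<close>.\<close>

lemma coarse_offset_bound:
  assumes \<beta>: "0 < \<beta>" and \<gamma>: "0 < \<gamma>" and f: "smooth_bound x0 \<beta> \<gamma> f A"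
    and r: "1 \<le> r"
  shows "cmod ((if d z x0 < (r + d y x0) / (2 * A0) then 0 else f z) - (if r \<le> d y x0 then f y else 0))
     \<le> 2 * D * (4 * A0) powr (\<beta> + \<gamma> + \<omega>) * A * r powr \<beta>
     * decay x0 (\<beta> + \<gamma>) (r + d y x0) * (1 + d y z / r) powr (\<beta> + \<gamma> + \<omega>)" (is "?L \<le> ?R")
proof -
  define T where "T = r + d y x0"
  define u where "u = 1 + d y z / r"
  define K where "K = \<beta> + \<gamma> + \<omega>"
  define P where "P = decay x0 (\<beta> + \<gamma>) T"
  define E where "E = D * (4 * A0) powr K * A * (r powr \<beta> * u powr K) * P"
  have RE: "?R = 2 * E" by (simp add: E_def T_def u_def K_def P_def mult_ac)
  have A: "0 \<le> A" using f by (rule smooth_bound_nonneg)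
  have T: "r \<le> T" "0 < T" "1 \<le> T" using d_nonneg[of y x0] r by (auto simp: T_def)
  have u: "1 \<le> u" using r d_nonneg[of y z] by (simp add: u_def)
  have du: "d y z \<le> r * u" using r by (simp add: u_def field_simps)
  have K: "0 \<le> K" "\<beta> \<le> K" using \<beta> \<gamma> \<omega>_nonneg by (auto simp: K_def)
  have P: "0 \<le> P" by (simp add: P_def)
  have E: "0 \<le> E" using A P D_pos by (simp add: E_def)
  \<comment> \<open>values of \<open>f\<close> at points not much closer to \<open>x0\<close> than \<open>T\<close>, when \<open>z\<close> is far from \<open>y\<close> on the scale \<open>T\<close>\<close>
  have val: "cmod (f w) \<le> E" if w: "T \<le> 2 * A0 * (1 + d w x0)" and Tu: "T \<le> 4 * A0 * (r * u)" for w
  proof -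
    have Rw: "0 < 1 + d w x0" using d_nonneg[of w x0] by linarith
    have "cmod (f w) \<le> A * decay x0 \<gamma> (1 + d w x0)" using f by (simp add: smooth_bound_def)
    also have "\<dots> \<le> A * (D * (2 * A0) powr (\<gamma> + \<omega>) * decay x0 \<gamma> T)"
      using A0_ge_1 \<gamma> T w Rw A by (intro mult_left_mono decay_compare) auto
    also have "\<dots> \<le> A * (D * (4 * A0) powr (\<gamma> + \<omega>) * decay x0 \<gamma> T)"
      using A0_ge_1 \<gamma> \<omega>_nonneg A D_pos by (intro mult_left_mono mult_right_mono powr_mono2) auto
    also have "decay x0 \<gamma> T = T powr \<beta> * P" unfolding P_def by (rule decay_split[OF T(2)])
    also have "A * (D * (4 * A0) powr (\<gamma> + \<omega>) * (T powr \<beta> * P)) \<le>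
       A * (D * (4 * A0) powr (\<gamma> + \<omega>) * (((4 * A0) powr \<beta> * r powr \<beta> * u powr K) * P))"
    proof -
      have "T powr \<beta> \<le> (4 * A0 * (r * u)) powr \<beta>" using Tu T \<beta> by (intro powr_mono2) auto
      also have "\<dots> = (4 * A0) powr \<beta> * r powr \<beta> * u powr \<beta>" using A0_pos r u by (simp add: powr_mult mult_ac)
      also have "\<dots> \<le> (4 * A0) powr \<beta> * r powr \<beta> * u powr K" using u K by (intro mult_left_mono powr_mono) auto
      finally show ?thesis using A D_pos P by (intro mult_left_mono mult_right_mono) auto
    qed
    also have "\<dots> = E" by (simp add: E_def K_def powr_add mult_ac)
    finally show ?thesis .
  qed
  have "?L \<le> 2 * E"
  proof (cases "r \<le> d y x0")
    case False
    have Tu: "T \<le> 4 * A0 * (r * u)"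
    proof -
      have "T \<le> 2 * r" using False by (simp add: T_def)
      also have "\<dots> \<le> 4 * (A0 * (r * u))"
      proof -
        have "1 \<le> A0 * u" using A0_ge_1 u mult_mono[of 1 A0 1 u] by simp
        then have "r * 1 \<le> r * (A0 * u)" using r by (intro mult_left_mono) auto
        moreover have "r * (A0 * u) = A0 * (r * u)" by simp
        ultimately show ?thesis using r by linarith
      qed
      finally show ?thesis by simp
    qed
    show ?thesis
    proof (cases "d z x0 < T / (2 * A0)")
      case True then show ?thesis using False E by (simp add: T_def)
    next
      case z: False
      then have "T \<le> 2 * A0 * d z x0" using A0_pos by (simp add: field_simps)
      also have "\<dots> \<le> 2 * A0 * (1 + d z x0)" using A0_pos by simp
      finally have "cmod (f z) \<le> E" using Tu by (rule val)
      then show ?thesis using False z E by (simp add: T_def)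
    qed
  next
    case True
    have Ty: "T \<le> 2 * (1 + d y x0)" using True by (simp add: T_def)
    also have "\<dots> \<le> 2 * A0 * (1 + d y x0)" using A0_ge_1 d_nonneg[of y x0] by (intro mult_right_mono) auto
    finally have Ty': "T \<le> 2 * A0 * (1 + d y x0)" .
    show ?thesis
    proof (cases "d z x0 < T / (2 * A0)")
      case z: True
      then have "T \<le> 2 * A0 * (r * u)"
        using near_origin_far_from_centre[of r z x0 y] r by (simp add: T_def u_def)
      also have "\<dots> \<le> 4 * A0 * (r * u)" using r u A0_pos by (intro mult_right_mono) auto
      finally have "cmod (f y) \<le> E" by (rule val[OF Ty'])
      then show ?thesis using True z E by (simp add: T_def)
    next
      case z: False
      have L: "?L = cmod (f y - f z)" using True z by (simp add: T_def norm_minus_commute)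
      show ?thesis
      proof (cases "d y z < (1 + d y x0) / (2 * A0)")
        case near: True
        then have "cmod (f y - f z) \<le> A * d y z powr \<beta> * decay x0 (\<beta> + \<gamma>) (1 + d y x0)"
          using f unfolding smooth_bound_def by blast
        also have "\<dots> \<le> A * (r powr \<beta> * u powr K) * (D * (4 * A0) powr K * P)"
        proof -
          have 1: "d y z powr \<beta> \<le> r powr \<beta> * u powr K"
            unfolding u_def using r \<beta> K by (intro dist_powr_le) auto
          have "decay x0 (\<beta> + \<gamma>) (1 + d y x0) \<le> D * (4 * A0) powr (\<beta> + \<gamma> + \<omega>) * P"
            unfolding P_def
          proof (rule decay_compare)
            show "T \<le> 4 * A0 * (1 + d y x0)" using Ty' mult_right_mono[of "2 * A0" "4 * A0" "1 + d y x0"] A0_pos d_nonneg[of y x0] by linarith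
          qed (use T A0_ge_1 \<beta> \<gamma> d_nonneg[of y x0] in auto)
          then show ?thesis using 1 A P D_pos unfolding K_def[symmetric]
            by (intro mult_mono) auto
        qed
        also have "\<dots> = E" by (simp add: E_def mult_ac)
        finally show ?thesis using E L by linarith
      next
        case far: False
        have "T \<le> 2 * (1 + d y x0)" by (rule Ty)
        also have "\<dots> \<le> 4 * A0 * d y z" using far A0_pos by (simp add: field_simps)
        also have "\<dots> \<le> 4 * A0 * (r * u)" using du A0_pos by (intro mult_left_mono) auto
        finally have Tu: "T \<le> 4 * A0 * (r * u)" .
        have "T \<le> 2 * A0 * d z x0" using z A0_pos by (simp add: field_simps)
        also have "\<dots> \<le> 2 * A0 * (1 + d z x0)" using A0_pos by simp
        finally have "cmod (f z) \<le> E" using Tu by (rule val)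
        moreover have "cmod (f y) \<le> E" using Ty' Tu by (rule val)
        ultimately show ?thesis unfolding L using norm_triangle_ineq4[of "f y" "f z"] by linarith
      qed
    qed
  qed
  then show ?thesis using RE by simp
qed

text \<open>Cutting a molecule off to the ball around \<open>x0\<close> and subtracting its value at \<open>x0\<close> yields, by
Hoelder continuity, a function that is small within distance \<open>r\<close> of \<open>x0\<close>. On the cut-off ball the molecule
still has the decay of its value at \<open>x0\<close>, because that ball stays away from \<open>y\<close> unless
\<open>d y x0\<close> is of order \<open>r\<close>.\<close>

lemma molecule_offset_bound:
  assumes \<eta>: "0 < \<eta>" "\<eta> \<le> 1" and N: "0 \<le> N" and \<phi>: "molecule N \<eta> y r B \<phi>" and r: "0 < r"
  shows "cmod ((if d z x0 < (r + d y x0) / (2 * A0) then \<phi> z else 0) - \<phi> x0)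
    \<le> (1 + (2 * A0) powr N + 2 * A0) * B * ((r + d y x0) / r) powr (- N) * min 1 ((1 + d z x0) / r) powr \<eta>"
proof -
  define T where "T = r + d y x0"
  define m where "m = min 1 ((1 + d z x0) / r) powr \<eta>"
  define Q where "Q = B * (T / r) powr (- N)"
  have B: "0 \<le> B" using \<phi> by (rule molecule_nonneg)
  have Q: "0 \<le> Q" using B by (simp add: Q_def)
  have T: "r \<le> T" "0 < T" using d_nonneg[of y x0] r by (auto simp: T_def)
  have Tr: "T / r = 1 + d y x0 / r" using r by (simp add: T_def field_simps)
  have m0: "0 \<le> m" by (simp add: m_def)
  have \<phi>0: "cmod (\<phi> x0) \<le> Q" using \<phi> by (simp add: molecule_def Q_def Tr)
  have a: "1 \<le> 2 * A0" using A0_ge_1 by simp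
  have c: "0 \<le> (2 * A0) powr N" by simp
  have "cmod ((if d z x0 < T / (2 * A0) then \<phi> z else 0) - \<phi> x0) \<le> (1 + (2 * A0) powr N + 2 * A0) * (Q * m)"
  proof (cases "d z x0 < T / (2 * A0)")
    case True
    show ?thesis
    proof (cases "d z x0 \<le> r")
      case near: True
      have "cmod (\<phi> x0 - \<phi> z) \<le> B * (d x0 z / r) powr \<eta> * (1 + d y x0 / r) powr (- N)"
        using \<phi> near d_sym[of x0 z] unfolding molecule_def by metis
      also have "\<dots> = Q * (d x0 z / r) powr \<eta>" by (simp add: Q_def Tr)
      also have "\<dots> \<le> Q * m"
        unfolding m_def using near r d_nonneg[of x0 z] \<eta> Q
        by (intro mult_left_mono powr_mono2) (auto simp: d_sym[of x0 z] divide_right_mono)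
      also have "\<dots> \<le> (1 + (2 * A0) powr N + 2 * A0) * (Q * m)"
        using mult_right_mono[of 1 "1 + (2 * A0) powr N + 2 * A0" "Q * m"] a c Q m0 by simp
      finally show ?thesis using True by (simp add: norm_minus_commute)
    next
      case far: False
      then have m1: "m = 1" using r by (simp add: m_def min_def)
      define u where "u = 1 + d y z / r"
      have u: "1 \<le> u" using r d_nonneg[of y z] by (simp add: u_def)
      have "T \<le> 2 * A0 * (r * u)" unfolding T_def u_def
        using near_origin_far_from_centre[of r z x0 y] r True by (simp add: T_def)
      then have Tu: "T / r / (2 * A0) \<le> u" using r A0_pos by (simp add: field_simps)
      have "cmod (\<phi> z) \<le> B * u powr (- N)" using \<phi> by (simp add: molecule_def u_def)
      also have "\<dots> \<le> B * (T / r / (2 * A0)) powr (- N)"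
        using Tu B T r A0_pos N by (intro mult_left_mono powr_mono2') auto
      also have "(T / r / (2 * A0)) powr (- N) = (2 * A0) powr N * (T / r) powr (- N)"
        unfolding powr_divide[of "T / r" "2 * A0"] powr_minus[of "2 * A0"]
        by (simp only: divide_inverse inverse_inverse_eq mult.commute)
      also have "B * \<dots> = (2 * A0) powr N * Q"
        by (simp add: Q_def mult_ac)
      finally have "cmod (\<phi> z) \<le> (2 * A0) powr N * Q" .
      then have "cmod (\<phi> z - \<phi> x0) \<le> (2 * A0) powr N * Q + Q"
        using \<phi>0 norm_triangle_ineq4[of "\<phi> z" "\<phi> x0"] by linarith
      also have "\<dots> \<le> (1 + (2 * A0) powr N + 2 * A0) * Q" using a Q by (simp add: algebra_simps)
      finally show ?thesis using True m1 by simp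
    qed
  next
    case False
    have "r / (2 * A0) \<le> T / (2 * A0)" using T A0_pos by (simp add: divide_right_mono)
    then have "r / (2 * A0) \<le> 1 + d z x0" using False by linarith
    then have "1 / (2 * A0) \<le> min 1 ((1 + d z x0) / r)" using a r A0_pos by (simp add: field_simps)
    then have "(1 / (2 * A0)) powr \<eta> \<le> m" unfolding m_def using \<eta> A0_pos by (intro powr_mono2) auto
    moreover have "(1 / (2 * A0)) powr 1 \<le> (1 / (2 * A0)) powr \<eta>" using \<eta> a by (intro powr_mono') auto
    ultimately have "1 / (2 * A0) \<le> m" using A0_pos by simp
    then have "1 \<le> 2 * A0 * m" using A0_pos by (simp add: field_simps)
    then have "Q * 1 \<le> Q * (2 * A0 * m)" using Q by (rule mult_left_mono)
    then have "cmod (\<phi> x0) \<le> 2 * A0 * (Q * m)" using \<phi>0 by (simp add: mult_ac)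
    also have "\<dots> \<le> (1 + (2 * A0) powr N + 2 * A0) * (Q * m)"
      using Q m0 c by (intro mult_right_mono) auto
    finally show ?thesis using False by simp
  qed
  then show ?thesis by (simp add: T_def Q_def m_def mult_ac)
qed

end

context volume_growth
begin

text \<open>For an \<open>L\<^sup>2\<close>-normalised wavelet one has \<open>B = V r y powr (- 1 / 2)\<close>, up to a constant. The argument
of the profile is the distance from \<open>x0\<close> seen at the coarser of the scales 1 and \<open>r\<close>.\<close>

definition coefficient_bound :: "real \<Rightarrow> real \<Rightarrow> real \<Rightarrow> real \<Rightarrow> real \<Rightarrow> real \<Rightarrow> bool" where
  "coefficient_bound \<eta> \<beta> \<gamma> N r C \<longleftrightarrow> (\<forall>f \<phi> x0 y A B.
     smooth_bound x0 \<beta> \<gamma> f A \<longrightarrow> mean_zero f \<longrightarrow> molecule N \<eta> y r B \<phi> \<longrightarrow>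
     cmod (l2_inner M f \<phi>) \<le> C * A * B * V r y * r powr \<beta> * decay x0 (\<beta> + \<gamma>) (max 1 r + d y x0))"

lemma coefficient_bound_mono:
  assumes "coefficient_bound \<eta> \<beta> \<gamma> N r C" "C \<le> C'"
  shows "coefficient_bound \<eta> \<beta> \<gamma> N r C'"
  unfolding coefficient_bound_def
proof (intro allI impI)
  fix f \<phi> x0 y A B
  assume h: "smooth_bound x0 \<beta> \<gamma> f A" "mean_zero f" "molecule N \<eta> y r B \<phi>"
  then have "cmod (l2_inner M f \<phi>) \<le> C * A * B * V r y * r powr \<beta> * decay x0 (\<beta> + \<gamma>) (max 1 r + d y x0)"
    using assms(1) by (simp add: coefficient_bound_def)
  also have "\<dots> \<le> C' * A * B * V r y * r powr \<beta> * decay x0 (\<beta> + \<gamma>) (max 1 r + d y x0)"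
    using smooth_bound_nonneg[OF h(1)] molecule_nonneg[OF h(3)] assms(2) by (intro mult_right_mono) auto
  finally show "cmod (l2_inner M f \<phi>) \<le> C' * A * B * V r y * r powr \<beta> * decay x0 (\<beta> + \<gamma>) (max 1 r + d y x0)" .
qed

lemma fine_coefficient_ex:
  assumes \<beta>: "0 < \<beta>" and \<gamma>: "0 < \<gamma>" and N: "\<beta> + \<gamma> + 2 * \<omega> + 1 \<le> N"
  shows "\<exists>C\<ge>0. \<forall>r>0. r \<le> 1 \<longrightarrow> coefficient_bound \<eta> \<beta> \<gamma> N r C"
proof -
  define K where "K = \<beta> + \<gamma> + \<omega>"
  define c where "c = 2 * D * (4 * A0) powr K"
  have c: "0 \<le> c" using D_pos by (simp add: c_def)
  have KN: "K + \<omega> + 1 \<le> N" using N by (simp add: K_def)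
  obtain C where C0: "0 \<le> C" and
    C: "\<And>(g :: 'a \<Rightarrow> complex) \<phi> G B K N y r. 0 < r \<Longrightarrow> K + \<omega> + 1 \<le> N \<Longrightarrow> 0 \<le> G \<Longrightarrow> 0 \<le> B \<Longrightarrow>
     g \<in> borel_measurable M \<Longrightarrow> \<phi> \<in> borel_measurable M \<Longrightarrow>
     (\<forall>z. cmod (g z) \<le> G * (1 + d y z / r) powr K) \<Longrightarrow>
     (\<forall>z. cmod (\<phi> z) \<le> B * (1 + d y z / r) powr (- N)) \<Longrightarrow>
     integrable M (\<lambda>z. g z * cnj (\<phi> z)) \<and>
     cmod (LINT z|M. g z * cnj (\<phi> z)) \<le> C * G * B * V r y"
    using pairing_growth_ex by blast
  have main: "cmod (l2_inner M f \<phi>) \<le> C * c * A * B * V r y * r powr \<beta> * decay x0 (\<beta> + \<gamma>) (1 + d y x0)"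
    if r: "0 < r" "r \<le> 1" and f: "smooth_bound x0 \<beta> \<gamma> f A" and f0: "mean_zero f"
      and \<phi>: "molecule N \<eta> y r B \<phi>" for f \<phi> :: "'a \<Rightarrow> complex" and x0 y r A B
  proof -
    have [measurable]: "f \<in> borel_measurable M" "\<phi> \<in> borel_measurable M"
      using f0 molecule_measurable[OF \<phi>] by (auto simp: has_bochner_integral_iff)
    define G where "G = c * A * r powr \<beta> * decay x0 (\<beta> + \<gamma>) (1 + d y x0)"
    have A: "0 \<le> A" using f by (rule smooth_bound_nonneg)
    have B: "0 \<le> B" using \<phi> by (rule molecule_nonneg)
    have G: "0 \<le> G" using A c by (simp add: G_def)
    have g: "\<forall>z. cmod (f z - f y) \<le> G * (1 + d y z / r) powr K"
      using fine_offset_bound[OF \<beta> \<gamma> f r, where y = y] by (simp add: G_def c_def K_def)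
    have \<phi>b: "\<forall>z. cmod (\<phi> z) \<le> B * (1 + d y z / r) powr (- N)" using \<phi> by (simp add: molecule_def)
    have I: "integrable M (\<lambda>z. (f z - f y) * cnj (\<phi> z))"
      "cmod (LINT z|M. (f z - f y) * cnj (\<phi> z)) \<le> C * G * B * V r y"
      using C[OF r(1) KN G B _ _ g \<phi>b] by auto
    have \<phi>i: "integrable M \<phi>" "(LINT z|M. \<phi> z) = 0"
      using \<phi> by (auto simp: molecule_def has_bochner_integral_iff)
    have eq: "f z * cnj (\<phi> z) = (f z - f y) * cnj (\<phi> z) + f y * cnj (\<phi> z)" for z
      by (simp add: algebra_simps)
    have "l2_inner M f \<phi> = (LINT z|M. (f z - f y) * cnj (\<phi> z))"
      unfolding l2_inner_def eq using I(1) \<phi>i by (subst Bochner_Integration.integral_add) auto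
    then show ?thesis using I(2) by (simp add: G_def mult_ac)
  qed
  show ?thesis
    unfolding coefficient_bound_def using main C0 c by (intro exI[of _ "C * c"]) (auto simp: max_absorb1)
qed

text \<open>Both cancellations are used: that of the molecule for the part of \<open>f\<close> controlled by
\<open>coarse_offset_bound\<close>, that of \<open>f\<close> for the part near \<open>x0\<close>, which is paired with the function of
\<open>molecule_offset_bound\<close> and estimated by the moment of \<open>decay_moment_ex\<close>.\<close>

lemma coarse_coefficient_ex:
  assumes \<beta>: "0 < \<beta>" and \<gamma>: "0 < \<gamma>" "\<gamma> < \<eta>" and \<eta>: "\<eta> \<le> 1" and N: "\<beta> + \<gamma> + 2 * \<omega> + 1 \<le> N"
  shows "\<exists>C\<ge>0. \<forall>r\<ge>1. coefficient_bound \<eta> \<beta> \<gamma> N r C"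
proof -
  define K where "K = \<beta> + \<gamma> + \<omega>"
  define c where "c = 2 * D * (4 * A0) powr K"
  define c2 where "c2 = 1 + (2 * A0) powr N + 2 * A0"
  define c4 where "c4 = D * (2 * A0) powr \<omega>"
  have c: "0 \<le> c" "0 \<le> c2" "0 \<le> c4" using D_pos A0_pos by (auto simp: c_def c2_def c4_def)
  have KN: "K + \<omega> + 1 \<le> N" using N by (simp add: K_def)
  have N0: "0 \<le> N" "K \<le> N" using KN \<beta> \<gamma> \<omega>_nonneg by (auto simp: K_def)
  obtain C where C0: "0 \<le> C" and
    C: "\<And>(g :: 'a \<Rightarrow> complex) \<phi> G B K N y r. 0 < r \<Longrightarrow> K + \<omega> + 1 \<le> N \<Longrightarrow> 0 \<le> G \<Longrightarrow> 0 \<le> B \<Longrightarrow>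
     g \<in> borel_measurable M \<Longrightarrow> \<phi> \<in> borel_measurable M \<Longrightarrow>
     (\<forall>z. cmod (g z) \<le> G * (1 + d y z / r) powr K) \<Longrightarrow>
     (\<forall>z. cmod (\<phi> z) \<le> B * (1 + d y z / r) powr (- N)) \<Longrightarrow>
     integrable M (\<lambda>z. g z * cnj (\<phi> z)) \<and>
     cmod (LINT z|M. g z * cnj (\<phi> z)) \<le> C * G * B * V r y"
    using pairing_growth_ex by blast
  obtain C3 where C3: "0 \<le> C3" "\<And>x0 r. 1 \<le> r \<Longrightarrow>
     (\<integral>\<^sup>+z. ennreal (decay x0 \<gamma> (1 + d z x0) * min 1 ((1 + d z x0) / r) powr \<eta>) \<partial>M) \<le> ennreal (C3 * r powr (- \<gamma>))"
    using decay_moment_ex[OF \<gamma>] by blast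
  have main: "cmod (l2_inner M f \<phi>) \<le> (C * c + c2 * C3 * c4) * A * B * V r y * r powr \<beta> * decay x0 (\<beta> + \<gamma>) (r + d y x0)"
    if r: "1 \<le> r" and f: "smooth_bound x0 \<beta> \<gamma> f A" and f0: "mean_zero f"
      and \<phi>: "molecule N \<eta> y r B \<phi>" for f \<phi> :: "'a \<Rightarrow> complex" and x0 y r A B
  proof -
    have r0: "0 < r" using r by simp
    have f_meas [measurable]: "f \<in> borel_measurable M" and [measurable]: "\<phi> \<in> borel_measurable M"
      using f0 molecule_measurable[OF \<phi>] by (auto simp: has_bochner_integral_iff)
    define T where "T = r + d y x0"
    have T: "r \<le> T" "0 < T" using d_nonneg[of y x0] r by (auto simp: T_def)
    define P where "P = decay x0 (\<beta> + \<gamma>) T"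
    define G where "G = c * A * r powr \<beta> * P"
    have P: "0 \<le> P" by (simp add: P_def)
    have A: "0 \<le> A" using f by (rule smooth_bound_nonneg)
    have B: "0 \<le> B" using \<phi> by (rule molecule_nonneg)
    have G: "0 \<le> G" using A c P by (simp add: G_def)
    \<comment> \<open>splitting of \<open>f\<close> into a slowly growing part, a constant, and the part near \<open>x0\<close>\<close>
    define b where "b = (if r \<le> d y x0 then f y else 0)"
    define g where "g z = (if d z x0 < T / (2 * A0) then 0 else f z) - b" for z
    define h where "h z = (if d z x0 < T / (2 * A0) then \<phi> z else 0) - \<phi> x0" for z
    have [measurable]: "g \<in> borel_measurable M" "h \<in> borel_measurable M"
      unfolding g_def[abs_def] h_def[abs_def] by measurable
    have gb: "\<forall>z. cmod (g z) \<le> G * (1 + d y z / r) powr K"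
      using coarse_offset_bound[OF \<beta> \<gamma>(1) f r, where y = y] by (simp add: g_def b_def G_def c_def K_def T_def P_def)
    have \<phi>b: "\<forall>z. cmod (\<phi> z) \<le> B * (1 + d y z / r) powr (- N)" using \<phi> by (simp add: molecule_def)
    have I: "integrable M (\<lambda>z. g z * cnj (\<phi> z))"
      "cmod (LINT z|M. g z * cnj (\<phi> z)) \<le> C * G * B * V r y"
      using C[OF r0 KN G B _ _ gb \<phi>b] by auto
    have \<phi>i: "integrable M \<phi>" "(LINT z|M. \<phi> z) = 0"
      using \<phi> by (auto simp: molecule_def has_bochner_integral_iff)
    have fi: "integrable M f" "(LINT z|M. f z) = 0"
      using f0 by (auto simp: has_bochner_integral_iff)
    define q where "q = A * (c2 * B * (T / r) powr (- N))"
    have q: "0 \<le> q" using A B c by (simp add: q_def)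
    define w where "w z = decay x0 \<gamma> (1 + d z x0) * min 1 ((1 + d z x0) / r) powr \<eta>" for z
    have w: "integrable M w" "(LINT z|M. w z) \<le> C3 * r powr (- \<gamma>)"
      unfolding w_def using C3(1)
      by (auto intro!: nn_integral_le_imp_integrable[OF _ _ _ C3(2)[OF r]])
    have fh: "cmod (f z * cnj (h z)) \<le> q * w z" for z
    proof -
      have "cmod (f z) \<le> A * decay x0 \<gamma> (1 + d z x0)" using f by (simp add: smooth_bound_def)
      moreover have "cmod (h z) \<le> c2 * B * (T / r) powr (- N) * min 1 ((1 + d z x0) / r) powr \<eta>"
        using molecule_offset_bound[OF _ \<eta> N0(1) \<phi> r0] \<gamma> by (simp add: h_def T_def c2_def)
      ultimately have "cmod (f z * cnj (h z)) \<le> (A * decay x0 \<gamma> (1 + d z x0)) * (c2 * B * (T / r) powr (- N) * min 1 ((1 + d z x0) / r) powr \<eta>)"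
        unfolding norm_mult complex_mod_cnj using A by (intro mult_mono) auto
      then show ?thesis by (simp add: q_def w_def mult_ac)
    qed
    have qw: "integrable M (\<lambda>z. q * w z)" using w(1) by simp
    have J: "integrable M (\<lambda>z. f z * cnj (h z))"
      by (rule norm_integral_le_dominated(1)[OF qw _ fh]) measurable
    have "cmod (LINT z|M. f z * cnj (h z)) \<le> (LINT z|M. q * w z)"
      by (rule norm_integral_le_dominated(2)[OF qw _ fh]) measurable
    also have "\<dots> = q * (LINT z|M. w z)" by simp
    also have "\<dots> \<le> q * (C3 * r powr (- \<gamma>))" using w q by (intro mult_left_mono) auto
    also have "\<dots> = A * B * c2 * C3 * ((T / r) powr (- N) * r powr (- \<gamma>))" by (simp add: q_def)
    also have "\<dots> \<le> A * B * c2 * C3 * (c4 * V r y * r powr \<beta> * P)"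
    proof (rule mult_left_mono)
      have Tr: "1 \<le> T / r" using T r by simp
      have "V T x0 \<le> V (2 * A0 * (T / r) * r) y"
      proof (rule V_mono_ball[OF qball_subset])
        have "A0 * (d x0 y + T) \<le> A0 * (2 * T)" using A0_pos r by (intro mult_left_mono) (auto simp: T_def d_sym[of x0 y])
        then show "A0 * (d x0 y + T) \<le> 2 * A0 * (T / r) * r" using r by simp
      qed (use A0_pos T r in auto)
      also have "\<dots> \<le> D * (2 * A0 * (T / r)) powr \<omega> * V r y"
      proof (rule V_growth[OF r0])
        show "1 \<le> 2 * A0 * (T / r)" using A0_ge_1 Tr mult_mono[of 1 "2 * A0" 1 "T / r"] by simp
      qed
      also have "\<dots> = c4 * (T / r) powr \<omega> * V r y"
        unfolding c4_def by (subst powr_mult) (use A0_pos T r in auto)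
      finally have VT: "V T x0 \<le> c4 * (T / r) powr \<omega> * V r y" .
      have VTp: "0 < V T x0" using T by (intro V_pos)
      have "(T / r) powr (- N) \<le> (T / r) powr (- K)" using Tr N0 by (intro powr_mono) auto
      also have "\<dots> = (T / r) powr (- \<omega>) * (T / r) powr (- (\<beta> + \<gamma>))" by (simp add: K_def flip: powr_add)
      finally have "(T / r) powr (- N) * r powr (- \<gamma>) \<le> (T / r) powr (- \<omega>) * (T / r) powr (- (\<beta> + \<gamma>)) * r powr (- \<gamma>)"
        by (rule mult_right_mono) simp
      also have "(T / r) powr (- (\<beta> + \<gamma>)) = T powr (- (\<beta> + \<gamma>)) * r powr (\<beta> + \<gamma>)"
        unfolding powr_divide[of T r] powr_minus[of r] by (simp only: divide_inverse inverse_inverse_eq)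
      also have "(T / r) powr (- \<omega>) * (T powr (- (\<beta> + \<gamma>)) * r powr (\<beta> + \<gamma>)) * r powr (- \<gamma>)
         = (T / r) powr (- \<omega>) * (r powr \<beta> * T powr (- (\<beta> + \<gamma>)))"
        using r by (simp add: mult_ac flip: powr_add)
      also have "\<dots> \<le> (c4 * V r y / V T x0) * (r powr \<beta> * T powr (- (\<beta> + \<gamma>)))"
      proof (rule mult_right_mono)
        have "(T / r) powr (- \<omega>) * V T x0 \<le> (T / r) powr (- \<omega>) * (c4 * (T / r) powr \<omega> * V r y)"
          using VT by (rule mult_left_mono) simp
        also have "\<dots> = c4 * V r y" using Tr T r by (simp add: powr_minus)
        finally show "(T / r) powr (- \<omega>) \<le> c4 * V r y / V T x0" using VTp by (simp add: field_simps)
      qed simp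
      also have "\<dots> = c4 * V r y * r powr \<beta> * P" by (simp add: P_def decay_def)
      finally show "(T / r) powr (- N) * r powr (- \<gamma>) \<le> c4 * V r y * r powr \<beta> * P" .
    qed (use A B c C3 in auto)
    finally have J2: "cmod (LINT z|M. f z * cnj (h z)) \<le> A * B * c2 * C3 * (c4 * V r y * r powr \<beta> * P)" .
    \<comment> \<open>the two terms in the second bracket integrate to 0 by the cancellation of \<open>\<phi>\<close> and of \<open>f\<close>\<close>
    have eq: "f z * cnj (\<phi> z) = (g z * cnj (\<phi> z) + f z * cnj (h z)) + (b * cnj (\<phi> z) + cnj (\<phi> x0) * f z)" for z
      by (simp add: g_def h_def algebra_simps)
    have S: "integrable M (\<lambda>z. g z * cnj (\<phi> z) + f z * cnj (h z))" "integrable M (\<lambda>z. b * cnj (\<phi> z) + cnj (\<phi> x0) * f z)"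
      using I(1) J \<phi>i fi by (auto intro!: Bochner_Integration.integrable_add)
    have "l2_inner M f \<phi> = (LINT z|M. g z * cnj (\<phi> z)) + (LINT z|M. f z * cnj (h z))"
    proof -
      have "(LINT z|M. b * cnj (\<phi> z) + cnj (\<phi> x0) * f z) = 0"
        using \<phi>i fi by (subst Bochner_Integration.integral_add) auto
      then show ?thesis
        unfolding l2_inner_def eq using S I(1) J
        by (simp add: Bochner_Integration.integral_add[OF S] Bochner_Integration.integral_add[OF I(1) J])
    qed
    then show ?thesis
      using I(2) J2 norm_triangle_ineq[of "LINT z|M. g z * cnj (\<phi> z)" "LINT z|M. f z * cnj (h z)"]
      by (simp add: G_def T_def P_def algebra_simps)
  qed
  show ?thesis
    unfolding coefficient_bound_def using main C0 C3(1) c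
    by (intro exI[of _ "C * c + c2 * C3 * c4"]) (auto simp: max_absorb2)
qed

lemma coefficient_bound_ex:
  assumes \<beta>: "0 < \<beta>" and \<gamma>: "0 < \<gamma>" "\<gamma> < \<eta>" and \<eta>: "\<eta> \<le> 1" and N: "\<beta> + \<gamma> + 2 * \<omega> + 1 \<le> N"
  shows "\<exists>C\<ge>0. \<forall>r>0. coefficient_bound \<eta> \<beta> \<gamma> N r C"
proof -
  obtain C1 where C1: "0 \<le> C1" "\<forall>r>0. r \<le> 1 \<longrightarrow> coefficient_bound \<eta> \<beta> \<gamma> N r C1"
    using fine_coefficient_ex[OF \<beta> \<gamma>(1) N] by blast
  obtain C2 where C2: "0 \<le> C2" "\<forall>r\<ge>1. coefficient_bound \<eta> \<beta> \<gamma> N r C2"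
    using coarse_coefficient_ex[OF \<beta> \<gamma> \<eta> N] by blast
  have "coefficient_bound \<eta> \<beta> \<gamma> N r (C1 + C2)" if "0 < r" for r
  proof (cases "r \<le> 1")
    case True
    then have "coefficient_bound \<eta> \<beta> \<gamma> N r C1" using C1(2) that by simp
    then show ?thesis by (rule coefficient_bound_mono) (use C2(1) in simp)
  next
    case False
    then have "coefficient_bound \<eta> \<beta> \<gamma> N r C2" using C2(2) by simp
    then show ?thesis by (rule coefficient_bound_mono) (use C1(1) in simp)
  qed
  then show ?thesis using C1(1) C2(1) by (intro exI[of _ "C1 + C2"]) auto
qed

end

section \<open>Wavelets of one level\<close>

lemma exp_le_powr_ex:
  fixes \<nu> a N :: real
  assumes "0 < \<nu>" "0 < a" "0 \<le> N"
  shows "\<exists>C\<ge>0. \<forall>s\<ge>0. exp (- \<nu> * s powr a) \<le> C * (1 + s) powr (- N)"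
proof -
  \<comment> \<open>the index of a single term of the exponential series that beats the power \<open>N\<close>\<close>
  define m where "m = nat \<lceil>N / a\<rceil>"
  have "N / a \<le> real m" by (simp add: m_def real_nat_ceiling_ge)
  then have m: "N \<le> a * real m" using assms by (simp add: field_simps)
  define c where "c = max 1 (fact m / \<nu> ^ m)"
  have c: "1 \<le> c" "fact m / \<nu> ^ m \<le> c" by (auto simp: c_def)
  have "exp (- \<nu> * s powr a) \<le> 2 powr N * c * (1 + s) powr (- N)" if s: "0 \<le> s" for s
  proof -
    have key: "(1 + s) powr N \<le> 2 powr N * c * exp (\<nu> * s powr a)"
    proof (cases "s \<le> 1")
      case True
      have "(1 + s) powr N \<le> 2 powr N" using s True assms by (intro powr_mono2) auto
      also have "\<dots> \<le> 2 powr N * (c * exp (\<nu> * s powr a))"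
      proof -
        have "1 \<le> exp (\<nu> * s powr a)" using assms by simp
        then have "1 * 1 \<le> c * exp (\<nu> * s powr a)" using c by (intro mult_mono) auto
        then show ?thesis by simp
      qed
      finally show ?thesis by simp
    next
      case False
      define x where "x = \<nu> * s powr a"
      have x: "0 \<le> x" using assms by (simp add: x_def)
      have "x ^ m / fact m \<le> exp x"
      proof -
        have "x ^ m / fact m = (\<Sum>n\<in>{m}. x ^ n / fact n)" by simp
        also have "\<dots> \<le> (\<Sum>n. x ^ n / fact n)"
          using x by (intro sum_le_suminf) (auto simp: summable_exp_generic divide_inverse mult.commute intro: summable_exp)
        also have "\<dots> = exp x" by (simp add: exp_def divide_inverse mult.commute)
        finally show ?thesis .
      qed
      then have "x ^ m \<le> fact m * exp x" by (simp add: field_simps)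
      moreover have "x ^ m = \<nu> ^ m * s powr (a * real m)"
        using False by (simp add: x_def power_mult_distrib powr_powr flip: powr_realpow)
      ultimately have sm: "s powr (a * real m) \<le> fact m / \<nu> ^ m * exp x"
        using assms by (simp add: field_simps)
      have "(1 + s) powr N \<le> (2 * s) powr N" using False assms by (intro powr_mono2) auto
      also have "\<dots> = 2 powr N * s powr N" using False by (simp add: powr_mult)
      also have "\<dots> \<le> 2 powr N * s powr (a * real m)" using False m by (intro mult_left_mono powr_mono) auto
      also have "\<dots> \<le> 2 powr N * (fact m / \<nu> ^ m * exp x)" using sm by (intro mult_left_mono) auto
      also have "\<dots> \<le> 2 powr N * (c * exp x)" using c by (intro mult_left_mono mult_right_mono) auto
      finally show ?thesis by (simp add: x_def)
    qed
    have p: "0 < (1 + s) powr N" using s by simp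
    have "exp (- \<nu> * s powr a) = 1 / exp (\<nu> * s powr a)" by (simp add: exp_minus divide_inverse)
    also have "\<dots> \<le> 2 powr N * c / (1 + s) powr N" using key p by (simp add: field_simps)
    finally show ?thesis using s by (simp add: powr_minus divide_inverse)
  qed
  then show ?thesis using c by (intro exI[of _ "2 powr N * c"]) auto
qed

locale wavelet_growth = wavelet_basis d A0 M \<delta> X \<eta> \<psi> + volume_growth d A0 M D \<omega>
  for d :: "'a \<Rightarrow> 'a \<Rightarrow> real" and A0 :: real and M :: "'a measure"
    and \<delta> :: real and X :: "int \<Rightarrow> 'a set" and \<eta> :: real and \<psi> :: "int \<Rightarrow> 'a \<Rightarrow> 'a \<Rightarrow> complex"
    and D \<omega> :: real
begin

abbreviation sc :: "int \<Rightarrow> real" where "sc k \<equiv> \<delta> powi k"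

text \<open>Summing over one level uses up to \<open>\<beta> + \<gamma> + \<omega>\<close> powers for the variation of the profile and
\<open>2 * \<omega> + 1\<close> for counting the centres; the coefficient bound uses no more than that, and \<open>\<beta> + \<gamma> \<le> 2\<close>.\<close>

abbreviation decay_order :: real where "decay_order \<equiv> 3 * \<omega> + 3"

text \<open>The size at its centre of a wavelet of norm 1 in \<open>L\<^sup>2\<close>.\<close>

abbreviation normalizer :: "int \<Rightarrow> 'a \<Rightarrow> real" where "normalizer k y \<equiv> V (sc k) y powr (- 1 / 2)"

abbreviation coef :: "('a \<Rightarrow> complex) \<Rightarrow> int \<Rightarrow> 'a \<Rightarrow> complex" where
  "coef f k y \<equiv> l2_inner M f (\<psi> k y)"

lemma sc_pos: "0 < sc k" using \<delta>_range by simp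

lemma wavelet_molecule_ex:
  "\<exists>B\<ge>0. \<forall>k. \<forall>y\<in>new_points X k. molecule decay_order \<eta> y (sc k) (B * normalizer k y) (\<psi> k y)"
proof -
  define a where "a = 1 / (1 + 2 * log 2 A0)"
  have "0 \<le> log 2 A0" using A0_ge_1 by simp
  then have a: "0 < a" by (simp add: a_def add_pos_nonneg)
  obtain C \<nu> where \<nu>: "0 < \<nu>" and
    1: "\<And>k y x. y \<in> new_points X k \<Longrightarrow> cmod (\<psi> k y x) \<le> C * normalizer k y
             * exp (- \<nu> * (d y x / sc k) powr a)" and
    2: "\<And>k y x z. y \<in> new_points X k \<Longrightarrow> d x z \<le> sc k \<Longrightarrow>
             cmod (\<psi> k y x - \<psi> k y z) \<le> C * normalizer k y
             * (d x z / sc k) powr \<eta> * exp (- \<nu> * (d y x / sc k) powr a)"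
    using estimates unfolding a_def by blast
  obtain c where c: "0 \<le> c" "\<And>s. 0 \<le> s \<Longrightarrow> exp (- \<nu> * s powr a) \<le> c * (1 + s) powr (- decay_order)"
    using exp_le_powr_ex[OF \<nu> a, of decay_order] \<omega>_nonneg by auto
  have main: "C * v * e \<le> \<bar>C\<bar> * c * v * p" if "0 \<le> v" "0 \<le> e" "e \<le> c * p" for v e p
  proof -
    have "C * v * e \<le> \<bar>C\<bar> * v * e" using that by (intro mult_right_mono) auto
    also have "\<dots> \<le> \<bar>C\<bar> * v * (c * p)" using that by (intro mult_left_mono) auto
    finally show ?thesis by (simp add: mult_ac)
  qed
  have "molecule decay_order \<eta> y (sc k) (\<bar>C\<bar> * c * normalizer k y) (\<psi> k y)"
    if y: "y \<in> new_points X k" for k y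
    unfolding molecule_def
  proof (intro conjI allI impI)
    show "mean_zero (\<psi> k y)" using cancellation[OF y] .
    fix z w
    have s: "0 \<le> d y z / sc k" by (intro divide_nonneg_pos sc_pos d_nonneg)
    show "cmod (\<psi> k y z) \<le> \<bar>C\<bar> * c * normalizer k y * (1 + d y z / sc k) powr (- decay_order)"
      using 1[OF y, of z] main[OF _ _ c(2)[OF s], of "normalizer k y"] by simp
    assume "d z w \<le> sc k"
    then have "cmod (\<psi> k y z - \<psi> k y w) \<le> C * (normalizer k y * (d z w / sc k) powr \<eta>)
             * exp (- \<nu> * (d y z / sc k) powr a)"
      using 2[OF y] by (simp add: mult_ac)
    also have "\<dots> \<le> \<bar>C\<bar> * c * (normalizer k y * (d z w / sc k) powr \<eta>) * (1 + d y z / sc k) powr (- decay_order)"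
      by (rule main[OF _ _ c(2)[OF s]]) auto
    finally show "cmod (\<psi> k y z - \<psi> k y w)
        \<le> \<bar>C\<bar> * c * normalizer k y * (d z w / sc k) powr \<eta> * (1 + d y z / sc k) powr (- decay_order)"
      by (simp add: mult_ac)
  qed
  then show ?thesis using c(1) by (intro exI[of _ "\<bar>C\<bar> * c"]) auto
qed

lemma new_points_separated:
  assumes "y \<in> new_points X k" "y' \<in> new_points X k" "y \<noteq> y'"
  shows "sc (k + 1) \<le> d y y'"
proof -
  have "separated d (sc (k + 1)) (X (k + 1))"
    using reference_points unfolding reference_points_def maximal_separated_def
    by (cases "0 \<le> k + 1") auto
  then show ?thesis using assms by (auto simp: separated_def new_points_def)
qed

text \<open>The separation makes the balls of radius \<open>\<epsilon>\<close> around the points of \<open>F\<close> disjoint, and the summand is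
comparable to a constant on each of them, so that the sum is dominated by an integral over the space. The loss of
\<open>\<omega>\<close> powers comes from comparing the volumes of these balls with \<open>V (sc k) x\<close>.\<close>

lemma counting_ex:
  "\<exists>C\<ge>0. \<forall>k x F. finite F \<longrightarrow> F \<subseteq> new_points X k \<longrightarrow>
     (\<Sum>y\<in>F. (1 + d x y / sc k) powr (- (2 * \<omega> + 1))) \<le> C"
proof -
  obtain C where C: "0 \<le> C" "\<And>y r. 0 < r \<Longrightarrow>
     (\<integral>\<^sup>+z. ennreal ((1 + d y z / r) powr (- (\<omega> + 1))) \<partial>M) \<le> ennreal (C * V r y)"
    using ball_tail_integral_ex by blast
  define c1 where "c1 = (2 * A0) powr (\<omega> + 1)"
  define c2 where "c2 = D * A0 powr \<omega> * (D * (2 * A0 / \<delta>) powr \<omega>)"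
  have c: "0 \<le> c1" "0 \<le> c2" using D_pos by (auto simp: c1_def c2_def)
  have "(\<Sum>y\<in>F. (1 + d x y / sc k) powr (- (2 * \<omega> + 1))) \<le> c2 * c1 * C"
    if F: "finite F" "F \<subseteq> new_points X k" for k x F
  proof -
    define r where "r = sc k"
    \<comment> \<open>the new points are separated at the next finer scale \<open>\<delta> * r\<close>, and the quasi-triangle inequality costs \<open>2 * A0\<close>\<close>
    define \<epsilon> where "\<epsilon> = \<delta> * r / (2 * A0)"
    define u where "u z = 1 + d x z / r" for z
    have r: "0 < r" using sc_pos by (simp add: r_def)
    have u: "1 \<le> u z" for z using r d_nonneg[of x z] by (simp add: u_def)
    have \<epsilon>: "0 < \<epsilon>" using r \<delta>_range A0_pos by (simp add: \<epsilon>_def)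
    have "\<delta> * r \<le> 1 * (2 * A0 * r)"
    proof -
      have "\<delta> * r \<le> 1 * r" using \<delta>_range r by (intro mult_right_mono) auto
      also have "1 * r \<le> (2 * A0) * r" using A0_ge_1 r by (intro mult_right_mono) auto
      finally show ?thesis by simp
    qed
    then have \<epsilon>r: "\<epsilon> \<le> r" using A0_pos by (simp add: \<epsilon>_def field_simps)
    have sk: "sc (k + 1) = \<delta> * r" using \<delta>_range by (simp add: r_def power_int_add)
    have disj: "qball d y \<epsilon> \<inter> qball d y' \<epsilon> = {}" if "y \<in> F" "y' \<in> F" "y \<noteq> y'" for y y'
    proof (rule ccontr)
      assume "qball d y \<epsilon> \<inter> qball d y' \<epsilon> \<noteq> {}"
      then obtain z where z: "d y z < \<epsilon>" "d y' z < \<epsilon>" by (auto simp: qball_def)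
      have "d y y' \<le> A0 * (d y z + d z y')" by (rule d_quasi_triangle)
      also have "\<dots> < A0 * (\<epsilon> + \<epsilon>)" using z A0_pos by (intro mult_strict_left_mono) (auto simp: d_sym[of z y'])
      also have "\<dots> = \<delta> * r" using A0_pos by (simp add: \<epsilon>_def)
      finally show False using new_points_separated[of y k y'] that F(2) sk by auto
    qed
    define w where "w z = u z powr (- (\<omega> + 1))" for z
    have w: "integrable M w" "(LINT z|M. w z) \<le> C * V r x"
      unfolding w_def u_def by (rule nn_integral_le_imp_integrable[OF _ _ _ C(2)[OF r]]; use C(1) in simp)+
    have pt: "(\<Sum>y\<in>F. u y powr (- (\<omega> + 1)) * indicator (qball d y \<epsilon>) z) \<le> c1 * w z" for z
    proof (cases "\<exists>y\<in>F. z \<in> qball d y \<epsilon>")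
      case False
      then have "(\<Sum>y\<in>F. u y powr (- (\<omega> + 1)) * indicator (qball d y \<epsilon>) z) = 0"
        by (intro sum.neutral) auto
      then show ?thesis using c by (simp add: w_def)
    next
      case True
      then obtain y where y: "y \<in> F" "z \<in> qball d y \<epsilon>" by blast
      have "(\<Sum>y'\<in>F. u y' powr (- (\<omega> + 1)) * indicator (qball d y' \<epsilon>) z)
          = (\<Sum>y'\<in>{y}. u y' powr (- (\<omega> + 1)) * indicator (qball d y' \<epsilon>) z)"
        using y F(1) disj by (intro sum.mono_neutral_right) (auto simp: indicator_def)
      also have "\<dots> = u y powr (- (\<omega> + 1))" using y by simp
      also have "\<dots> \<le> (u z / (2 * A0)) powr (- (\<omega> + 1))"
      proof (rule powr_mono2')
        have "d x z \<le> A0 * (d x y + d y z)" by (rule d_quasi_triangle)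
        also have "\<dots> \<le> A0 * (d x y + r)" using y \<epsilon>r A0_pos by (intro mult_left_mono) (auto simp: qball_def)
        finally have "r + d x z \<le> r + A0 * (d x y + r)" by simp
        also have "\<dots> \<le> 2 * (A0 * (d x y + r))"
        proof -
          have "r \<le> A0 * r" "0 \<le> A0 * d x y" using A0_ge_1 r d_nonneg[of x y] by auto
          then show ?thesis by (simp add: algebra_simps)
        qed
        also have "\<dots> = (2 * A0 * u y) * r" using r by (simp add: u_def field_simps)
        also have "r + d x z = u z * r" using r by (simp add: u_def field_simps)
        finally have "u z \<le> 2 * A0 * u y" using r by simp
        then show "u z / (2 * A0) \<le> u y" using A0_pos by (simp add: field_simps)
      qed (use \<omega>_nonneg A0_pos u[of z] in auto)
      also have "\<dots> = c1 * w z"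
        unfolding c1_def w_def powr_divide[of "u z" "2 * A0"] powr_minus[of "2 * A0"]
        by (simp only: divide_inverse inverse_inverse_eq mult.commute)
      finally show ?thesis .
    qed
    have Vy: "V r x * u y powr (- (2 * \<omega> + 1)) \<le> c2 * (u y powr (- (\<omega> + 1)) * V \<epsilon> y)" for y
    proof -
      have "V r x \<le> V (A0 * u y * r) y"
      proof (rule V_mono_ball[OF qball_subset])
        show "A0 * (d x y + r) \<le> A0 * u y * r" using r A0_pos by (simp add: u_def field_simps)
        show "0 < A0 * u y * r" using r A0_pos u[of y] by (intro mult_pos_pos) auto
      qed
      also have "\<dots> \<le> D * (A0 * u y) powr \<omega> * V r y"
        using A0_ge_1 u[of y] mult_mono[of 1 A0 1 "u y"] by (intro V_growth r) auto
      also have "V r y \<le> D * (2 * A0 / \<delta>) powr \<omega> * V \<epsilon> y"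
      proof (rule V_growth_le[OF \<epsilon>])
        show "1 \<le> 2 * A0 / \<delta>" using A0_ge_1 \<delta>_range by (simp add: field_simps)
        show "r \<le> 2 * A0 / \<delta> * \<epsilon>" using A0_pos \<delta>_range by (simp add: \<epsilon>_def)
      qed
      also have "(A0 * u y) powr \<omega> = A0 powr \<omega> * u y powr \<omega>" using A0_pos u[of y] by (simp add: powr_mult)
      finally have "V r x \<le> D * (A0 powr \<omega> * u y powr \<omega>) * (D * (2 * A0 / \<delta>) powr \<omega> * V \<epsilon> y)"
        using D_pos by (simp add: mult_left_mono)
      then have "V r x \<le> c2 * u y powr \<omega> * V \<epsilon> y" by (simp add: c2_def mult_ac)
      then have "V r x * u y powr (- (2 * \<omega> + 1)) \<le> c2 * u y powr \<omega> * V \<epsilon> y * u y powr (- (2 * \<omega> + 1))"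
        by (rule mult_right_mono) simp
      also have "\<dots> = c2 * ((u y powr \<omega> * u y powr (- (2 * \<omega> + 1))) * V \<epsilon> y)" by (simp only: mult_ac)
      also have "u y powr \<omega> * u y powr (- (2 * \<omega> + 1)) = u y powr (- (\<omega> + 1))" by (simp flip: powr_add)
      finally show ?thesis .
    qed
    have ii: "integrable M (\<lambda>z. u y powr (- (\<omega> + 1)) * indicator (qball d y \<epsilon>) z)" for y
      using ball_finite[OF \<epsilon>, of y] by (intro integrable_mult_right integrable_real_indicator) auto
    have "V r x * (\<Sum>y\<in>F. u y powr (- (2 * \<omega> + 1))) \<le> (\<Sum>y\<in>F. c2 * (u y powr (- (\<omega> + 1)) * V \<epsilon> y))"
      unfolding sum_distrib_left by (rule sum_mono[OF Vy])
    also have "\<dots> = c2 * (\<Sum>y\<in>F. (LINT z|M. u y powr (- (\<omega> + 1)) * indicator (qball d y \<epsilon>) z))"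
      by (simp add: sum_distrib_left vol_def space_M)
    also have "\<dots> = c2 * (LINT z|M. (\<Sum>y\<in>F. u y powr (- (\<omega> + 1)) * indicator (qball d y \<epsilon>) z))"
      using ii by (subst Bochner_Integration.integral_sum) auto
    also have "\<dots> \<le> c2 * (LINT z|M. c1 * w z)"
      using ii w(1) pt c by (intro mult_left_mono integral_mono) auto
    also have "\<dots> \<le> c2 * (c1 * (C * V r x))" using w(2) c by (simp add: mult_left_mono)
    finally have "V r x * (\<Sum>y\<in>F. u y powr (- (2 * \<omega> + 1))) \<le> V r x * (c2 * c1 * C)" by (simp add: mult_ac)
    then have "(\<Sum>y\<in>F. u y powr (- (2 * \<omega> + 1))) \<le> c2 * c1 * C" using V_pos[OF r, of x] by simp
    then show ?thesis by (simp add: u_def r_def)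
  qed
  then show ?thesis using c C(1) by (intro exI[of _ "c2 * c1 * C"]) auto
qed

lemma countable_new_points: "countable (new_points X k)"
proof -
  fix x :: 'a
  obtain C where "\<forall>k x F. finite F \<longrightarrow> F \<subseteq> new_points X k \<longrightarrow>
     (\<Sum>y\<in>F. (1 + d x y / sc k) powr (- (2 * \<omega> + 1))) \<le> C"
    using counting_ex by (elim exE conjE) (rule that)
  then have C: "(\<Sum>y\<in>F. (1 + d x y / sc k) powr (- (2 * \<omega> + 1))) \<le> C"
    if "finite F" "F \<subseteq> new_points X k" for F using that by simp
  have u: "0 < 1 + d x y / sc k" for y by (intro add_pos_nonneg divide_nonneg_pos sc_pos d_nonneg) auto
  have "(\<lambda>y. (1 + d x y / sc k) powr (- (2 * \<omega> + 1))) summable_on new_points X k"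
  proof (rule nonneg_bdd_above_summable_on[OF _ bdd_aboveI2])
    fix F assume "F \<in> {F. F \<subseteq> new_points X k \<and> finite F}"
    then show "(\<Sum>y\<in>F. (1 + d x y / sc k) powr (- (2 * \<omega> + 1))) \<le> C" using C[of F] by simp
  qed simp
  then have "countable {y \<in> new_points X k. (1 + d x y / sc k) powr (- (2 * \<omega> + 1)) \<noteq> 0}"
    by (rule summable_countable_real)
  moreover have "{y \<in> new_points X k. (1 + d x y / sc k) powr (- (2 * \<omega> + 1)) \<noteq> 0} = new_points X k"
    using u by (auto simp: less_imp_neq[symmetric])
  ultimately show ?thesis by simp
qed

end

section \<open>Blocks of the wavelet expansion\<close>

lemma infsum_norm_le:
  fixes g :: "'b \<Rightarrow> complex"
  assumes "\<And>F. finite F \<Longrightarrow> F \<subseteq> S \<Longrightarrow> (\<Sum>y\<in>F. cmod (g y)) \<le> B"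
  shows "g summable_on S" "cmod (infsum g S) \<le> B"
proof -
  have s: "(\<lambda>y. norm (g y)) summable_on S"
  proof (rule nonneg_bdd_above_summable_on[OF _ bdd_aboveI2])
    fix F assume "F \<in> {F. F \<subseteq> S \<and> finite F}"
    then show "(\<Sum>y\<in>F. norm (g y)) \<le> B" using assms[of F] by simp
  qed simp
  show "g summable_on S" using s by (rule abs_summable_summable)
  have "cmod (infsum g S) \<le> infsum (\<lambda>y. norm (g y)) S" using s by (rule norm_infsum_bound)
  also have "\<dots> \<le> B" using s assms by (intro infsum_le_finite_sums) auto
  finally show "cmod (infsum g S) \<le> B" .
qed

lemma infsum_diff_complex:
  fixes f g :: "'b \<Rightarrow> complex"
  assumes "f summable_on S" "g summable_on S"
  shows "infsum (\<lambda>y. f y - g y) S = infsum f S - infsum g S"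
  using infsum_add[OF assms(1) summable_on_uminus[THEN iffD2, OF assms(2)]]
  by (simp add: infsum_uminus)

text \<open>An unordered sum over a countable set is the limit along an increasing sequence of finite subsets
exhausting it, which brings it within reach of dominated convergence.\<close>

lemma integral_infsum_dominated:
  fixes F :: "'b \<Rightarrow> 'a \<Rightarrow> complex"
  assumes S: "countable S" and int: "\<And>y. y \<in> S \<Longrightarrow> integrable M (F y)" and w: "integrable M w"
    and dom: "\<And>E z. finite E \<Longrightarrow> E \<subseteq> S \<Longrightarrow> (\<Sum>y\<in>E. cmod (F y z)) \<le> w z"
  shows "integrable M (\<lambda>z. \<Sum>\<^sub>\<infinity>y\<in>S. F y z)"
    and "(LINT z|M. (\<Sum>\<^sub>\<infinity>y\<in>S. F y z)) = (\<Sum>\<^sub>\<infinity>y\<in>S. (LINT z|M. F y z))"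
proof -
  define E where "E m = {y \<in> S. to_nat_on S y < m}" for m :: nat
  have fin: "finite (E m)" for m
    by (rule finite_imageD[of "to_nat_on S"])
       (use inj_on_to_nat_on[OF S] in \<open>auto simp: E_def inj_on_def intro: finite_subset[of _ "{..<m}"]\<close>)
  have sub: "E m \<subseteq> S" for m by (auto simp: E_def)
  have lim: "filterlim E (finite_subsets_at_top S) sequentially"
    unfolding filterlim_finite_subsets_at_top
  proof (intro allI impI)
    fix Y assume Y: "finite Y \<and> Y \<subseteq> S"
    have "Y \<subseteq> E m" if "Suc (Max (to_nat_on S ` Y)) \<le> m" for m
    proof
      fix y assume "y \<in> Y"
      then have "to_nat_on S y \<le> Max (to_nat_on S ` Y)" using Y by (intro Max_ge) auto
      then have "to_nat_on S y < m" using that by linarith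
      then show "y \<in> E m" using \<open>y \<in> Y\<close> Y by (auto simp: E_def)
    qed
    then show "\<forall>\<^sub>F m in sequentially. finite (E m) \<and> Y \<subseteq> E m \<and> E m \<subseteq> S"
      using fin sub by (auto simp: eventually_sequentially)
  qed
  have tend: "(\<lambda>m. \<Sum>y\<in>E m. G y) \<longlonglongrightarrow> infsum G S" if "G summable_on S" for G :: "'b \<Rightarrow> complex"
    using has_sum_infsum[OF that] filterlim_compose[OF _ lim] unfolding has_sum_def by blast
  have sm: "(\<lambda>y. F y z) summable_on S" for z by (rule infsum_norm_le(1)) (rule dom)
  have meas: "(\<lambda>z. \<Sum>y\<in>E m. F y z) \<in> borel_measurable M" for m
    using int sub by (intro borel_measurable_sum) (auto intro: borel_measurable_integrable)
  have meas': "(\<lambda>z. \<Sum>\<^sub>\<infinity>y\<in>S. F y z) \<in> borel_measurable M"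
    by (rule borel_measurable_LIMSEQ_metric[OF meas]) (rule tend[OF sm])
  have bd: "AE z in M. norm (\<Sum>y\<in>E m. F y z) \<le> w z" for m
    using dom[OF fin sub] by (intro AE_I2) (auto intro: order_trans[OF norm_sum])
  have cv: "AE z in M. (\<lambda>m. \<Sum>y\<in>E m. F y z) \<longlonglongrightarrow> (\<Sum>\<^sub>\<infinity>y\<in>S. F y z)"
    by (intro AE_I2 tend sm)
  show "integrable M (\<lambda>z. \<Sum>\<^sub>\<infinity>y\<in>S. F y z)"
    by (rule integrable_dominated_convergence[OF meas' meas w cv bd])
  have "(\<lambda>m. (LINT z|M. (\<Sum>y\<in>E m. F y z))) \<longlonglongrightarrow> (LINT z|M. (\<Sum>\<^sub>\<infinity>y\<in>S. F y z))"
    by (rule integral_dominated_convergence[OF meas' meas w cv bd])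
  moreover have "(LINT z|M. (\<Sum>y\<in>E m. F y z)) = (\<Sum>y\<in>E m. (LINT z|M. F y z))" for m
    using int sub by (intro Bochner_Integration.integral_sum) auto
  moreover have "(\<lambda>m. \<Sum>y\<in>E m. (LINT z|M. F y z)) \<longlonglongrightarrow> (\<Sum>\<^sub>\<infinity>y\<in>S. (LINT z|M. F y z))"
  proof (rule tend[OF infsum_norm_le(1)])
    fix Y assume Y: "finite Y" "Y \<subseteq> S"
    have i: "integrable M (\<lambda>z. cmod (F y z))" if "y \<in> Y" for y using int that Y by auto
    have "(\<Sum>y\<in>Y. cmod (LINT z|M. F y z)) \<le> (\<Sum>y\<in>Y. (LINT z|M. cmod (F y z)))"
      by (intro sum_mono integral_norm_bound)
    also have "\<dots> = (LINT z|M. (\<Sum>y\<in>Y. cmod (F y z)))"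
      using i by (intro Bochner_Integration.integral_sum[symmetric])
    also have "\<dots> \<le> (LINT z|M. w z)"
      using i w dom[OF Y] by (intro integral_mono Bochner_Integration.integrable_sum) auto
    finally show "(\<Sum>y\<in>Y. cmod (LINT z|M. F y z)) \<le> (LINT z|M. w z)" .
  qed
  ultimately show "(LINT z|M. (\<Sum>\<^sub>\<infinity>y\<in>S. F y z)) = (\<Sum>\<^sub>\<infinity>y\<in>S. (LINT z|M. F y z))"
    using LIMSEQ_unique by auto
qed

context homogeneous_type
begin

text \<open>The gain in \<open>k\<close>: at fine scales surplus smoothness becomes a positive power of \<open>r\<close>, at coarse scales
surplus decay becomes a negative power of \<open>r\<close>. The exponent \<open>b\<close> is 0 for size estimates and \<open>\<beta>'\<close> for
increments.\<close>

lemma decay_scale_gain: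
  assumes "0 < r" "0 \<le> b" "b \<le> \<beta>'" "\<beta>' \<le> \<beta>" "0 \<le> \<gamma>'" "\<epsilon> \<le> \<beta> - \<beta>'" "\<epsilon> \<le> \<gamma> - \<gamma>'" "0 \<le> \<epsilon>" "0 \<le> s"
  shows "r powr (\<beta> - b) * decay x0 (\<beta> + \<gamma>) (max 1 r + s) \<le> min r (1 / r) powr \<epsilon> * decay x0 (b + \<gamma>') (1 + s)"
proof (cases "r \<le> 1")
  case True
  then have "r * r \<le> 1" using assms(1) by (simp add: mult_le_one)
  then have m: "min r (1 / r) = r" using assms(1) by (simp add: min_def field_simps)
  have "decay x0 (\<beta> + \<gamma>) (1 + s) \<le> decay x0 (b + \<gamma>') (1 + s)"
    unfolding decay_def using assms by (intro divide_right_mono powr_mono) auto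
  moreover have "r powr (\<beta> - b) \<le> r powr \<epsilon>" using assms True by (intro powr_mono') auto
  ultimately show ?thesis using True by (simp add: m mult_mono)
next
  case False
  then have "1 \<le> r * r" using mult_mono[of 1 r 1 r] by simp
  then have m: "min r (1 / r) = 1 / r" using assms(1) by (simp add: min_def field_simps)
  define T where "T = r + s"
  have T: "r \<le> T" "1 \<le> T" "1 + s \<le> T" using False assms by (auto simp: T_def)
  have "r powr (\<beta> - b) * T powr (- (\<beta> + \<gamma>)) \<le> T powr (\<beta> - b) * T powr (- (\<beta> + \<gamma>))"
    using T False assms by (intro mult_right_mono powr_mono2) auto
  also have "\<dots> = T powr (- (\<gamma> - \<gamma>')) * T powr (- (b + \<gamma>'))"
    unfolding powr_add[symmetric] by (rule arg_cong[where f = "(powr) T"]) simp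
  also have "\<dots> \<le> r powr (- \<epsilon>) * T powr (- (b + \<gamma>'))"
  proof (rule mult_right_mono)
    have "T powr (- (\<gamma> - \<gamma>')) \<le> T powr (- \<epsilon>)" using T assms by (intro powr_mono) auto
    also have "\<dots> \<le> r powr (- \<epsilon>)" using T False assms by (intro powr_mono2') auto
    finally show "T powr (- (\<gamma> - \<gamma>')) \<le> r powr (- \<epsilon>)" .
  qed simp
  also have "r powr (- \<epsilon>) = (1 / r) powr \<epsilon>" using assms(1) by (simp add: powr_divide powr_minus_divide)
  finally have "r powr (\<beta> - b) * T powr (- (\<beta> + \<gamma>)) / V T x0 \<le> (1 / r) powr \<epsilon> * T powr (- (b + \<gamma>')) / V T x0"
    by (rule divide_right_mono) simp
  then have "r powr (\<beta> - b) * decay x0 (\<beta> + \<gamma>) T \<le> (1 / r) powr \<epsilon> * decay x0 (b + \<gamma>') T"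
    by (simp add: decay_def)
  also have "\<dots> \<le> (1 / r) powr \<epsilon> * decay x0 (b + \<gamma>') (1 + s)"
    using assms T by (intro mult_left_mono decay_antimono) auto
  finally show ?thesis using False by (simp add: m T_def max_def)
qed

end

context wavelet_growth
begin

lemma weighted_counting_ex:
  assumes \<kappa>: "0 \<le> \<kappa>" "\<kappa> \<le> 2"
  shows "\<exists>C\<ge>0. \<forall>x0 k x F. finite F \<longrightarrow> F \<subseteq> new_points X k \<longrightarrow>
     (\<Sum>y\<in>F. (1 + d y x / sc k) powr (- decay_order) * decay x0 \<kappa> (max 1 (sc k) + d y x0))
      \<le> C * decay x0 \<kappa> (max 1 (sc k) + d x x0)"
proof -
  obtain C where C0: "0 \<le> C" and C': "\<forall>k x F. finite F \<longrightarrow> F \<subseteq> new_points X k \<longrightarrow>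
     (\<Sum>y\<in>F. (1 + d x y / sc k) powr (- (2 * \<omega> + 1))) \<le> C"
    using counting_ex by (elim exE conjE) (rule that)
  define c where "c = D * A0 powr (\<kappa> + \<omega>)"
  have c: "0 \<le> c" using D_pos by (simp add: c_def)
  have "(\<Sum>y\<in>F. (1 + d y x / sc k) powr (- decay_order) * decay x0 \<kappa> (max 1 (sc k) + d y x0))
      \<le> c * C * decay x0 \<kappa> (max 1 (sc k) + d x x0)"
    if F: "finite F" "F \<subseteq> new_points X k" for x0 k x F
  proof -
    define r where "r = sc k"
    define m where "m = max 1 r"
    have r: "0 < r" using sc_pos by (simp add: r_def)
    have m: "1 \<le> m" "r \<le> m" by (auto simp: m_def)
    have "(1 + d y x / r) powr (- decay_order) * decay x0 \<kappa> (m + d y x0)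
        \<le> c * decay x0 \<kappa> (m + d x x0) * (1 + d x y / r) powr (- (2 * \<omega> + 1))" for y
    proof -
      define u where "u = 1 + d x y / r"
      have u: "1 \<le> u" using r d_nonneg[of x y] by (simp add: u_def)
      have T: "m + d x x0 \<le> (A0 * u) * (m + d y x0)"
      proof -
        have "d x y = r * (u - 1)" using r by (simp add: u_def)
        also have "\<dots> \<le> m * (u - 1)" using m u by (intro mult_right_mono) auto
        finally have "d x y + d y x0 \<le> m * (u - 1) + d y x0" by simp
        then have "A0 * (d x y + d y x0) \<le> A0 * (m * (u - 1) + d y x0)" using A0_pos by (intro mult_left_mono) auto
        then have 1: "d x x0 \<le> A0 * (m * (u - 1) + d y x0)" using d_quasi_triangle[of x x0 y] by linarith
        have "m \<le> A0 * m" using A0_ge_1 m by simp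
        moreover have "A0 * d y x0 \<le> A0 * (u * d y x0)"
          using u d_nonneg[of y x0] A0_pos mult_right_mono[of 1 u "d y x0"] by (intro mult_left_mono) auto
        ultimately show ?thesis using 1 by (simp add: algebra_simps)
      qed
      have "decay x0 \<kappa> (m + d y x0) \<le> D * (A0 * u) powr (\<kappa> + \<omega>) * decay x0 \<kappa> (m + d x x0)"
      proof (rule decay_compare[OF _ _ _ T])
        show "1 \<le> A0 * u" using A0_ge_1 u mult_mono[of 1 A0 1 u] by simp
      qed (use m \<kappa> d_nonneg[of x x0] d_nonneg[of y x0] in auto)
      also have "(A0 * u) powr (\<kappa> + \<omega>) = A0 powr (\<kappa> + \<omega>) * u powr (\<kappa> + \<omega>)" using A0_pos u by (simp add: powr_mult)
      finally have "decay x0 \<kappa> (m + d y x0) \<le> c * decay x0 \<kappa> (m + d x x0) * u powr (\<kappa> + \<omega>)"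
        by (simp add: c_def mult_ac)
      then have "u powr (- decay_order) * decay x0 \<kappa> (m + d y x0)
          \<le> u powr (- decay_order) * (c * decay x0 \<kappa> (m + d x x0) * u powr (\<kappa> + \<omega>))"
        by (rule mult_left_mono) simp
      also have "\<dots> = c * decay x0 \<kappa> (m + d x x0) * (u powr (- decay_order) * u powr (\<kappa> + \<omega>))" by (simp only: mult_ac)
      also have "u powr (- decay_order) * u powr (\<kappa> + \<omega>) = u powr (\<kappa> + \<omega> - decay_order)" by (simp flip: powr_add)
      also have "c * decay x0 \<kappa> (m + d x x0) * \<dots> \<le> c * decay x0 \<kappa> (m + d x x0) * u powr (- (2 * \<omega> + 1))"
        using u c \<kappa> by (intro mult_left_mono powr_mono) auto
      finally show ?thesis by (simp add: u_def d_sym[of y x])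
    qed
    then have "(\<Sum>y\<in>F. (1 + d y x / r) powr (- decay_order) * decay x0 \<kappa> (m + d y x0))
        \<le> (\<Sum>y\<in>F. c * decay x0 \<kappa> (m + d x x0) * (1 + d x y / r) powr (- (2 * \<omega> + 1)))" by (rule sum_mono)
    also have "\<dots> = c * decay x0 \<kappa> (m + d x x0) * (\<Sum>y\<in>F. (1 + d x y / r) powr (- (2 * \<omega> + 1)))"
      by (rule sum_distrib_left[symmetric])
    also have "\<dots> \<le> c * decay x0 \<kappa> (m + d x x0) * C"
      using c C' F unfolding r_def by (intro mult_left_mono) auto
    finally show ?thesis by (simp add: r_def m_def mult_ac)
  qed
  then show ?thesis using c C0 by (intro exI[of _ "c * C"]) auto
qed

text \<open>The weights \<open>c\<close> stand for the values \<open>cmod (\<psi> k y x)\<close> as well as for increments of the wavelets, which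
satisfy the same bound up to the factor \<open>p\<close>. The three powers of \<open>V (sc k) y\<close> cancel.\<close>

lemma expansion_bound_ex:
  assumes \<beta>: "0 < \<beta>" "\<beta> \<le> \<eta>" and \<gamma>: "0 < \<gamma>" "\<gamma> < \<eta>"
  shows "\<exists>C\<ge>0. \<forall>f x0 A k c p F x. smooth_bound x0 \<beta> \<gamma> f A \<longrightarrow> mean_zero f \<longrightarrow>
     finite F \<longrightarrow> F \<subseteq> new_points X k \<longrightarrow> 0 \<le> p \<longrightarrow>
     (\<forall>y\<in>F. c y \<le> p * normalizer k y * (1 + d y x / sc k) powr (- decay_order)) \<longrightarrow>
     (\<Sum>y\<in>F. cmod (coef f k y) * c y) \<le> C * A * p * sc k powr \<beta> * decay x0 (\<beta> + \<gamma>) (max 1 (sc k) + d x x0)"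
proof -
  have \<beta>\<gamma>: "\<beta> + \<gamma> \<le> 2" using \<beta> \<gamma> \<eta>_range by linarith
  obtain B where B: "0 \<le> B" "\<forall>k. \<forall>y\<in>new_points X k. molecule decay_order \<eta> y (sc k) (B * normalizer k y) (\<psi> k y)"
    using wavelet_molecule_ex by (elim exE conjE) (rule that)
  obtain C1 where C1: "0 \<le> C1" "\<forall>r>0. coefficient_bound \<eta> \<beta> \<gamma> decay_order r C1"
    using coefficient_bound_ex[OF \<beta>(1) \<gamma> \<eta>_range(2), of decay_order] \<beta>\<gamma> \<omega>_nonneg by auto
  obtain C2 where C2: "0 \<le> C2" "\<forall>x0 k x F. finite F \<longrightarrow> F \<subseteq> new_points X k \<longrightarrow>
     (\<Sum>y\<in>F. (1 + d y x / sc k) powr (- decay_order) * decay x0 (\<beta> + \<gamma>) (max 1 (sc k) + d y x0))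
      \<le> C2 * decay x0 (\<beta> + \<gamma>) (max 1 (sc k) + d x x0)"
    using weighted_counting_ex[of "\<beta> + \<gamma>"] \<beta> \<gamma> \<beta>\<gamma> by auto
  have "(\<Sum>y\<in>F. cmod (coef f k y) * c y) \<le> C1 * B * C2 * A * p * sc k powr \<beta> * decay x0 (\<beta> + \<gamma>) (max 1 (sc k) + d x x0)"
    if f: "smooth_bound x0 \<beta> \<gamma> f A" and f0: "mean_zero f" and F: "finite F" "F \<subseteq> new_points X k"
      and p: "0 \<le> p" and c: "\<forall>y\<in>F. c y \<le> p * normalizer k y * (1 + d y x / sc k) powr (- decay_order)"
    for f x0 A k c p F x
  proof -
    have A: "0 \<le> A" using f by (rule smooth_bound_nonneg)
    define q where "q = C1 * B * A * p * sc k powr \<beta>"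
    have q: "0 \<le> q" using C1 B A p by (simp add: q_def)
    have "cmod (coef f k y) * c y
        \<le> q * ((1 + d y x / sc k) powr (- decay_order) * decay x0 (\<beta> + \<gamma>) (max 1 (sc k) + d y x0))" if y: "y \<in> F" for y
    proof -
      have v: "normalizer k y * V (sc k) y * normalizer k y = 1"
      proof -
        have p: "0 < V (sc k) y" by (rule V_pos[OF sc_pos])
        have "normalizer k y * normalizer k y = V (sc k) y powr (- 1)"
          by (simp flip: powr_add)
        also have "\<dots> = 1 / V (sc k) y" using p by (simp add: powr_minus_divide)
        finally have "V (sc k) y * (normalizer k y * normalizer k y) = 1" using p by simp
        then show ?thesis by (simp only: mult_ac)
      qed
      have 1: "cmod (coef f k y) \<le> C1 * A * (B * normalizer k y) * V (sc k) y * sc k powr \<beta>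
          * decay x0 (\<beta> + \<gamma>) (max 1 (sc k) + d y x0)"
        using C1(2) sc_pos f f0 B(2) y F(2) unfolding coefficient_bound_def by blast
      have "cmod (coef f k y) * c y
         \<le> cmod (coef f k y) * (p * normalizer k y * (1 + d y x / sc k) powr (- decay_order))"
        using c y by (intro mult_left_mono) auto
      also have "\<dots> \<le> (C1 * A * (B * normalizer k y) * V (sc k) y * sc k powr \<beta>
          * decay x0 (\<beta> + \<gamma>) (max 1 (sc k) + d y x0)) * (p * normalizer k y * (1 + d y x / sc k) powr (- decay_order))"
        using 1 p by (intro mult_right_mono) auto
      also have "\<dots> = (normalizer k y * V (sc k) y * normalizer k y) *
          (q * ((1 + d y x / sc k) powr (- decay_order) * decay x0 (\<beta> + \<gamma>) (max 1 (sc k) + d y x0)))"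
        unfolding q_def by (simp only: mult_ac)
      finally show ?thesis unfolding v by simp
    qed
    then have "(\<Sum>y\<in>F. cmod (coef f k y) * c y)
       \<le> (\<Sum>y\<in>F. q * ((1 + d y x / sc k) powr (- decay_order) * decay x0 (\<beta> + \<gamma>) (max 1 (sc k) + d y x0)))" by (rule sum_mono)
    also have "\<dots> = q * (\<Sum>y\<in>F. (1 + d y x / sc k) powr (- decay_order) * decay x0 (\<beta> + \<gamma>) (max 1 (sc k) + d y x0))"
      by (rule sum_distrib_left[symmetric])
    also have "\<dots> \<le> q * (C2 * decay x0 (\<beta> + \<gamma>) (max 1 (sc k) + d x x0))"
      using q C2(2) F by (intro mult_left_mono) auto
    finally show ?thesis by (simp add: q_def mult_ac)
  qed
  then show ?thesis using C1(1) B(1) C2(1) by (intro exI[of _ "C1 * B * C2"]) auto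
qed

definition block :: "int \<Rightarrow> ('a \<Rightarrow> complex) \<Rightarrow> 'a \<Rightarrow> complex" where
  "block k f x = (\<Sum>\<^sub>\<infinity>y\<in>new_points X k. coef f k y * \<psi> k y x)"

lemma block_bound_ex:
  assumes \<beta>: "0 < \<beta>" "\<beta> \<le> \<eta>" and \<gamma>: "0 < \<gamma>" "\<gamma> < \<eta>"
  shows "\<exists>C\<ge>0. \<forall>f x0 A k x. smooth_bound x0 \<beta> \<gamma> f A \<longrightarrow> mean_zero f \<longrightarrow>
     (\<forall>F. finite F \<longrightarrow> F \<subseteq> new_points X k \<longrightarrow> (\<Sum>y\<in>F. cmod (coef f k y * \<psi> k y x))
        \<le> C * A * sc k powr \<beta> * decay x0 (\<beta> + \<gamma>) (max 1 (sc k) + d x x0)) \<and>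
     (\<forall>x'. d x x' \<le> sc k \<longrightarrow> cmod (block k f x - block k f x')
        \<le> C * A * (d x x' / sc k) powr \<eta> * sc k powr \<beta> * decay x0 (\<beta> + \<gamma>) (max 1 (sc k) + d x x0))"
proof -
  obtain B where B: "0 \<le> B" "\<forall>k. \<forall>y\<in>new_points X k. molecule decay_order \<eta> y (sc k) (B * normalizer k y) (\<psi> k y)"
    using wavelet_molecule_ex by (elim exE conjE) (rule that)
  obtain C where C: "0 \<le> C" "\<forall>f x0 A k c p F x. smooth_bound x0 \<beta> \<gamma> f A \<longrightarrow> mean_zero f \<longrightarrow>
     finite F \<longrightarrow> F \<subseteq> new_points X k \<longrightarrow> 0 \<le> p \<longrightarrow>
     (\<forall>y\<in>F. c y \<le> p * normalizer k y * (1 + d y x / sc k) powr (- decay_order)) \<longrightarrow>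
     (\<Sum>y\<in>F. cmod (coef f k y) * c y) \<le> C * A * p * sc k powr \<beta> * decay x0 (\<beta> + \<gamma>) (max 1 (sc k) + d x x0)"
    using expansion_bound_ex[OF \<beta> \<gamma>] by (elim exE conjE) (rule that)
  note C2 = C(2)[rule_format]
  have size: "(\<Sum>y\<in>F. cmod (coef f k y * \<psi> k y x)) \<le> C * B * A * sc k powr \<beta> * decay x0 (\<beta> + \<gamma>) (max 1 (sc k) + d x x0)"
    if f: "smooth_bound x0 \<beta> \<gamma> f A" "mean_zero f" and F: "finite F" "F \<subseteq> new_points X k" for f x0 A k x F
  proof -
    have "cmod (\<psi> k y x) \<le> B * normalizer k y * (1 + d y x / sc k) powr (- decay_order)" if "y \<in> F" for y
      using B(2) that F(2) unfolding molecule_def by blast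
    from C2[OF f F B(1) this] show ?thesis by (simp add: norm_mult mult_ac)
  qed
  have diff: "cmod (block k f x - block k f x')
        \<le> C * B * A * (d x x' / sc k) powr \<eta> * sc k powr \<beta> * decay x0 (\<beta> + \<gamma>) (max 1 (sc k) + d x x0)"
    if f: "smooth_bound x0 \<beta> \<gamma> f A" "mean_zero f" and xx: "d x x' \<le> sc k" for f x0 A k x x'
  proof -
    have s: "(\<lambda>y. coef f k y * \<psi> k y x) summable_on new_points X k" for x
      by (rule infsum_norm_le(1)) (rule size[OF f])
    have "block k f x - block k f x' = (\<Sum>\<^sub>\<infinity>y\<in>new_points X k. coef f k y * (\<psi> k y x - \<psi> k y x'))"
      unfolding block_def right_diff_distrib using s s by (rule infsum_diff_complex[symmetric])
    also have "cmod \<dots> \<le> C * B * A * (d x x' / sc k) powr \<eta> * sc k powr \<beta> * decay x0 (\<beta> + \<gamma>) (max 1 (sc k) + d x x0)"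
    proof (rule infsum_norm_le(2))
      fix F assume F: "finite F" "F \<subseteq> new_points X k"
      have "cmod (\<psi> k y x - \<psi> k y x') \<le> B * (d x x' / sc k) powr \<eta> * normalizer k y * (1 + d y x / sc k) powr (- decay_order)"
        if "y \<in> F" for y
      proof -
        have "cmod (\<psi> k y x - \<psi> k y x') \<le> B * normalizer k y * (d x x' / sc k) powr \<eta> * (1 + d y x / sc k) powr (- decay_order)"
          using B(2) that F(2) xx unfolding molecule_def by blast
        then show ?thesis by (simp only: mult_ac)
      qed
      from C2[OF f F _ this] B(1)
      show "(\<Sum>y\<in>F. cmod (coef f k y * (\<psi> k y x - \<psi> k y x')))
          \<le> C * B * A * (d x x' / sc k) powr \<eta> * sc k powr \<beta> * decay x0 (\<beta> + \<gamma>) (max 1 (sc k) + d x x0)"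
        by (simp add: norm_mult mult_ac)
    qed
    finally show ?thesis .
  qed
  show ?thesis using size diff C(1) B(1) by (intro exI[of _ "C * B"]) auto
qed

end

section \<open>Geometric series, square-integrable functions and limits of smooth functions\<close>

lemma two_sided_geometric_bounds:
  fixes a :: "int \<Rightarrow> complex" and B q :: real
  assumes a: "\<And>k. cmod (a k) \<le> B * q ^ nat \<bar>k\<bar>" and q: "0 < q" "q < 1"
  defines "S \<equiv> \<lambda>L::nat. \<Sum>k = - int L..int L. a k"
  shows "convergent S"
    and "cmod (S L) \<le> 2 * B / (1 - q)"
    and "S \<longlonglongrightarrow> s \<Longrightarrow> cmod (S L - s) \<le> 2 * B * q ^ Suc L / (1 - q)"
proof -
  define H where "H n = (if n = 0 then a 0 else a (int n) + a (- int n))" for n :: nat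
  have B: "0 \<le> B" using a[of 0] norm_ge_zero[of "a 0"] by (simp del: norm_ge_zero)
  have SH: "S L = (\<Sum>n<Suc L. H n)" for L
  proof (induction L)
    case 0 then show ?case by (simp add: S_def H_def)
  next
    case (Suc L)
    have "{- int (Suc L)..int (Suc L)} = insert (int (Suc L)) (insert (- int (Suc L)) {- int L..int L})" by auto
    then have "S (Suc L) = a (int (Suc L)) + (a (- int (Suc L)) + S L)" by (simp add: S_def)
    then show ?case using Suc by (simp add: H_def)
  qed
  have Hb: "cmod (H n) \<le> 2 * B * q ^ n" for n
  proof (cases "n = 0")
    case True then show ?thesis using a[of 0] B by (simp add: H_def)
  next
    case False
    then show ?thesis using norm_triangle_ineq[of "a (int n)" "a (- int n)"] a[of "int n"] a[of "- int n"]
      by (simp add: H_def)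
  qed
  have sg: "summable (\<lambda>n. 2 * B * q ^ n)" using q by (intro summable_mult summable_geometric) auto
  have sgn: "(\<Sum>n. 2 * B * q ^ n) = 2 * B / (1 - q)" using q by (simp add: suminf_mult summable_geometric suminf_geometric)
  have sn: "summable (\<lambda>n. cmod (H n))" by (rule summable_comparison_test'[OF sg, of 0]) (use Hb in auto)
  have sH: "summable H" using sn by (rule summable_norm_cancel)
  have lim: "S \<longlonglongrightarrow> suminf H"
  proof -
    have "S = (\<lambda>L. \<Sum>n<Suc L. H n)" by (rule ext) (rule SH)
    then show ?thesis using LIMSEQ_Suc[OF summable_LIMSEQ[OF sH]] by (simp only:)
  qed
  then show "convergent S" by (rule convergentI)
  show "cmod (S L) \<le> 2 * B / (1 - q)"
  proof -
    have "cmod (S L) \<le> (\<Sum>n<Suc L. 2 * B * q ^ n)" unfolding SH by (rule order_trans[OF norm_sum sum_mono[OF Hb]])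
    also have "\<dots> \<le> (\<Sum>n. 2 * B * q ^ n)" using sg B q by (intro sum_le_suminf) auto
    finally show ?thesis by (simp add: sgn)
  qed
  assume "S \<longlonglongrightarrow> s"
  then have s: "s = suminf H" using lim LIMSEQ_unique by blast
  have "s - S L = (\<Sum>n. H (n + Suc L))"
    using suminf_minus_initial_segment[OF sH, of "Suc L"] by (simp add: s SH)
  also have "cmod \<dots> \<le> (\<Sum>n. cmod (H (n + Suc L)))"
    by (rule summable_norm) (use sn in \<open>subst summable_iff_shift\<close>)
  also have "\<dots> \<le> (\<Sum>n. (2 * B * q ^ n) * q ^ Suc L)"
  proof (rule suminf_le)
    show "cmod (H (n + Suc L)) \<le> 2 * B * q ^ n * q ^ Suc L" for n
      using Hb[of "n + Suc L"] by (simp add: power_add mult_ac)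
    show "summable (\<lambda>n. cmod (H (n + Suc L)))" using sn by (subst summable_iff_shift)
    show "summable (\<lambda>n. 2 * B * q ^ n * q ^ Suc L)" by (rule summable_mult2[OF sg])
  qed
  also have "\<dots> = 2 * B / (1 - q) * q ^ Suc L" using suminf_mult2[OF sg, of "q ^ Suc L"] sgn by simp
  finally show "cmod (S L - s) \<le> 2 * B * q ^ Suc L / (1 - q)" by (simp add: norm_minus_commute)
qed

lemma square_integrable_mult_cnj:
  assumes "square_integrable M f" "square_integrable M g"
  shows "integrable M (\<lambda>x. f x * cnj (g x))"
proof (rule Bochner_Integration.integrable_bound)
  show "integrable M (\<lambda>x. (cmod (f x))\<^sup>2 + (cmod (g x))\<^sup>2)"
    using assms by (auto simp: square_integrable_def)
  have "cmod (f x * cnj (g x)) \<le> (cmod (f x))\<^sup>2 + (cmod (g x))\<^sup>2" for x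
  proof -
    have "2 * (cmod (f x) * cmod (g x)) \<le> (cmod (f x))\<^sup>2 + (cmod (g x))\<^sup>2"
      using sum_squares_bound[of "cmod (f x)" "cmod (g x)"] by (simp add: mult.assoc)
    moreover have "0 \<le> cmod (f x) * cmod (g x)" by simp
    ultimately show ?thesis unfolding norm_mult complex_mod_cnj by linarith
  qed
  then show "AE x in M. cmod (f x * cnj (g x)) \<le> norm ((cmod (f x))\<^sup>2 + (cmod (g x))\<^sup>2)" by simp
qed (use assms in \<open>auto simp: square_integrable_def\<close>)

lemma square_integrable_add:
  assumes "square_integrable M f" "square_integrable M g"
  shows "square_integrable M (\<lambda>x. f x + g x)"
  unfolding square_integrable_def
proof
  show m: "(\<lambda>x. f x + g x) \<in> borel_measurable M" using assms by (auto simp: square_integrable_def)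
  show "integrable M (\<lambda>x. (cmod (f x + g x))\<^sup>2)"
  proof (rule Bochner_Integration.integrable_bound)
    show "integrable M (\<lambda>x. 2 * (cmod (f x))\<^sup>2 + 2 * (cmod (g x))\<^sup>2)"
      using assms by (auto simp: square_integrable_def)
    have "(cmod (f x + g x))\<^sup>2 \<le> 2 * (cmod (f x))\<^sup>2 + 2 * (cmod (g x))\<^sup>2" for x
    proof -
      have "(cmod (f x + g x))\<^sup>2 \<le> (cmod (f x) + cmod (g x))\<^sup>2" by (intro power_mono norm_triangle_ineq) auto
      also have "\<dots> \<le> 2 * (cmod (f x))\<^sup>2 + 2 * (cmod (g x))\<^sup>2"
        using sum_squares_bound[of "cmod (f x)" "cmod (g x)"] by (simp add: power2_sum)
      finally show ?thesis .
    qed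
    then show "AE x in M. norm ((cmod (f x + g x))\<^sup>2) \<le> norm (2 * (cmod (f x))\<^sup>2 + 2 * (cmod (g x))\<^sup>2)" by simp
  qed (use m in measurable)
qed

lemma square_integrable_cmult:
  assumes "square_integrable M f" shows "square_integrable M (\<lambda>x. c * f x)"
  using assms by (auto simp: square_integrable_def norm_mult power_mult_distrib)

lemma square_integrable_sum:
  assumes "finite F" "\<And>i. i \<in> F \<Longrightarrow> square_integrable M (f i)"
  shows "square_integrable M (\<lambda>x. \<Sum>i\<in>F. f i x)"
  using assms
proof (induction F rule: finite_induct)
  case empty then show ?case by (simp add: square_integrable_def)
next
  case (insert i F)
  then have "square_integrable M (\<lambda>x. f i x + (\<Sum>i\<in>F. f i x))" by (intro square_integrable_add) auto
  then show ?case using insert by simp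
qed

text \<open>Subtracting from \<open>g\<close> a combination of basis elements, all orthogonal to \<open>g\<close>, cannot decrease its norm;
density makes that norm arbitrarily small.\<close>

lemma orthogonal_to_basis_imp_AE_zero:
  assumes basis: "orthonormal_basis M I e" and g: "square_integrable M g"
    and orth: "\<And>i. i \<in> I \<Longrightarrow> l2_inner M g (e i) = 0"
  shows "AE x in M. g x = 0"
proof -
  have gi: "integrable M (\<lambda>x. (cmod (g x))\<^sup>2)" using g by (simp add: square_integrable_def)
  have le: "(LINT x|M. (cmod (g x))\<^sup>2) < \<epsilon>" if "0 < \<epsilon>" for \<epsilon>
  proof -
    have "\<exists>F c. finite F \<and> F \<subseteq> I \<and> (LINT x|M. (cmod (g x - (\<Sum>i\<in>F. c i * e i x)))\<^sup>2) < \<epsilon>"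
      using basis g that unfolding orthonormal_basis_def by simp
    then obtain F c where F: "finite F" "F \<subseteq> I" and lt: "(LINT x|M. (cmod (g x - (\<Sum>i\<in>F. c i * e i x)))\<^sup>2) < \<epsilon>"
      by (elim exE conjE) (rule that)
    define s where "s x = (\<Sum>i\<in>F. c i * e i x)" for x
    have e2: "square_integrable M (e i)" if "i \<in> F" for i using basis F that unfolding orthonormal_basis_def by blast
    have s2: "square_integrable M s" unfolding s_def
      by (intro square_integrable_sum square_integrable_cmult F e2)
    have gs: "square_integrable M (\<lambda>x. g x - s x)"
      using square_integrable_add[OF g square_integrable_cmult[OF s2, of "-1"]] by simp
    have int: "integrable M (\<lambda>x. g x * cnj (e i x))" if "i \<in> F" for i
      using square_integrable_mult_cnj[OF g e2[OF that]] .
    have "(LINT x|M. g x * cnj (s x)) = (LINT x|M. (\<Sum>i\<in>F. cnj (c i) * (g x * cnj (e i x))))"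
      by (simp add: s_def sum_distrib_left mult_ac)
    also have "\<dots> = (\<Sum>i\<in>F. (LINT x|M. cnj (c i) * (g x * cnj (e i x))))"
      using int by (intro Bochner_Integration.integral_sum) auto
    also have "\<dots> = (\<Sum>i\<in>F. cnj (c i) * l2_inner M g (e i))" by (simp add: l2_inner_def)
    also have "\<dots> = 0" using orth F by (intro sum.neutral) auto
    finally have z: "(LINT x|M. g x * cnj (s x)) = 0" .
    have i1: "integrable M (\<lambda>x. g x * cnj (s x))" by (rule square_integrable_mult_cnj[OF g s2])
    define p where "p x = g x * cnj (s x)" for x
    have p: "integrable M p" "(LINT x|M. p x) = 0" using i1 z by (simp_all add: p_def[abs_def])
    have "(LINT x|M. (cmod (g x))\<^sup>2) = (LINT x|M. (cmod (g x))\<^sup>2) - 2 * Re (LINT x|M. p x)" by (simp add: p)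
    also have "\<dots> = (LINT x|M. (cmod (g x))\<^sup>2 - 2 * Re (p x))"
      using gi p(1) by (subst Bochner_Integration.integral_diff) auto
    also have "\<dots> \<le> (LINT x|M. (cmod (g x - s x))\<^sup>2)"
    proof (rule integral_mono)
      show "integrable M (\<lambda>x. (cmod (g x))\<^sup>2 - 2 * Re (p x))" using gi p(1) by auto
      show "integrable M (\<lambda>x. (cmod (g x - s x))\<^sup>2)" using gs by (simp add: square_integrable_def)
      have "(cmod (v - w))\<^sup>2 = (cmod v)\<^sup>2 - 2 * Re (v * cnj w) + (cmod w)\<^sup>2" for v w :: complex
        unfolding cmod_power2 by (simp add: power2_eq_square algebra_simps)
      then show "(cmod (g x))\<^sup>2 - 2 * Re (p x) \<le> (cmod (g x - s x))\<^sup>2" for x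
        unfolding p_def by simp
    qed
    also have "\<dots> < \<epsilon>" using lt by (simp add: s_def)
    finally show ?thesis .
  qed
  have "(LINT x|M. (cmod (g x))\<^sup>2) \<le> 0" using le[of "LINT x|M. (cmod (g x))\<^sup>2"] by linarith
  moreover have "0 \<le> (LINT x|M. (cmod (g x))\<^sup>2)" by (rule integral_nonneg_AE) auto
  ultimately have "(LINT x|M. (cmod (g x))\<^sup>2) = 0" by simp
  then have "AE x in M. (cmod (g x))\<^sup>2 = 0" using gi by (subst (asm) integral_nonneg_eq_0_iff_AE) auto
  then show ?thesis by simp
qed

context homogeneous_type
begin

lemma smooth_boundI:
  assumes "\<And>x. cmod (f x) \<le> C * decay x0 \<gamma> (1 + d x x0)"
    "\<And>x y. d x y < (1 + d x x0) / (2 * A0) \<Longrightarrow>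
        cmod (f x - f y) \<le> C * d x y powr \<beta> * decay x0 (\<beta> + \<gamma>) (1 + d x x0)"
  shows "smooth_bound x0 \<beta> \<gamma> f C"
  using assms by (simp add: smooth_bound_def)

lemma smooth_bound_size: "smooth_bound x0 \<beta> \<gamma> f C \<Longrightarrow> cmod (f x) \<le> C * decay x0 \<gamma> (1 + d x x0)"
  by (simp add: smooth_bound_def)

lemma smooth_bound_diff_le: "smooth_bound x0 \<beta> \<gamma> f C \<Longrightarrow> d x y < (1 + d x x0) / (2 * A0) \<Longrightarrow>
    cmod (f x - f y) \<le> C * d x y powr \<beta> * decay x0 (\<beta> + \<gamma>) (1 + d x x0)"
  by (simp add: smooth_bound_def)

lemma smooth_bound_mono:
  assumes "smooth_bound x0 \<beta> \<gamma> f C" "C \<le> C'"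
  shows "smooth_bound x0 \<beta> \<gamma> f C'"
proof (rule smooth_boundI)
  fix x y
  show "cmod (f x) \<le> C' * decay x0 \<gamma> (1 + d x x0)"
    using smooth_bound_size[OF assms(1), of x] mult_right_mono[OF assms(2), of "decay x0 \<gamma> (1 + d x x0)"] by simp
  assume "d x y < (1 + d x x0) / (2 * A0)"
  from smooth_bound_diff_le[OF assms(1) this]
    mult_right_mono[OF assms(2), of "d x y powr \<beta> * decay x0 (\<beta> + \<gamma>) (1 + d x x0)"]
  show "cmod (f x - f y) \<le> C' * d x y powr \<beta> * decay x0 (\<beta> + \<gamma>) (1 + d x x0)" by (simp add: mult.assoc)
qed

lemma smooth_bound_add:
  assumes "smooth_bound x0 \<beta> \<gamma> f A" "smooth_bound x0 \<beta> \<gamma> g B"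
  shows "smooth_bound x0 \<beta> \<gamma> (\<lambda>x. f x + g x) (A + B)"
proof (rule smooth_boundI)
  fix x y
  show "cmod (f x + g x) \<le> (A + B) * decay x0 \<gamma> (1 + d x x0)"
    using norm_triangle_ineq[of "f x" "g x"] smooth_bound_size[OF assms(1), of x] smooth_bound_size[OF assms(2), of x]
    by (simp add: algebra_simps)
  assume *: "d x y < (1 + d x x0) / (2 * A0)"
  have eq: "f x + g x - (f y + g y) = (f x - f y) + (g x - g y)" by simp
  show "cmod (f x + g x - (f y + g y)) \<le> (A + B) * d x y powr \<beta> * decay x0 (\<beta> + \<gamma>) (1 + d x x0)"
    unfolding eq using norm_triangle_ineq[of "f x - f y" "g x - g y"] smooth_bound_diff_le[OF assms(1) *] smooth_bound_diff_le[OF assms(2) *]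
    by (simp add: distrib_right)
qed

lemma smooth_bound_uminus:
  assumes "smooth_bound x0 \<beta> \<gamma> f A" shows "smooth_bound x0 \<beta> \<gamma> (\<lambda>x. - f x) A"
  using assms unfolding smooth_bound_def by (simp add: norm_minus_commute)

lemma smooth_bound_diff:
  assumes "smooth_bound x0 \<beta> \<gamma> f A" "smooth_bound x0 \<beta> \<gamma> g B"
  shows "smooth_bound x0 \<beta> \<gamma> (\<lambda>x. f x - g x) (A + B)"
  using smooth_bound_add[OF assms(1) smooth_bound_uminus[OF assms(2)]] by simp

lemma smooth_bound_sum:
  assumes "finite F" "\<And>k. k \<in> F \<Longrightarrow> smooth_bound x0 \<beta> \<gamma> (f k) (A k)"
  shows "smooth_bound x0 \<beta> \<gamma> (\<lambda>x. \<Sum>k\<in>F. f k x) (\<Sum>k\<in>F. A k)"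
  using assms
proof (induction F rule: finite_induct)
  case empty then show ?case by (simp add: smooth_bound_def)
next
  case (insert i F)
  then show ?case using smooth_bound_add[of x0 \<beta> \<gamma> "f i" "A i" "\<lambda>x. \<Sum>k\<in>F. f k x" "\<Sum>k\<in>F. A k"] by simp
qed

lemma smooth_bound_embed:
  assumes f: "smooth_bound x0 \<beta> \<gamma> f A" and "0 < \<beta>'" "\<beta>' \<le> \<beta>" "\<gamma>' \<le> \<gamma>"
  shows "smooth_bound x0 \<beta>' \<gamma>' f A"
proof (rule smooth_boundI)
  fix x y
  have A: "0 \<le> A" using f by (rule smooth_bound_nonneg)
  define R where "R = 1 + d x x0"
  have R: "1 \<le> R" using d_nonneg by (simp add: R_def)
  have "decay x0 \<gamma> R \<le> decay x0 \<gamma>' R"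
    unfolding decay_def using R assms by (intro divide_right_mono powr_mono) auto
  then have "A * decay x0 \<gamma> R \<le> A * decay x0 \<gamma>' R" using A by (rule mult_left_mono)
  then show "cmod (f x) \<le> A * decay x0 \<gamma>' (1 + d x x0)"
    using smooth_bound_size[OF f, of x] by (simp add: R_def)
  assume *: "d x y < (1 + d x x0) / (2 * A0)"
  have "R / (2 * A0) \<le> R / 1" using A0_ge_1 R by (intro divide_left_mono) auto
  then have dR: "d x y \<le> R" using * by (simp add: R_def)
  have "d x y powr \<beta> * decay x0 (\<beta> + \<gamma>) R \<le> d x y powr \<beta>' * decay x0 (\<beta>' + \<gamma>') R"
  proof -
    have "d x y powr \<beta> * R powr (- (\<beta> + \<gamma>)) = d x y powr \<beta>' * (d x y powr (\<beta> - \<beta>') * R powr (- (\<beta> + \<gamma>)))"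
      by (simp flip: powr_add)
    also have "\<dots> \<le> d x y powr \<beta>' * (R powr (\<beta> - \<beta>') * R powr (- (\<beta> + \<gamma>)))"
      using dR d_nonneg assms by (intro mult_left_mono mult_right_mono powr_mono2) auto
    also have "R powr (\<beta> - \<beta>') * R powr (- (\<beta> + \<gamma>)) = R powr (- (\<beta>' + \<gamma>))"
      unfolding powr_add[symmetric] by (rule arg_cong[where f = "(powr) R"]) simp
    also have "d x y powr \<beta>' * \<dots> \<le> d x y powr \<beta>' * R powr (- (\<beta>' + \<gamma>'))"
      using R assms by (intro mult_left_mono powr_mono) auto
    finally have "d x y powr \<beta> * R powr (- (\<beta> + \<gamma>)) / V R x0 \<le> d x y powr \<beta>' * R powr (- (\<beta>' + \<gamma>')) / V R x0"
      by (rule divide_right_mono) simp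
    then show ?thesis by (simp add: decay_def)
  qed
  then have "A * (d x y powr \<beta> * decay x0 (\<beta> + \<gamma>) R) \<le> A * (d x y powr \<beta>' * decay x0 (\<beta>' + \<gamma>') R)"
    using A by (rule mult_left_mono)
  then show "cmod (f x - f y) \<le> A * d x y powr \<beta>' * decay x0 (\<beta>' + \<gamma>') (1 + d x x0)"
    using smooth_bound_diff_le[OF f *] by (simp add: R_def mult.assoc)
qed

text \<open>Every ball has positive measure and so contains a zero of \<open>g\<close>.\<close>

lemma smooth_AE_zero_imp_zero:
  assumes g: "smooth_bound x0 \<beta> \<gamma> g K" and \<beta>: "0 < \<beta>" and ae: "AE x in M. g x = 0"
  shows "g x = 0"
proof -
  define R where "R = 1 + d x x0"
  have R: "1 \<le> R" using d_nonneg by (simp add: R_def)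
  have K: "0 \<le> K" using g by (rule smooth_bound_nonneg)
  have le: "cmod (g x) \<le> K * r powr \<beta> * decay x0 (\<beta> + \<gamma>) R" if r: "0 < r" "r < R / (2 * A0)" for r
  proof -
    have "\<exists>y\<in>qball d x r. g y = 0"
    proof (rule ccontr)
      assume "\<not> ?thesis"
      then have "AE y in M. y \<notin> qball d x r" using ae by (auto elim: eventually_mono)
      then have "emeasure M (qball d x r) = 0" by (subst (asm) AE_iff_measurable[where N = "qball d x r"]) (auto simp: space_M)
      then show False using ball_pos[OF r(1), of x] by simp
    qed
    then obtain y where y: "d x y < r" "g y = 0" by (auto simp: qball_def)
    then have "cmod (g x) \<le> K * d x y powr \<beta> * decay x0 (\<beta> + \<gamma>) R"
      using smooth_bound_diff_le[OF g, of x y] r by (simp add: R_def)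
    also have "\<dots> \<le> K * r powr \<beta> * decay x0 (\<beta> + \<gamma>) R"
      using y d_nonneg K \<beta> by (intro mult_left_mono mult_right_mono powr_mono2) auto
    finally show ?thesis .
  qed
  have "((\<lambda>r. r powr \<beta>) \<longlongrightarrow> 0) (at_right (0::real))"
  proof (rule tendsto_zero_powrI[OF _ tendsto_const _ \<beta>])
    show "eventually (\<lambda>r. 0 \<le> r) (at_right (0::real))"
      unfolding eventually_at_right_field by (intro exI[of _ 1]) auto
  qed (rule tendsto_ident_at)
  then have "((\<lambda>r. K * r powr \<beta> * decay x0 (\<beta> + \<gamma>) R) \<longlongrightarrow> K * 0 * decay x0 (\<beta> + \<gamma>) R) (at_right 0)"
    by (intro tendsto_mult tendsto_const)
  moreover have "eventually (\<lambda>r. cmod (g x) \<le> K * r powr \<beta> * decay x0 (\<beta> + \<gamma>) R) (at_right 0)"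
    using le R A0_pos unfolding eventually_at_right_field by (intro exI[of _ "R / (2 * A0)"]) auto
  ultimately have "cmod (g x) \<le> K * 0 * decay x0 (\<beta> + \<gamma>) R"
    by (intro tendsto_lowerbound[of _ _ "at_right 0"]) auto
  then show ?thesis by simp
qed

end

context volume_growth
begin

section \<open>Completed spaces of test functions\<close>

lemma test_functions_iff:
  "f \<in> test_functions d A0 M x0 1 \<beta> \<gamma> \<longleftrightarrow> (\<exists>A. smooth_bound x0 \<beta> \<gamma> f A) \<and> mean_zero f"
proof -
  obtain K where K: "1 \<le> K" "\<And>x0 \<beta> \<gamma> f C. 0 \<le> C \<Longrightarrow> test_bound d A0 M x0 1 \<beta> \<gamma> f C \<Longrightarrow> smooth_bound x0 \<beta> \<gamma> f (K * C)"
     "\<And>x0 \<beta> \<gamma> f C. 0 \<le> C \<Longrightarrow> smooth_bound x0 \<beta> \<gamma> f C \<Longrightarrow> test_bound d A0 M x0 1 \<beta> \<gamma> f (K * C)"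
    using test_bound_equiv_ex by (elim exE conjE) blast
  have "(\<exists>C>0. test_bound d A0 M x0 1 \<beta> \<gamma> f C) \<longleftrightarrow> (\<exists>A. smooth_bound x0 \<beta> \<gamma> f A)"
  proof
    assume "\<exists>C>0. test_bound d A0 M x0 1 \<beta> \<gamma> f C"
    then show "\<exists>A. smooth_bound x0 \<beta> \<gamma> f A" using K(2) less_imp_le by blast
  next
    assume "\<exists>A. smooth_bound x0 \<beta> \<gamma> f A"
    then obtain A where A: "smooth_bound x0 \<beta> \<gamma> f A" by blast
    have A0: "0 \<le> A" using A by (rule smooth_bound_nonneg)
    have "smooth_bound x0 \<beta> \<gamma> f (A + 1)" using A by (rule smooth_bound_mono) simp
    then have "test_bound d A0 M x0 1 \<beta> \<gamma> f (K * (A + 1))" using A0 by (intro K(3)) auto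
    moreover have "0 < K * (A + 1)" using K(1) A0 by (intro mult_pos_pos) auto
    ultimately show "\<exists>C>0. test_bound d A0 M x0 1 \<beta> \<gamma> f C" by blast
  qed
  then show ?thesis by (simp add: test_functions_def)
qed

lemma test_norm_tendsto_zeroI:
  fixes u :: "nat \<Rightarrow> 'a \<Rightarrow> complex"
  assumes u: "\<And>n. smooth_bound x0 \<beta> \<gamma> (u n) (B n)" and B: "B \<longlonglongrightarrow> 0"
  shows "(\<lambda>n. test_norm d A0 M x0 1 \<beta> \<gamma> (u n)) \<longlonglongrightarrow> 0"
proof -
  obtain K where K: "1 \<le> K"
     "\<And>x0 \<beta> \<gamma> f C. 0 \<le> C \<Longrightarrow> smooth_bound x0 \<beta> \<gamma> f C \<Longrightarrow> test_bound d A0 M x0 1 \<beta> \<gamma> f (K * C)"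
    using test_bound_equiv_ex by (elim exE conjE) blast
  define B' where "B' n = K * (B n + 1 / real (Suc n))" for n
  have B'0: "0 < B' n" for n
    using smooth_bound_nonneg[OF u[of n]] K(1) by (simp add: B'_def add_nonneg_pos)
  have tb: "test_bound d A0 M x0 1 \<beta> \<gamma> (u n) (B' n)" for n
    unfolding B'_def using smooth_bound_nonneg[OF u[of n]]
    by (intro K(2) smooth_bound_mono[OF u]) auto
  have "B' \<longlonglongrightarrow> K * (0 + 0)"
    unfolding B'_def by (intro tendsto_mult tendsto_const tendsto_add B LIMSEQ_Suc[OF lim_1_over_n])
  then have "B' \<longlonglongrightarrow> 0" by simp
  then show ?thesis
  proof (rule tendsto_sandwich[rotated 2, OF tendsto_const])
    show "\<forall>\<^sub>F n in sequentially. 0 \<le> test_norm d A0 M x0 1 \<beta> \<gamma> (u n)"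
    proof (rule always_eventually, rule allI)
      fix n
      show "0 \<le> test_norm d A0 M x0 1 \<beta> \<gamma> (u n)"
        unfolding test_norm_def
      proof (rule cInf_greatest)
        show "{C. 0 < C \<and> test_bound d A0 M x0 1 \<beta> \<gamma> (u n) C} \<noteq> {}" using tb[of n] B'0[of n] by blast
      qed auto
    qed
    show "\<forall>\<^sub>F n in sequentially. test_norm d A0 M x0 1 \<beta> \<gamma> (u n) \<le> B' n"
    proof (rule always_eventually, rule allI)
      fix n
      show "test_norm d A0 M x0 1 \<beta> \<gamma> (u n) \<le> B' n"
        unfolding test_norm_def
        by (rule cInf_lower) (use tb B'0 in \<open>auto intro!: bdd_belowI[of _ 0]\<close>)
    qed
  qed
qed

lemma test_norm_tendsto_zeroD:
  fixes u :: "nat \<Rightarrow> 'a \<Rightarrow> complex"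
  assumes u: "\<And>n. u n \<in> test_functions d A0 M x0 1 \<beta> \<gamma>"
    and lim: "(\<lambda>n. test_norm d A0 M x0 1 \<beta> \<gamma> (u n)) \<longlonglongrightarrow> 0"
  shows "\<exists>B. (\<forall>n. smooth_bound x0 \<beta> \<gamma> (u n) (B n)) \<and> B \<longlonglongrightarrow> 0"
proof -
  obtain K where K: "1 \<le> K"
     "\<And>x0 \<beta> \<gamma> f C. 0 \<le> C \<Longrightarrow> test_bound d A0 M x0 1 \<beta> \<gamma> f C \<Longrightarrow> smooth_bound x0 \<beta> \<gamma> f (K * C)"
    using test_bound_equiv_ex by (elim exE conjE) blast
  define B where "B n = K * (test_norm d A0 M x0 1 \<beta> \<gamma> (u n) + 1 / real (Suc n))" for n
  have "smooth_bound x0 \<beta> \<gamma> (u n) (B n)" for n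
  proof -
    have "\<exists>C\<in>{C. 0 < C \<and> test_bound d A0 M x0 1 \<beta> \<gamma> (u n) C}. C < test_norm d A0 M x0 1 \<beta> \<gamma> (u n) + 1 / real (Suc n)"
    proof (rule cInf_lessD)
      show "{C. 0 < C \<and> test_bound d A0 M x0 1 \<beta> \<gamma> (u n) C} \<noteq> {}"
        using u[of n] by (auto simp: test_functions_def)
    qed (simp add: test_norm_def)
    then obtain C where C: "0 < C" "test_bound d A0 M x0 1 \<beta> \<gamma> (u n) C"
      "C < test_norm d A0 M x0 1 \<beta> \<gamma> (u n) + 1 / real (Suc n)" by blast
    have "smooth_bound x0 \<beta> \<gamma> (u n) (K * C)" using C by (intro K(2)) auto
    then show ?thesis
      by (rule smooth_bound_mono) (use C K(1) in \<open>auto simp: B_def intro!: mult_left_mono\<close>)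
  qed
  moreover have "B \<longlonglongrightarrow> K * (0 + 0)"
    unfolding B_def by (intro tendsto_mult tendsto_const tendsto_add lim LIMSEQ_Suc[OF lim_1_over_n])
  ultimately show ?thesis by auto
qed

text \<open>Convergence of norms is replaced by the existence of bounds tending to 0, which need not be optimal and
hence are stable under linear operations.\<close>

lemma completed_test_functions_iff:
  assumes "0 < \<beta>" "\<beta> \<le> \<eta>"
  shows "f \<in> completed_test_functions d A0 M \<eta> x0 \<beta> \<gamma> \<longleftrightarrow>
    (\<exists>A. smooth_bound x0 \<beta> \<gamma> f A) \<and> mean_zero f \<and>
    (\<exists>g B. (\<forall>n. (\<exists>A. smooth_bound x0 \<eta> \<gamma> (g n) A) \<and> mean_zero (g n) \<and>
              smooth_bound x0 \<beta> \<gamma> (\<lambda>x. g n x - f x) (B n)) \<and> B \<longlonglongrightarrow> (0::real))"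
    (is "?L \<longleftrightarrow> ?R")
proof
  assume ?L
  then obtain g where f: "f \<in> test_functions d A0 M x0 1 \<beta> \<gamma>"
    and g: "\<And>n. g n \<in> test_functions d A0 M x0 1 \<eta> \<gamma>"
    and lim: "(\<lambda>n::nat. test_norm d A0 M x0 1 \<beta> \<gamma> (\<lambda>x. g n x - f x)) \<longlonglongrightarrow> 0"
    by (auto simp: completed_test_functions_def)
  have "(\<lambda>x. g n x - f x) \<in> test_functions d A0 M x0 1 \<beta> \<gamma>" for n
  proof -
    obtain A A' where A: "smooth_bound x0 \<beta> \<gamma> f A" and A': "smooth_bound x0 \<eta> \<gamma> (g n) A'"
      using f g[of n] by (auto simp: test_functions_iff)
    from A' have "smooth_bound x0 \<beta> \<gamma> (g n) A'" by (rule smooth_bound_embed) (use assms in auto)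
    from smooth_bound_diff[OF this A]
    have "smooth_bound x0 \<beta> \<gamma> (\<lambda>x. g n x - f x) (A' + A)" .
    moreover have "has_bochner_integral M (\<lambda>x. g n x - f x) (0 - 0)"
      using f g[of n] by (intro has_bochner_integral_diff) (auto simp: test_functions_iff)
    ultimately show ?thesis by (auto simp: test_functions_iff)
  qed
  from test_norm_tendsto_zeroD[OF this lim] obtain B
    where B: "\<forall>n. smooth_bound x0 \<beta> \<gamma> (\<lambda>x. g n x - f x) (B n)" "B \<longlonglongrightarrow> 0"
    by (elim exE conjE) (rule that)
  moreover have "\<forall>n. (\<exists>A. smooth_bound x0 \<eta> \<gamma> (g n) A) \<and> mean_zero (g n)"
    using g by (simp add: test_functions_iff)
  ultimately have "\<forall>n. (\<exists>A. smooth_bound x0 \<eta> \<gamma> (g n) A) \<and> mean_zero (g n) \<and>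
              smooth_bound x0 \<beta> \<gamma> (\<lambda>x. g n x - f x) (B n)" by simp
  moreover have "\<exists>A. smooth_bound x0 \<beta> \<gamma> f A" "mean_zero f"
    using f by (simp_all add: test_functions_iff)
  ultimately show ?R using B(2) by (intro conjI exI[of _ g] exI[of _ B])
next
  assume ?R
  then obtain A g B where f: "smooth_bound x0 \<beta> \<gamma> f A" "mean_zero f"
    and g: "\<forall>n. (\<exists>A. smooth_bound x0 \<eta> \<gamma> (g n) A) \<and> mean_zero (g n) \<and>
              smooth_bound x0 \<beta> \<gamma> (\<lambda>x. g n x - f x) (B n)" and B: "B \<longlonglongrightarrow> (0::real)"
    by (elim exE conjE) (rule that)
  have "(\<lambda>n. test_norm d A0 M x0 1 \<beta> \<gamma> (\<lambda>x. g n x - f x)) \<longlonglongrightarrow> 0"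
    by (rule test_norm_tendsto_zeroI[OF _ B]) (use g in simp)
  moreover have "\<forall>n. g n \<in> test_functions d A0 M x0 1 \<eta> \<gamma>" using g by (simp add: test_functions_iff)
  moreover have "f \<in> test_functions d A0 M x0 1 \<beta> \<gamma>" using f by (auto simp: test_functions_iff)
  ultimately show ?L unfolding completed_test_functions_def by blast
qed

lemma completed_test_functions_embed:
  assumes "f \<in> completed_test_functions d A0 M \<eta> x0 \<beta> \<gamma>" "0 < \<beta>'" "\<beta>' \<le> \<beta>" "\<beta> \<le> \<eta>" "\<gamma>' \<le> \<gamma>"
  shows "f \<in> completed_test_functions d A0 M \<eta> x0 \<beta>' \<gamma>'"
proof -
  have b: "0 < \<beta>" "\<beta>' \<le> \<eta>" "0 < \<eta>" using assms by auto
  obtain A g B where f: "smooth_bound x0 \<beta> \<gamma> f A" "mean_zero f"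
    and g: "\<forall>n. (\<exists>A. smooth_bound x0 \<eta> \<gamma> (g n) A) \<and> mean_zero (g n) \<and>
              smooth_bound x0 \<beta> \<gamma> (\<lambda>x. g n x - f x) (B n)" and B: "B \<longlonglongrightarrow> (0::real)"
    using assms(1) unfolding completed_test_functions_iff[OF b(1) assms(4)] by (elim exE conjE) (rule that)
  have 1: "smooth_bound x0 \<beta>' \<gamma>' f A" by (rule smooth_bound_embed[OF f(1)]) (use assms in auto)
  have 2: "\<exists>A. smooth_bound x0 \<eta> \<gamma>' (g n) A" for n
  proof -
    obtain A where "smooth_bound x0 \<eta> \<gamma> (g n) A" using g by auto
    then have "smooth_bound x0 \<eta> \<gamma>' (g n) A" by (rule smooth_bound_embed) (use assms b in auto)
    then show ?thesis by blast
  qed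
  have 3: "smooth_bound x0 \<beta>' \<gamma>' (\<lambda>x. g n x - f x) (B n)" for n
    by (rule smooth_bound_embed[where \<beta> = \<beta> and \<gamma> = \<gamma>]) (use g assms in auto)
  have "\<forall>n. (\<exists>A. smooth_bound x0 \<eta> \<gamma>' (g n) A) \<and> mean_zero (g n) \<and>
              smooth_bound x0 \<beta>' \<gamma>' (\<lambda>x. g n x - f x) (B n)" using 2 3 g by simp
  then show ?thesis unfolding completed_test_functions_iff[OF assms(2) b(2)]
    using 1 f(2) B by (intro conjI exI[of _ A] exI[of _ g] exI[of _ B])
qed

end

context wavelet_growth
begin

lemma wavelet_bounded:
  assumes "y \<in> new_points X k" obtains b where "0 \<le> b" "\<And>z. cmod (\<psi> k y z) \<le> b"
proof -
  obtain B where B: "0 \<le> B" "\<forall>k. \<forall>y\<in>new_points X k. molecule decay_order \<eta> y (sc k) (B * normalizer k y) (\<psi> k y)"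
    using wavelet_molecule_ex by (elim exE conjE) (rule that)
  define b where "b = B * normalizer k y"
  have b: "0 \<le> b" using B by (simp add: b_def)
  have "cmod (\<psi> k y z) \<le> b" for z
  proof -
    have "1 \<le> 1 + d y z / sc k" using divide_nonneg_pos[OF d_nonneg sc_pos, of y z k] by simp
    then have "(1 + d y z / sc k) powr (- decay_order) \<le> (1 + d y z / sc k) powr 0"
      using \<omega>_nonneg by (intro powr_mono) auto
    then have "(1 + d y z / sc k) powr (- decay_order) \<le> 1" using \<open>1 \<le> 1 + d y z / sc k\<close> by simp
    then have "b * (1 + d y z / sc k) powr (- decay_order) \<le> b * 1" using b by (rule mult_left_mono)
    moreover have "cmod (\<psi> k y z) \<le> b * (1 + d y z / sc k) powr (- decay_order)"
      using B(2) assms unfolding molecule_def b_def by blast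
    ultimately show ?thesis by simp
  qed
  then show thesis using b that by blast
qed

lemma wavelet_integrable: "y \<in> new_points X k \<Longrightarrow> integrable M (\<psi> k y)"
  using cancellation has_bochner_integral_iff by blast

lemma integrable_mult_bounded:
  fixes f g :: "'a \<Rightarrow> complex"
  assumes "integrable M f" "g \<in> borel_measurable M" "\<And>z. cmod (g z) \<le> b"
  shows "integrable M (\<lambda>z. f z * g z)"
proof (rule norm_integral_le_dominated(1))
  show "integrable M (\<lambda>z. cmod (f z) * b)" using assms(1) by simp
  show "cmod (f z * g z) \<le> cmod (f z) * b" for z
    unfolding norm_mult using assms(3) by (intro mult_left_mono) auto
  show "(\<lambda>z. f z * g z) \<in> borel_measurable M" using assms by measurable
qed

lemma l2_inner_wavelet_integrable:
  assumes "integrable M f" "y \<in> new_points X k"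
  shows "integrable M (\<lambda>z. f z * cnj (\<psi> k y z))"
proof -
  obtain b where b: "\<And>z. cmod (\<psi> k y z) \<le> b" using wavelet_bounded[OF assms(2)] by blast
  show ?thesis
    by (rule integrable_mult_bounded[OF assms(1), where b = b])
       (use b borel_measurable_integrable[OF wavelet_integrable[OF assms(2)]] in auto)
qed

text \<open>With \<open>\<epsilon> = 0\<close>, \<open>\<beta>' = \<beta>\<close> and \<open>\<gamma>' = \<gamma>\<close> this says that the blocks are uniformly bounded on the test
functions; with \<open>\<epsilon> > 0\<close> it is the geometric decay in the level.\<close>

lemma block_smooth_ex:
  assumes \<beta>: "0 < \<beta>" "\<beta> \<le> \<eta>" and \<gamma>: "0 < \<gamma>" "\<gamma> < \<eta>"
  shows "\<exists>C\<ge>0. \<forall>f x0 A k \<beta>' \<gamma>' \<epsilon>. smooth_bound x0 \<beta> \<gamma> f A \<longrightarrow> mean_zero f \<longrightarrow>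
     0 < \<beta>' \<longrightarrow> \<beta>' \<le> \<beta> \<longrightarrow> 0 < \<gamma>' \<longrightarrow> 0 \<le> \<epsilon> \<longrightarrow> \<epsilon> \<le> \<beta> - \<beta>' \<longrightarrow> \<epsilon> \<le> \<gamma> - \<gamma>' \<longrightarrow>
     smooth_bound x0 \<beta>' \<gamma>' (block k f) (C * A * min (sc k) (1 / sc k) powr \<epsilon>)"
proof -
  obtain C where C: "0 \<le> C" "\<forall>f x0 A k x. smooth_bound x0 \<beta> \<gamma> f A \<longrightarrow> mean_zero f \<longrightarrow>
     (\<forall>F. finite F \<longrightarrow> F \<subseteq> new_points X k \<longrightarrow> (\<Sum>y\<in>F. cmod (coef f k y * \<psi> k y x))
        \<le> C * A * sc k powr \<beta> * decay x0 (\<beta> + \<gamma>) (max 1 (sc k) + d x x0)) \<and>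
     (\<forall>x'. d x x' \<le> sc k \<longrightarrow> cmod (block k f x - block k f x')
        \<le> C * A * (d x x' / sc k) powr \<eta> * sc k powr \<beta> * decay x0 (\<beta> + \<gamma>) (max 1 (sc k) + d x x0))"
    using block_bound_ex[OF \<beta> \<gamma>] by (elim exE conjE) (rule that)
  define c where "c = 1 + D * (2 * A0) powr (\<beta> + \<gamma> + \<omega>)"
  have c1: "1 \<le> c" using D_pos by (simp add: c_def)
  have "smooth_bound x0 \<beta>' \<gamma>' (block k f) (C * c * A * min (sc k) (1 / sc k) powr \<epsilon>)"
    if f: "smooth_bound x0 \<beta> \<gamma> f A" and f0: "mean_zero f"
      and e: "0 < \<beta>'" "\<beta>' \<le> \<beta>" "0 < \<gamma>'" "0 \<le> \<epsilon>" "\<epsilon> \<le> \<beta> - \<beta>'" "\<epsilon> \<le> \<gamma> - \<gamma>'" for f x0 A k \<beta>' \<gamma>' \<epsilon>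
  proof -
    have A: "0 \<le> A" using f by (rule smooth_bound_nonneg)
    define r where "r = sc k"
    have r: "0 < r" using sc_pos by (simp add: r_def)
    define T where "T x = max 1 r + d x x0" for x
    have T: "1 \<le> T x" for x using d_nonneg[of x x0] by (simp add: T_def)
    define Q where "Q x = r powr \<beta> * decay x0 (\<beta> + \<gamma>) (T x)" for x
    have Q: "0 \<le> Q x" for x by (simp add: Q_def)
    define m where "m = min r (1 / r) powr \<epsilon>"
    note Cf = C(2)[rule_format, OF f f0]
    have fin: "(\<Sum>y\<in>F. cmod (coef f k y * \<psi> k y x)) \<le> C * A * Q x"
      if "finite F" "F \<subseteq> new_points X k" for x F
      using conjunct1[OF Cf, rule_format, OF that] unfolding Q_def T_def r_def by (simp only: mult.assoc)
    have df: "cmod (block k f x - block k f x') \<le> C * A * (d x x' / r) powr \<eta> * Q x" if "d x x' \<le> r" for x x'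
      using conjunct2[OF Cf, rule_format, OF that[unfolded r_def]] unfolding Q_def T_def r_def
      by (simp only: mult.assoc)
    have size: "cmod (block k f x) \<le> C * A * Q x" for x
      unfolding block_def by (rule infsum_norm_le(2)) (rule fin)
    have CA: "0 \<le> C * A" "C * A \<le> C * c * A" using C(1) A c1 mult_left_mono[OF c1, of "C * A"] by (auto simp: mult_ac)
    have gain: "r powr (\<beta> - b) * decay x0 (\<beta> + \<gamma>) (T x) \<le> m * decay x0 (b + \<gamma>') (1 + d x x0)"
      if "0 \<le> b" "b \<le> \<beta>'" for b x
      unfolding m_def T_def using that e r d_nonneg by (intro decay_scale_gain) auto
    have "smooth_bound x0 \<beta>' \<gamma>' (block k f) (C * c * A * m)"
    proof (rule smooth_boundI)
      fix x x'
      have "C * A * Q x \<le> C * c * A * (m * decay x0 \<gamma>' (1 + d x x0))"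
        using gain[of 0 x] e CA Q by (intro mult_mono[OF CA(2)]) (auto simp: Q_def)
      then show "cmod (block k f x) \<le> C * c * A * m * decay x0 \<gamma>' (1 + d x x0)"
        using size[of x] by (simp add: mult.assoc)
      assume near: "d x x' < (1 + d x x0) / (2 * A0)"
      have main: "cmod (block k f x - block k f x') \<le> C * c * A * ((d x x' / r) powr \<beta>' * Q x)"
      proof (cases "d x x' \<le> r")
        case True
        have "(d x x' / r) powr \<eta> \<le> (d x x' / r) powr \<beta>'"
          using True r d_nonneg[of x x'] e \<beta> by (intro powr_mono') auto
        then have "C * A * ((d x x' / r) powr \<eta> * Q x) \<le> C * c * A * ((d x x' / r) powr \<beta>' * Q x)"
          using CA Q by (intro mult_mono[OF CA(2)] mult_right_mono) auto
        then show ?thesis using df[OF True] by (simp add: mult.assoc)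
      next
        case False
        have "T x \<le> 2 * A0 * T x'"
        proof -
          have "2 * A0 * d x x' \<le> 1 + d x x0" using near A0_pos by (simp add: field_simps)
          moreover have "1 + d x x0 \<le> T x" by (simp add: T_def)
          moreover have "d x x0 \<le> A0 * d x x' + A0 * d x' x0"
            using d_quasi_triangle[of x x0 x'] by (simp add: algebra_simps)
          moreover have "1 * max 1 r \<le> A0 * max 1 r" using A0_ge_1 by (intro mult_right_mono) auto
          moreover have "A0 * T x' = A0 * max 1 r + A0 * d x' x0" by (simp add: T_def algebra_simps)
          ultimately show ?thesis unfolding T_def by linarith
        qed
        then have "decay x0 (\<beta> + \<gamma>) (T x') \<le> D * (2 * A0) powr (\<beta> + \<gamma> + \<omega>) * decay x0 (\<beta> + \<gamma>) (T x)"
          using T[of x] T[of x'] A0_ge_1 \<beta> \<gamma> by (intro decay_compare) auto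
        then have "r powr \<beta> * decay x0 (\<beta> + \<gamma>) (T x') \<le> r powr \<beta> * (D * (2 * A0) powr (\<beta> + \<gamma> + \<omega>) * decay x0 (\<beta> + \<gamma>) (T x))"
          by (rule mult_left_mono) simp
        then have Q': "Q x + Q x' \<le> c * Q x" by (simp add: Q_def c_def algebra_simps)
        have "cmod (block k f x - block k f x') \<le> C * A * Q x + C * A * Q x'"
          using size[of x] size[of x'] norm_triangle_ineq4[of "block k f x" "block k f x'"] by linarith
        also have "\<dots> \<le> C * A * (c * Q x)"
          using mult_left_mono[OF Q' CA(1)] by (simp add: distrib_left)
        also have "\<dots> = C * c * A * (1 * Q x)" by simp
        also have "\<dots> \<le> C * c * A * ((d x x' / r) powr \<beta>' * Q x)"
        proof -
          have "1 \<le> (d x x' / r) powr \<beta>'" using False r e by (intro ge_one_powr_ge_zero) auto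
          then show ?thesis using CA Q by (intro mult_left_mono mult_right_mono) auto
        qed
        finally show ?thesis .
      qed
      have "(d x x' / r) powr \<beta>' * r powr \<beta> = d x x' powr \<beta>' * r powr (\<beta> - \<beta>')"
        unfolding powr_divide powr_diff by simp
      then have "(d x x' / r) powr \<beta>' * Q x = d x x' powr \<beta>' * (r powr (\<beta> - \<beta>') * decay x0 (\<beta> + \<gamma>) (T x))"
        by (simp add: Q_def flip: mult.assoc)
      also have "\<dots> \<le> d x x' powr \<beta>' * (m * decay x0 (\<beta>' + \<gamma>') (1 + d x x0))"
        using gain[of \<beta>' x] e by (intro mult_left_mono) auto
      finally have "C * c * A * ((d x x' / r) powr \<beta>' * Q x) \<le> C * c * A * (d x x' powr \<beta>' * (m * decay x0 (\<beta>' + \<gamma>') (1 + d x x0)))"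
        using CA by (intro mult_left_mono) auto
      then show "cmod (block k f x - block k f x') \<le> C * c * A * m * d x x' powr \<beta>' * decay x0 (\<beta>' + \<gamma>') (1 + d x x0)"
        using main by (simp add: mult_ac)
    qed
    then show ?thesis by (simp add: m_def r_def)
  qed
  then show ?thesis using C(1) c1 by (intro exI[of _ "C * c"]) auto
qed

section \<open>Convergence of the wavelet expansion\<close>

lemma block_finite_bound_ex:
  assumes \<beta>: "0 < \<beta>" "\<beta> \<le> \<eta>" and \<gamma>: "0 < \<gamma>" "\<gamma> < \<eta>"
    and f: "smooth_bound x0 \<beta> \<gamma> f A" "mean_zero f"
  shows "\<exists>C\<ge>0. \<forall>k x F. finite F \<longrightarrow> F \<subseteq> new_points X k \<longrightarrow>
        (\<Sum>y\<in>F. cmod (coef f k y * \<psi> k y x)) \<le> C * decay x0 \<gamma> (1 + d x x0)"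
proof -
  obtain C where C: "0 \<le> C" "\<forall>f x0 A k x. smooth_bound x0 \<beta> \<gamma> f A \<longrightarrow> mean_zero f \<longrightarrow>
     (\<forall>F. finite F \<longrightarrow> F \<subseteq> new_points X k \<longrightarrow> (\<Sum>y\<in>F. cmod (coef f k y * \<psi> k y x))
        \<le> C * A * sc k powr \<beta> * decay x0 (\<beta> + \<gamma>) (max 1 (sc k) + d x x0)) \<and>
     (\<forall>x'. d x x' \<le> sc k \<longrightarrow> cmod (block k f x - block k f x')
        \<le> C * A * (d x x' / sc k) powr \<eta> * sc k powr \<beta> * decay x0 (\<beta> + \<gamma>) (max 1 (sc k) + d x x0))"
    using block_bound_ex[OF \<beta> \<gamma>] by (elim exE conjE) (rule that)
  have CA: "0 \<le> C * A" using C(1) smooth_bound_nonneg[OF f(1)] by simp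
  have "(\<Sum>y\<in>F. cmod (coef f k y * \<psi> k y x)) \<le> (C * A) * decay x0 \<gamma> (1 + d x x0)"
    if F: "finite F" "F \<subseteq> new_points X k" for k x F
  proof -
    have "min (sc k) (1 / sc k) \<noteq> 0" using \<delta>_range by (simp add: min_def)
    then have "sc k powr \<beta> * decay x0 (\<beta> + \<gamma>) (max 1 (sc k) + d x x0) \<le> decay x0 \<gamma> (1 + d x x0)"
      using decay_scale_gain[of "sc k" 0 0 \<beta> \<gamma> 0 \<gamma> "d x x0" x0] sc_pos[of k] \<beta> \<gamma> d_nonneg by simp
    then have "(C * A) * (sc k powr \<beta> * decay x0 (\<beta> + \<gamma>) (max 1 (sc k) + d x x0)) \<le> (C * A) * decay x0 \<gamma> (1 + d x x0)"
      using CA by (rule mult_left_mono)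
    then show ?thesis
      using conjunct1[OF C(2)[rule_format, OF f], rule_format, OF F, of x] by (simp only: mult.assoc)
  qed
  then show ?thesis using CA by (intro exI[of _ "C * A"]) auto
qed

lemma wavelet_sum_summable:
  assumes "0 < \<beta>" "\<beta> \<le> \<eta>" "0 < \<gamma>" "\<gamma> < \<eta>" "smooth_bound x0 \<beta> \<gamma> f A" "mean_zero f"
  shows "(\<lambda>y. coef f k y * \<psi> k y x) summable_on new_points X k"
proof -
  obtain C where "\<forall>k x F. finite F \<longrightarrow> F \<subseteq> new_points X k \<longrightarrow>
        (\<Sum>y\<in>F. cmod (coef f k y * \<psi> k y x)) \<le> C * decay x0 \<gamma> (1 + d x x0)"
    using block_finite_bound_ex[OF assms] by (elim exE conjE) (rule that)
  then show ?thesis by (intro infsum_norm_le(1)) auto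
qed

lemma block_pairing:
  assumes asm: "0 < \<beta>" "\<beta> \<le> \<eta>" "0 < \<gamma>" "\<gamma> < \<eta>" "smooth_bound x0 \<beta> \<gamma> f A" "mean_zero f"
    and g: "g \<in> borel_measurable M" "\<And>z. cmod (g z) \<le> b"
  shows "integrable M (\<lambda>z. block k f z * g z)"
    "(LINT z|M. block k f z * g z) = (\<Sum>\<^sub>\<infinity>y\<in>new_points X k. coef f k y * (LINT z|M. \<psi> k y z * g z))"
proof -
  obtain C where C: "0 \<le> C" "\<forall>k x F. finite F \<longrightarrow> F \<subseteq> new_points X k \<longrightarrow>
        (\<Sum>y\<in>F. cmod (coef f k y * \<psi> k y x)) \<le> C * decay x0 \<gamma> (1 + d x x0)"
    using block_finite_bound_ex[OF asm] by (elim exE conjE) (rule that)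
  define F where "F y z = coef f k y * (\<psi> k y z * g z)" for y z
  have blk: "block k f z * g z = (\<Sum>\<^sub>\<infinity>y\<in>new_points X k. F y z)" for z
    unfolding block_def F_def mult.assoc[symmetric] by (rule infsum_cmult_left'[symmetric])
  have int: "integrable M (F y)" if "y \<in> new_points X k" for y
    unfolding F_def[abs_def]
    by (intro integrable_mult_right integrable_mult_bounded[OF wavelet_integrable[OF that] g])
  have w: "integrable M (\<lambda>z. C * decay x0 \<gamma> (1 + d z x0) * b)"
    using integrable_decay[OF asm(3)] by simp
  have dom: "(\<Sum>y\<in>E. cmod (F y z)) \<le> C * decay x0 \<gamma> (1 + d z x0) * b" if E: "finite E" "E \<subseteq> new_points X k" for E z
  proof -
    have "(\<Sum>y\<in>E. cmod (F y z)) = (\<Sum>y\<in>E. cmod (coef f k y * \<psi> k y z)) * cmod (g z)"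
      by (simp add: F_def norm_mult sum_distrib_right mult.assoc)
    also have "\<dots> \<le> C * decay x0 \<gamma> (1 + d z x0) * b"
      using C E g(2) by (intro mult_mono) (auto intro: sum_nonneg)
    finally show ?thesis .
  qed
  show "integrable M (\<lambda>z. block k f z * g z)"
    unfolding blk by (rule integral_infsum_dominated(1)[OF countable_new_points int w dom])
  have "(LINT z|M. block k f z * g z) = (\<Sum>\<^sub>\<infinity>y\<in>new_points X k. (LINT z|M. F y z))"
    unfolding blk by (rule integral_infsum_dominated(2)[OF countable_new_points int w dom])
  then show "(LINT z|M. block k f z * g z) = (\<Sum>\<^sub>\<infinity>y\<in>new_points X k. coef f k y * (LINT z|M. \<psi> k y z * g z))"
    by (simp add: F_def)
qed

lemma block_has_integral_zero:
  assumes asm: "0 < \<beta>" "\<beta> \<le> \<eta>" "0 < \<gamma>" "\<gamma> < \<eta>" "smooth_bound x0 \<beta> \<gamma> f A" "mean_zero f"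
  shows "mean_zero (block k f)"
proof -
  have z: "(LINT z|M. \<psi> k y z) = 0" if "y \<in> new_points X k" for y
    using cancellation[OF that] by (simp add: has_bochner_integral_iff)
  have "(LINT z|M. block k f z) = (\<Sum>\<^sub>\<infinity>y\<in>new_points X k. coef f k y * (LINT z|M. \<psi> k y z))"
    using block_pairing(2)[OF asm, of "\<lambda>_. 1" 1 k] by simp
  also have "\<dots> = 0" using z by (intro infsum_0) auto
  finally show ?thesis using block_pairing(1)[OF asm, of "\<lambda>_. 1" 1 k] by (simp add: has_bochner_integral_iff)
qed

lemma wavelet_orthonormal:
  assumes "y \<in> new_points X k" "y' \<in> new_points X k'"
  shows "l2_inner M (\<psi> k y) (\<psi> k' y') = (if k = k' \<and> y = y' then 1 else 0)"
proof -
  have "\<forall>i\<in>(SIGMA k:UNIV. new_points X k). \<forall>j\<in>(SIGMA k:UNIV. new_points X k).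
    l2_inner M ((\<lambda>(k, y). \<psi> k y) i) ((\<lambda>(k, y). \<psi> k y) j) = (if i = j then 1 else 0)"
    using basis by (simp add: orthonormal_basis_def)
  from this[rule_format, of "(k, y)" "(k', y')"] show ?thesis using assms by simp
qed

lemma block_inner_wavelet:
  assumes asm: "0 < \<beta>" "\<beta> \<le> \<eta>" "0 < \<gamma>" "\<gamma> < \<eta>" "smooth_bound x0 \<beta> \<gamma> f A" "mean_zero f"
    and y': "y' \<in> new_points X k'"
  shows "integrable M (\<lambda>z. block k f z * cnj (\<psi> k' y' z))"
    "l2_inner M (block k f) (\<psi> k' y') = (if k = k' then l2_inner M f (\<psi> k' y') else 0)"
proof -
  obtain b where b: "\<And>z. cmod (\<psi> k' y' z) \<le> b" using wavelet_bounded[OF y'] by blast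
  have m: "(\<lambda>z. cnj (\<psi> k' y' z)) \<in> borel_measurable M"
    using borel_measurable_integrable[OF wavelet_integrable[OF y']] by measurable
  have b': "cmod (cnj (\<psi> k' y' z)) \<le> b" for z using b by simp
  show "integrable M (\<lambda>z. block k f z * cnj (\<psi> k' y' z))" by (rule block_pairing(1)[OF asm m b'])
  have "l2_inner M (block k f) (\<psi> k' y') = (\<Sum>\<^sub>\<infinity>y\<in>new_points X k. coef f k y * l2_inner M (\<psi> k y) (\<psi> k' y'))"
    unfolding l2_inner_def[of M "block k f"] l2_inner_def[of M "\<psi> k _"] by (rule block_pairing(2)[OF asm m b'])
  also have "\<dots> = (if k = k' then l2_inner M f (\<psi> k' y') else 0)"
  proof (cases "k = k'")
    case True
    have "(\<Sum>\<^sub>\<infinity>y\<in>new_points X k. coef f k y * l2_inner M (\<psi> k y) (\<psi> k' y'))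
        = (\<Sum>\<^sub>\<infinity>y\<in>{y'}. coef f k y * l2_inner M (\<psi> k y) (\<psi> k' y'))"
      using y' True by (intro infsum_cong_neutral) (auto simp: wavelet_orthonormal)
    then show ?thesis using True y' by (simp add: wavelet_orthonormal)
  next
    case False
    then have "(\<Sum>\<^sub>\<infinity>y\<in>new_points X k. coef f k y * l2_inner M (\<psi> k y) (\<psi> k' y')) = 0"
      using y' by (intro infsum_0) (auto simp: wavelet_orthonormal)
    then show ?thesis using False by simp
  qed
  finally show "l2_inner M (block k f) (\<psi> k' y') = (if k = k' then l2_inner M f (\<psi> k' y') else 0)" .
qed

lemma block_diff:
  assumes asm: "0 < \<beta>" "\<beta> \<le> \<eta>" "0 < \<gamma>" "\<gamma> < \<eta>"
    and f: "smooth_bound x0 \<beta> \<gamma> f A" "mean_zero f"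
    and g: "smooth_bound x0 \<beta> \<gamma> g B" "mean_zero g"
  shows "block k (\<lambda>x. f x - g x) x = block k f x - block k g x"
proof -
  have "l2_inner M (\<lambda>x. f x - g x) (\<psi> k y) * \<psi> k y x
     = coef f k y * \<psi> k y x - l2_inner M g (\<psi> k y) * \<psi> k y x" if y: "y \<in> new_points X k" for y
  proof -
    have "integrable M (\<lambda>z. f z * cnj (\<psi> k y z))" "integrable M (\<lambda>z. g z * cnj (\<psi> k y z))"
      using f(2) g(2) y by (auto intro!: l2_inner_wavelet_integrable simp: has_bochner_integral_iff)
    then have "l2_inner M (\<lambda>x. f x - g x) (\<psi> k y) = coef f k y - l2_inner M g (\<psi> k y)"
      unfolding l2_inner_def left_diff_distrib by (rule Bochner_Integration.integral_diff)
    then show ?thesis by (simp add: left_diff_distrib)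
  qed
  then have "block k (\<lambda>x. f x - g x) x
    = (\<Sum>\<^sub>\<infinity>y\<in>new_points X k. coef f k y * \<psi> k y x - l2_inner M g (\<psi> k y) * \<psi> k y x)"
    unfolding block_def by (intro infsum_cong) auto
  also have "\<dots> = block k f x - block k g x"
    unfolding block_def
    by (rule infsum_diff_complex[OF wavelet_sum_summable[OF asm f] wavelet_sum_summable[OF asm g]])
  finally show ?thesis .
qed

lemma partial_sum_blocks: "wavelet_partial_sum M X \<psi> f L x = (\<Sum>k = - int L..int L. block k f x)"
  by (simp add: wavelet_partial_sum_def block_def)

lemma scale_factor: "min (sc k) (1 / sc k) powr \<epsilon> = (\<delta> powr \<epsilon>) ^ nat \<bar>k\<bar>"
proof -
  define n where "n = nat \<bar>k\<bar>"
  have d: "0 < \<delta> ^ n" "\<delta> ^ n \<le> 1" using \<delta>_range by (auto intro: power_le_one)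
  then have "\<delta> ^ n * \<delta> ^ n \<le> 1" by (intro mult_le_one) auto
  then have d1: "\<delta> ^ n \<le> 1 / \<delta> ^ n" using d by (simp add: field_simps)
  have "min (sc k) (1 / sc k) = \<delta> ^ n"
  proof (cases "0 \<le> k")
    case True
    then have "sc k = \<delta> ^ n" by (simp add: n_def power_int_def)
    then show ?thesis using d1 by simp
  next
    case False
    then have "sc k = 1 / \<delta> ^ n" by (simp add: n_def power_int_def divide_inverse power_inverse)
    then show ?thesis using d1 by simp
  qed
  moreover have "(\<delta> ^ n) powr \<epsilon> = (\<delta> powr \<epsilon>) ^ n"
  proof -
    have "(\<delta> ^ n) powr \<epsilon> = \<delta> powr (real n * \<epsilon>)" using \<delta>_range by (simp add: powr_powr flip: powr_realpow)
    also have "\<dots> = (\<delta> powr \<epsilon>) ^ n" using \<delta>_range by (simp add: powr_powr mult.commute flip: powr_realpow)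
    finally show ?thesis .
  qed
  ultimately show ?thesis by (simp add: n_def)
qed

text \<open>Blocks map the approximating functions of exponents \<open>(\<eta>, \<gamma>)\<close> to functions of the same kind, and
their boundedness in exponents \<open>(\<beta>, \<gamma>)\<close> carries the approximation over.\<close>

lemma partial_sum_completed:
  assumes \<beta>: "0 < \<beta>" "\<beta> \<le> \<eta>" and \<gamma>: "0 < \<gamma>" "\<gamma> < \<eta>"
    and f: "f \<in> completed_test_functions d A0 M \<eta> x0 \<beta> \<gamma>"
  shows "wavelet_partial_sum M X \<psi> f L \<in> completed_test_functions d A0 M \<eta> x0 \<beta> \<gamma>"
proof -
  define I where "I = {- int L..int L}"
  have I: "finite I" by (simp add: I_def)
  have S: "wavelet_partial_sum M X \<psi> f L = (\<lambda>x. \<Sum>k\<in>I. block k f x)" for f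
    by (rule ext) (simp add: partial_sum_blocks I_def)
  have bounded: "\<exists>C\<ge>0. \<forall>f A. smooth_bound x0 b \<gamma> f A \<longrightarrow> mean_zero f \<longrightarrow>
      smooth_bound x0 b \<gamma> (\<lambda>x. \<Sum>k\<in>I. block k f x) (C * A) \<and> mean_zero (\<lambda>x. \<Sum>k\<in>I. block k f x)"
    if b: "0 < b" "b \<le> \<eta>" for b
  proof -
    obtain C where C: "0 \<le> C" "\<forall>f x0 A k \<beta>' \<gamma>' \<epsilon>. smooth_bound x0 b \<gamma> f A \<longrightarrow> mean_zero f \<longrightarrow>
       0 < \<beta>' \<longrightarrow> \<beta>' \<le> b \<longrightarrow> 0 < \<gamma>' \<longrightarrow> 0 \<le> \<epsilon> \<longrightarrow> \<epsilon> \<le> b - \<beta>' \<longrightarrow> \<epsilon> \<le> \<gamma> - \<gamma>' \<longrightarrow>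
       smooth_bound x0 \<beta>' \<gamma>' (block k f) (C * A * min (sc k) (1 / sc k) powr \<epsilon>)"
      using block_smooth_ex[OF b \<gamma>] by (elim exE conjE) (rule that)
    have "smooth_bound x0 b \<gamma> (\<lambda>x. \<Sum>k\<in>I. block k f x) (real (card I) * C * A) \<and>
        mean_zero (\<lambda>x. \<Sum>k\<in>I. block k f x)"
      if f: "smooth_bound x0 b \<gamma> f A" "mean_zero f" for f A
    proof
      have "smooth_bound x0 b \<gamma> (block k f) (C * A)" for k
      proof -
        have "smooth_bound x0 b \<gamma> (block k f) (C * A * min (sc k) (1 / sc k) powr 0)"
          using C(2)[rule_format, OF f, where \<beta>' = b and \<gamma>' = \<gamma> and \<epsilon> = 0] b \<gamma> by simp
        then show ?thesis unfolding scale_factor using \<delta>_range by simp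
      qed
      from smooth_bound_sum[OF I this]
      show "smooth_bound x0 b \<gamma> (\<lambda>x. \<Sum>k\<in>I. block k f x) (real (card I) * C * A)" by (simp add: mult.assoc)
      have "has_bochner_integral M (\<lambda>x. \<Sum>k\<in>I. block k f x) (\<Sum>k\<in>I. 0)"
        using block_has_integral_zero[OF b \<gamma> f] by (intro has_bochner_integral_sum)
      then show "mean_zero (\<lambda>x. \<Sum>k\<in>I. block k f x)" by simp
    qed
    then show ?thesis using C(1) by (intro exI[of _ "real (card I) * C"]) auto
  qed
  obtain C where C: "0 \<le> C" "\<forall>f A. smooth_bound x0 \<beta> \<gamma> f A \<longrightarrow> mean_zero f \<longrightarrow>
      smooth_bound x0 \<beta> \<gamma> (\<lambda>x. \<Sum>k\<in>I. block k f x) (C * A) \<and> mean_zero (\<lambda>x. \<Sum>k\<in>I. block k f x)"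
    using bounded[OF \<beta>] by (elim exE conjE) (rule that)
  obtain C' where C': "0 \<le> C'" "\<forall>f A. smooth_bound x0 \<eta> \<gamma> f A \<longrightarrow> mean_zero f \<longrightarrow>
      smooth_bound x0 \<eta> \<gamma> (\<lambda>x. \<Sum>k\<in>I. block k f x) (C' * A) \<and> mean_zero (\<lambda>x. \<Sum>k\<in>I. block k f x)"
    using bounded[OF \<eta>_range(1) order_refl] by (elim exE conjE) (rule that)
  obtain A g B where f: "smooth_bound x0 \<beta> \<gamma> f A" "mean_zero f"
    and g: "\<forall>n. (\<exists>A. smooth_bound x0 \<eta> \<gamma> (g n) A) \<and> mean_zero (g n) \<and>
              smooth_bound x0 \<beta> \<gamma> (\<lambda>x. g n x - f x) (B n)" and B: "B \<longlonglongrightarrow> (0::real)"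
    using f unfolding completed_test_functions_iff[OF \<beta>] by (elim exE conjE) (rule that)
  have 1: "\<exists>A. smooth_bound x0 \<eta> \<gamma> (\<lambda>x. \<Sum>k\<in>I. block k (g n) x) A" "mean_zero (\<lambda>x. \<Sum>k\<in>I. block k (g n) x)" for n
    using C'(2) g by blast+
  have 2: "smooth_bound x0 \<beta> \<gamma> (\<lambda>x. (\<Sum>k\<in>I. block k (g n) x) - (\<Sum>k\<in>I. block k f x)) (C * B n)" for n
  proof -
    obtain A' where "smooth_bound x0 \<eta> \<gamma> (g n) A'" using g by auto
    then have gn: "smooth_bound x0 \<beta> \<gamma> (g n) A'" by (rule smooth_bound_embed) (use \<beta> in auto)
    have gn0: "mean_zero (g n)" using g by simp
    have "has_bochner_integral M (\<lambda>x. g n x - f x) (0 - 0)" using gn0 f(2) by (rule has_bochner_integral_diff)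
    then have "smooth_bound x0 \<beta> \<gamma> (\<lambda>x. \<Sum>k\<in>I. block k (\<lambda>x. g n x - f x) x) (C * B n)"
      using C(2) g by simp
    then show ?thesis using block_diff[OF \<beta> \<gamma> gn gn0 f] by (simp add: sum_subtractf)
  qed
  have "(\<lambda>n. C * B n) \<longlonglongrightarrow> C * 0" by (intro tendsto_mult tendsto_const B)
  then have 3: "(\<lambda>n. C * B n) \<longlonglongrightarrow> 0" by simp
  have 4: "\<forall>n. (\<exists>A. smooth_bound x0 \<eta> \<gamma> (\<lambda>x. \<Sum>k\<in>I. block k (g n) x) A) \<and>
     mean_zero (\<lambda>x. \<Sum>k\<in>I. block k (g n) x) \<and>
     smooth_bound x0 \<beta> \<gamma> (\<lambda>x. (\<Sum>k\<in>I. block k (g n) x) - (\<Sum>k\<in>I. block k f x)) (C * B n)"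
    using 1 2 by simp
  show ?thesis
    unfolding S completed_test_functions_iff[OF \<beta>]
    using C(2)[rule_format, OF f] 3 4
    by (intro conjI exI[of _ "C * A"] exI[of _ "\<lambda>n x. \<Sum>k\<in>I. block k (g n) x"] exI[of _ "\<lambda>n. C * B n"]) auto
qed

text \<open>The two-sided series of blocks converges geometrically to some \<open>h\<close>, and \<open>h - f\<close> is a continuous
square-integrable function orthogonal to the basis.\<close>

lemma partial_sums_converge:
  assumes \<beta>: "0 < \<beta>" "\<beta> \<le> \<eta>" and \<gamma>: "0 < \<gamma>" "\<gamma> < \<eta>"
    and f: "smooth_bound x0 \<beta> \<gamma> f A" "mean_zero f"
    and \<beta>': "0 < \<beta>'" "\<beta>' < \<beta>" and \<gamma>': "0 < \<gamma>'" "\<gamma>' < \<gamma>"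
  shows "\<exists>B. (\<forall>L. smooth_bound x0 \<beta>' \<gamma>' (\<lambda>x. wavelet_partial_sum M X \<psi> f L x - f x) (B L)) \<and> B \<longlonglongrightarrow> 0"
proof -
  define \<epsilon> where "\<epsilon> = min (\<beta> - \<beta>') (\<gamma> - \<gamma>')"
  define q where "q = \<delta> powr \<epsilon>"
  have \<epsilon>: "0 < \<epsilon>" "\<epsilon> \<le> \<beta> - \<beta>'" "\<epsilon> \<le> \<gamma> - \<gamma>'" using \<beta>' \<gamma>' by (auto simp: \<epsilon>_def)
  have "\<delta> powr \<epsilon> < 1 powr \<epsilon>" using \<delta>_range \<epsilon> by (intro powr_less_mono2) auto
  then have q: "0 < q" "q < 1" using \<delta>_range by (auto simp: q_def)
  obtain C where C: "0 \<le> C" "\<forall>f x0 A k \<beta>' \<gamma>' \<epsilon>. smooth_bound x0 \<beta> \<gamma> f A \<longrightarrow> mean_zero f \<longrightarrow>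
     0 < \<beta>' \<longrightarrow> \<beta>' \<le> \<beta> \<longrightarrow> 0 < \<gamma>' \<longrightarrow> 0 \<le> \<epsilon> \<longrightarrow> \<epsilon> \<le> \<beta> - \<beta>' \<longrightarrow> \<epsilon> \<le> \<gamma> - \<gamma>' \<longrightarrow>
     smooth_bound x0 \<beta>' \<gamma>' (block k f) (C * A * min (sc k) (1 / sc k) powr \<epsilon>)"
    using block_smooth_ex[OF \<beta> \<gamma>] by (elim exE conjE) (rule that)
  define K where "K = C * A"
  have K: "0 \<le> K" using C(1) smooth_bound_nonneg[OF f(1)] by (simp add: K_def)
  have sm: "smooth_bound x0 \<beta>' \<gamma>' (block k f) (K * q ^ nat \<bar>k\<bar>)" for k
    using C(2)[rule_format, OF f, where \<beta>' = \<beta>' and \<gamma>' = \<gamma>' and \<epsilon> = \<epsilon>] \<epsilon> \<beta>' \<gamma>'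
    by (simp add: K_def q_def scale_factor)
  define S where "S L x = (\<Sum>k = - int L..int L. block k f x)" for L x
  define dec where "dec x = decay x0 \<gamma>' (1 + d x x0)" for x
  have dec: "0 \<le> dec x" for x by (simp add: dec_def)
  have pt: "cmod (block k f x) \<le> (K * dec x) * q ^ nat \<bar>k\<bar>" for k x
    using smooth_bound_size[OF sm, of k x] by (simp add: dec_def mult_ac)
  note geo = two_sided_geometric_bounds[OF pt q, folded S_def]
  define h where "h x = lim (\<lambda>L. S L x)" for x
  have lim: "(\<lambda>L. S L x) \<longlonglongrightarrow> h x" for x
    using geo(1)[of x] by (simp add: h_def convergent_LIMSEQ_iff)
  have Sb: "cmod (S L x) \<le> 2 * (K * dec x) / (1 - q)" for L x by (rule geo(2))
  define E where "E L = 2 * K * q ^ Suc L / (1 - q)" for L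
  have err: "smooth_bound x0 \<beta>' \<gamma>' (\<lambda>x. S L x - h x) (E L)" for L
  proof (rule smooth_boundI)
    fix x y
    show "cmod (S L x - h x) \<le> E L * decay x0 \<gamma>' (1 + d x x0)"
      using geo(3)[OF lim, of L x] by (simp add: E_def dec_def mult_ac)
    assume near: "d x y < (1 + d x x0) / (2 * A0)"
    define Q where "Q = d x y powr \<beta>' * decay x0 (\<beta>' + \<gamma>') (1 + d x x0)"
    have "cmod (block k f x - block k f y) \<le> (K * Q) * q ^ nat \<bar>k\<bar>" for k
      using smooth_bound_diff_le[OF sm near, of k] by (simp add: Q_def mult_ac)
    note geo2 = two_sided_geometric_bounds(3)[OF this q]
    have "(\<lambda>L. \<Sum>k = - int L..int L. block k f x - block k f y) \<longlonglongrightarrow> h x - h y"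
      using tendsto_diff[OF lim[of x] lim[of y]] by (simp add: S_def sum_subtractf)
    from geo2[OF this, of L] have "cmod ((S L x - S L y) - (h x - h y)) \<le> 2 * (K * Q) * q ^ Suc L / (1 - q)"
      by (simp add: S_def sum_subtractf)
    moreover have "(S L x - S L y) - (h x - h y) = S L x - h x - (S L y - h y)" by simp
    ultimately show "cmod (S L x - h x - (S L y - h y)) \<le> E L * d x y powr \<beta>' * decay x0 (\<beta>' + \<gamma>') (1 + d x x0)"
      by (simp add: E_def Q_def mult_ac)
  qed
  have Smeas [measurable]: "S L \<in> borel_measurable M" for L
    unfolding S_def[abs_def] using block_has_integral_zero[OF \<beta> \<gamma> f] unfolding has_bochner_integral_iff
    by (intro borel_measurable_sum borel_measurable_integrable) blast
  have hmeas [measurable]: "h \<in> borel_measurable M"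
    by (rule borel_measurable_LIMSEQ_metric[OF Smeas]) (rule lim)
  have fmeas [measurable]: "f \<in> borel_measurable M" and fint: "integrable M f"
    using f(2) by (auto simp: has_bochner_integral_iff)
  have S0: "smooth_bound x0 \<beta>' \<gamma>' (S 0) K" using sm[of 0] by (simp add: S_def[abs_def])
  have hs: "smooth_bound x0 \<beta>' \<gamma>' h (K + E 0)" using smooth_bound_diff[OF S0 err[of 0]] by simp
  have fs: "smooth_bound x0 \<beta>' \<gamma>' f A" by (rule smooth_bound_embed[OF f(1)]) (use \<beta>' \<gamma>' in auto)
  define K3 where "K3 = K + E 0 + A"
  define g where "g x = h x - f x" for x
  have gs: "smooth_bound x0 \<beta>' \<gamma>' g K3" unfolding g_def[abs_def] K3_def by (rule smooth_bound_diff[OF hs fs])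
  have gmeas [measurable]: "g \<in> borel_measurable M" unfolding g_def[abs_def] by measurable
  have idec: "integrable M dec" unfolding dec_def[abs_def] by (rule integrable_decay[OF \<gamma>'(1)])
  have hint: "integrable M h"
  proof (rule norm_integral_le_dominated(1))
    show "integrable M (\<lambda>x. (K + E 0) * dec x)" using idec by simp
    show "cmod (h x) \<le> (K + E 0) * dec x" for x using smooth_bound_size[OF hs, of x] by (simp add: dec_def)
  qed measurable
  have K3: "0 \<le> K3" using gs by (rule smooth_bound_nonneg)
  have g2: "square_integrable M g"
    unfolding square_integrable_def
  proof
    show "integrable M (\<lambda>x. (cmod (g x))\<^sup>2)"
    proof (rule Bochner_Integration.integrable_bound)
      show "integrable M (\<lambda>x. K3\<^sup>2 * decay x0 \<gamma>' 1 * dec x)" using idec by simp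
      have "(cmod (g x))\<^sup>2 \<le> K3\<^sup>2 * decay x0 \<gamma>' 1 * dec x" for x
      proof -
        have "(cmod (g x))\<^sup>2 \<le> (K3 * dec x)\<^sup>2"
          using smooth_bound_size[OF gs, of x] by (intro power_mono) (auto simp: dec_def)
        also have "\<dots> = K3\<^sup>2 * dec x * dec x" by (simp add: power2_eq_square)
        also have "\<dots> \<le> K3\<^sup>2 * decay x0 \<gamma>' 1 * dec x"
          using dec \<gamma>' d_nonneg by (intro mult_right_mono mult_left_mono) (auto simp: dec_def intro!: decay_antimono)
        finally show ?thesis .
      qed
      then show "AE x in M. norm ((cmod (g x))\<^sup>2) \<le> norm (K3\<^sup>2 * decay x0 \<gamma>' 1 * dec x)"
        using dec by simp
    qed measurable
  qed measurable
  have "AE x in M. g x = 0"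
  proof (rule orthogonal_to_basis_imp_AE_zero[OF basis g2])
    fix i assume "i \<in> (SIGMA k:UNIV. new_points X k)"
    then obtain k y where i: "i = (k, y)" and y: "y \<in> new_points X k" by auto
    obtain b where b: "0 \<le> b" "\<And>z. cmod (\<psi> k y z) \<le> b" using wavelet_bounded[OF y] by blast
    have [measurable]: "\<psi> k y \<in> borel_measurable M" using wavelet_integrable[OF y] by auto
    have "(\<lambda>L. LINT z|M. S L z * cnj (\<psi> k y z)) \<longlonglongrightarrow> (LINT z|M. h z * cnj (\<psi> k y z))"
    proof (rule integral_dominated_convergence[where w = "\<lambda>z. 2 * (K * dec z) / (1 - q) * b"])
      show "integrable M (\<lambda>z. 2 * (K * dec z) / (1 - q) * b)" using idec by simp
      show "AE z in M. (\<lambda>L. S L z * cnj (\<psi> k y z)) \<longlonglongrightarrow> h z * cnj (\<psi> k y z)"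
        by (intro AE_I2 tendsto_mult tendsto_const lim)
      fix L
      show "AE z in M. norm (S L z * cnj (\<psi> k y z)) \<le> 2 * (K * dec z) / (1 - q) * b"
      proof (rule AE_I2)
        fix z
        show "norm (S L z * cnj (\<psi> k y z)) \<le> 2 * (K * dec z) / (1 - q) * b"
          unfolding norm_mult complex_mod_cnj using Sb[of L z] b order_trans[OF norm_ge_zero Sb[of L z]]
          by (intro mult_mono) auto
      qed
    qed measurable
    moreover have "(\<lambda>L. LINT z|M. S L z * cnj (\<psi> k y z)) \<longlonglongrightarrow> coef f k y"
    proof (rule tendsto_eventually)
      have "(LINT z|M. S L z * cnj (\<psi> k y z)) = coef f k y" if L: "nat \<bar>k\<bar> \<le> L" for L
      proof -
        have "(LINT z|M. S L z * cnj (\<psi> k y z)) = (LINT z|M. (\<Sum>j = - int L..int L. block j f z * cnj (\<psi> k y z)))"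
          by (simp add: S_def sum_distrib_right)
        also have "\<dots> = (\<Sum>j = - int L..int L. (LINT z|M. block j f z * cnj (\<psi> k y z)))"
          by (intro Bochner_Integration.integral_sum block_inner_wavelet(1)[OF \<beta> \<gamma> f y])
        also have "\<dots> = (\<Sum>j = - int L..int L. if j = k then coef f k y else 0)"
          using block_inner_wavelet(2)[OF \<beta> \<gamma> f y] by (simp add: l2_inner_def[of M "block _ f"])
        also have "\<dots> = coef f k y" using L by (subst sum.delta) auto
        finally show ?thesis .
      qed
      then show "\<forall>\<^sub>F L in sequentially. (LINT z|M. S L z * cnj (\<psi> k y z)) = coef f k y"
        unfolding eventually_sequentially by blast
    qed
    ultimately have eq: "(LINT z|M. h z * cnj (\<psi> k y z)) = coef f k y" by (rule LIMSEQ_unique)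
    have "l2_inner M g (\<psi> k y) = (LINT z|M. h z * cnj (\<psi> k y z)) - coef f k y"
      unfolding l2_inner_def g_def left_diff_distrib
      by (intro Bochner_Integration.integral_diff l2_inner_wavelet_integrable hint fint y)
    then show "l2_inner M g (case i of (k, y) \<Rightarrow> \<psi> k y) = 0" using eq by (simp add: i)
  qed
  then have "g x = 0" for x using smooth_AE_zero_imp_zero[OF gs \<beta>'(1)] by blast
  then have hf: "h x = f x" for x by (simp add: g_def)
  have "smooth_bound x0 \<beta>' \<gamma>' (\<lambda>x. wavelet_partial_sum M X \<psi> f L x - f x) (E L)" for L
    using err[of L] by (simp add: hf S_def partial_sum_blocks)
  moreover have "E \<longlonglongrightarrow> 0"
  proof -
    have "(\<lambda>L. 2 * K * q ^ Suc L / (1 - q)) \<longlonglongrightarrow> 2 * K * 0 / (1 - q)"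
      using q by (intro tendsto_divide tendsto_mult tendsto_const LIMSEQ_Suc[OF LIMSEQ_power_zero]) auto
    then show ?thesis by (simp add: E_def[abs_def])
  qed
  ultimately show ?thesis by blast
qed

end

theorem theorem3p4:
  fixes d :: "'a \<Rightarrow> 'a \<Rightarrow> real" and A0 :: real and M :: "'a measure"
    and \<delta> \<eta> \<beta> \<gamma> :: real
    and X :: "int \<Rightarrow> 'a set"
    and \<psi> :: "int \<Rightarrow> 'a \<Rightarrow> 'a \<Rightarrow> complex"
    and x0 :: 'a
    and f :: "'a \<Rightarrow> complex"
  assumes "wavelet_basis d A0 M \<delta> X \<eta> \<psi>"
    and "0 < \<beta>" "\<beta> < \<eta>" and "0 < \<gamma>" "\<gamma> < \<eta>"
    and "f \<in> completed_test_functions d A0 M \<eta> x0 \<beta> \<gamma>"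
  shows "(\<forall>k x. (\<lambda>y. l2_inner M f (\<psi> k y) * \<psi> k y x) summable_on new_points X k) \<and>
    (\<forall>\<beta>' \<gamma>'. 0 < \<beta>' \<and> \<beta>' < \<beta> \<and> 0 < \<gamma>' \<and> \<gamma>' < \<gamma> \<longrightarrow>
      f \<in> completed_test_functions d A0 M \<eta> x0 \<beta>' \<gamma>' \<and>
      (\<forall>L. wavelet_partial_sum M X \<psi> f L \<in> completed_test_functions d A0 M \<eta> x0 \<beta>' \<gamma>') \<and>
      (\<lambda>L. test_norm d A0 M x0 1 \<beta>' \<gamma>' (\<lambda>x. wavelet_partial_sum M X \<psi> f L x - f x)) \<longlonglongrightarrow> 0)"
proof -
  interpret wavelet_basis d A0 M \<delta> X \<eta> \<psi> by (rule assms(1))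
  obtain D \<omega> where "1 \<le> D" "0 \<le> \<omega>"
    "\<forall>x r l. 0 < r \<longrightarrow> 1 \<le> l \<longrightarrow> vol d M (l * r) x \<le> D * l powr \<omega> * vol d M r x"
    using V_growth_ex by (elim exE conjE) (rule that)
  then interpret wavelet_growth d A0 M \<delta> X \<eta> \<psi> D \<omega> by unfold_locales auto
  have \<beta>: "0 < \<beta>" "\<beta> \<le> \<eta>" and \<gamma>: "0 < \<gamma>" "\<gamma> < \<eta>" using assms by auto
  obtain A where f: "smooth_bound x0 \<beta> \<gamma> f A" "mean_zero f"
    using assms(6) unfolding completed_test_functions_iff[OF \<beta>] by (elim exE conjE) (rule that)
  show ?thesis
  proof (intro conjI allI impI)
    fix k x
    show "(\<lambda>y. l2_inner M f (\<psi> k y) * \<psi> k y x) summable_on new_points X k"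
      by (rule wavelet_sum_summable[OF \<beta> \<gamma> f])
  next
    fix \<beta>' \<gamma>' assume *: "0 < \<beta>' \<and> \<beta>' < \<beta> \<and> 0 < \<gamma>' \<and> \<gamma>' < \<gamma>"
    show "f \<in> completed_test_functions d A0 M \<eta> x0 \<beta>' \<gamma>'"
      by (rule completed_test_functions_embed[OF assms(6)]) (use * \<beta> in auto)
    show "wavelet_partial_sum M X \<psi> f L \<in> completed_test_functions d A0 M \<eta> x0 \<beta>' \<gamma>'" for L
      by (rule completed_test_functions_embed[OF partial_sum_completed[OF \<beta> \<gamma> assms(6)]]) (use * \<beta> in auto)
    obtain B where B: "\<forall>L. smooth_bound x0 \<beta>' \<gamma>' (\<lambda>x. wavelet_partial_sum M X \<psi> f L x - f x) (B L)" "B \<longlonglongrightarrow> 0"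
      using partial_sums_converge[OF \<beta> \<gamma> f, of \<beta>' \<gamma>'] * by (elim conjE) (blast intro: that)
    show "(\<lambda>L. test_norm d A0 M x0 1 \<beta>' \<gamma>' (\<lambda>x. wavelet_partial_sum M X \<psi> f L x - f x)) \<longlonglongrightarrow> 0"
      by (rule test_norm_tendsto_zeroI[OF _ B(2)]) (use B(1) in simp)
  qed
qed

end
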